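(* Let $\mathscr{O}_{1,1}=\mathscr{O}_{1,1}^{(N)}$ be the diagonal overlap associated to the eigenvalue $\lambda_1$ of the $N\times N$ quaternionic Ginibre ensemble. Conditionally on $\{\lambda_1=0\}$, as $N\to\infty$, $$\frac{1}{2N}\mathscr{O}_{1,1}\xrightarrow{\ d\ }\gamma_4^{-1},$$ where $\gamma_4$ is a gamma random variable with parameter $4$ and the convergence is in distribution.
   Context: $\mu$ denotes the standard complex Gaussian measure $d\mu(z)=\frac1\pi e^{-|z|^2}dm(z)$ on $\mathbb{C}$. A gamma variable with parameter $\alpha>0$ has density $\frac1{\Gamma(\alpha)}t^{\alpha-1}e^{-t}$ on $(0,\infty)$. The (unscaled) quaternionic Ginibre matrix $G$ is the $2N\times 2N$ complex matrix made of $N^2$ independent $2\times2$ blocks $\begin{pmatrix} z&-\overline w\\ w&\overline z\end{pmatrix}$ with $z,w$ i.i.d. standard complex Gaussian. Its eigenvalues form $N$ complex conjugate pairs, with labelled representatives $(\lambda_1,\dots,\lambda_N)$ of joint law proportional to $\prod_{i<j}|\lambda_i-\lambda_j|^2\prod_{i\le j}|\lambda_i-\overline{\lambda_j}|^2\,d\mu^N$. Schur form (known fact): $G$ is unitarily equivalent to a block upper-triangular matrix $S$ with $2\times 2$ diagonal blocks $\mathrm{diag}(\lambda_i,\overline{\lambda_i})$ and upper-diagonal blocks $T_{i,j}=\begin{pmatrix}u_{i,j}&v_{i,j}\\-\overline{v_{i,j}}&\overline{u_{i,j}}\end{pmatrix}$, $i<j$, where all $u_{i,j},v_{i,j}$ are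 i.i.d. standard complex Gaussian variables, independent of the diagonal blocks. Statistics of eigenvectors are computed on $S$. Conditioning on $\{\lambda_1=0\}$ means: $\lambda_1=0$, the vector $(\lambda_2,\dots,\lambda_N)$ has the conditional law given $\lambda_1=w$ ($w\in\mathbb{C}\setminus\mathbb{R}$) extended by continuity to $w=0$, i.e. the law proportional to $\prod_{i=2}^N|\lambda_i|^4\prod_{2\le i<j\le N}|\lambda_i-\lambda_j|^2\prod_{2\le i\le j\le N}|\lambda_i-\overline{\lambda_j}|^2\,d\mu^{N-1}(\lambda_2,\dots,\lambda_N)$, and the blocks $T_{i,j}=\begin{pmatrix}u_{i,j}&v_{i,j}\\-\overline{v_{i,j}}&\overline{u_{i,j}}\end{pmatrix}$, $i<j$, have all $u_{i,j},v_{i,j}$ i.i.d. standard complex Gaussian, independent of the $\lambda_i$. Diagonal overlap: for $L_i,R_i$ biorthogonal left and right eigenvectors ($L_iR_j=\delta_{i,j}$), $\mathscr{O}_{1,1}=\mathscr{O}(\lambda_1,\lambda_1)=\|R_1\|^2\|L_1\|^2$. When $\lambda_1=0$ the eigenvalues $\lambda_1,\overline{\lambda_1}$ coincide, and one fixes the reference eigenvectors of $S$: the right eigenvector $R_1=(1,0,\dots,0)^T$, and the left eigenvector $L_1=(1,0,b_3,\dots,b_{2N})$, where $b_3,\dots,b_{2N}$ are determined by $L_1S=0$. This quantity is invariant under scaling of $G$. *)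

theory Defs
  imports "HOL-Probability.Probability" "Jordan_Normal_Form.Matrix"
begin

unbundle no vec_syntax
no_notation inner (infix \<open>\<bullet>\<close> 70)

definition std_complex_gaussian :: "complex measure" where
  "std_complex_gaussian = density lborel (\<lambda>z. ennreal (exp (- (cmod z)\<^sup>2) / pi))"

definition gamma_density :: "real \<Rightarrow> real \<Rightarrow> real" where
  "gamma_density \<alpha> t =
     (if 0 < t then t powr (\<alpha> - 1) * exp (- t) / Gamma \<alpha> else 0)"

text \<open>
  Matrix blocks and eigenvalues are indexed by \<open>1, \<dots>, N\<close>; entries of vectors and matrices
  are indexed from \<open>0\<close>, so that block \<open>i\<close> occupies the indices \<open>2 * (i - 1)\<close> and \<open>2 * i - 1\<close>.
\<close>

text \<open>
  Weight, with respect to the Gaussian product measure, of the remaining eigenvalues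
  \<open>\<lambda>\<^sub>2, \<dots>, \<lambda>\<^sub>N\<close> given \<open>\<lambda>\<^sub>1 = w\<close>, extended by continuity from non-real \<open>w\<close> to \<open>w = 0\<close>:
  the factors \<open>\<bar>w - \<lambda>\<^sub>i\<bar>\<^sup>2\<close> and \<open>\<bar>w - cnj \<lambda>\<^sub>i\<bar>\<^sup>2\<close> merge into \<open>\<bar>\<lambda>\<^sub>i\<bar>\<^sup>4\<close>, and the factor
  \<open>\<bar>w - cnj w\<bar>\<^sup>2\<close> cancels in the normalization.
\<close>

definition cond_eigenvalue_weight :: "nat \<Rightarrow> (nat \<Rightarrow> complex) \<Rightarrow> real" where
  "cond_eigenvalue_weight N lam =
     (\<Prod>i\<in>{2..N}. cmod (lam i) ^ 4) *
     (\<Prod>i\<in>{2..N}. \<Prod>j\<in>{i<..N}. (cmod (lam i - lam j))\<^sup>2) *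
     (\<Prod>i\<in>{2..N}. \<Prod>j\<in>{i..N}. (cmod (lam i - cnj (lam j)))\<^sup>2)"

definition cond_eigenvalue_law :: "nat \<Rightarrow> (nat \<Rightarrow> complex) measure" where
  "cond_eigenvalue_law N =
     (let \<mu> = (\<Pi>\<^sub>M i\<in>{2..N}. std_complex_gaussian) in
      density \<mu> (\<lambda>lam. ennreal (cond_eigenvalue_weight N lam) /
                        (\<integral>\<^sup>+ x. ennreal (cond_eigenvalue_weight N x) \<partial>\<mu>)))"

definition upper_pairs :: "nat \<Rightarrow> (nat \<times> nat) set" where
  "upper_pairs N = {(i, j). 1 \<le> i \<and> i < j \<and> j \<le> N}"

definition upper_gaussian_law :: "nat \<Rightarrow> (nat \<times> nat \<Rightarrow> complex) measure" where
  "upper_gaussian_law N = (\<Pi>\<^sub>M p\<in>upper_pairs N. std_complex_gaussian)"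

text \<open>Joint law of \<open>(\<lambda>\<^sub>2, \<dots>, \<lambda>\<^sub>N)\<close>, the \<open>u\<^sub>i\<^sub>,\<^sub>j\<close> and the \<open>v\<^sub>i\<^sub>,\<^sub>j\<close> conditionally on \<open>\<lambda>\<^sub>1 = 0\<close>.\<close>

definition cond_schur_law ::
    "nat \<Rightarrow> ((nat \<Rightarrow> complex) \<times> (nat \<times> nat \<Rightarrow> complex) \<times> (nat \<times> nat \<Rightarrow> complex)) measure" where
  "cond_schur_law N =
     cond_eigenvalue_law N \<Otimes>\<^sub>M (upper_gaussian_law N \<Otimes>\<^sub>M upper_gaussian_law N)"

definition schur_block ::
    "(nat \<Rightarrow> complex) \<Rightarrow> (nat \<times> nat \<Rightarrow> complex) \<Rightarrow> (nat \<times> nat \<Rightarrow> complex) \<Rightarrow>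
      nat \<Rightarrow> nat \<Rightarrow> complex mat" where
  "schur_block lam u v i j =
     (if i = j then mat_of_rows_list 2 [[lam i, 0], [0, cnj (lam i)]]
      else if i < j then mat_of_rows_list 2 [[u (i, j), v (i, j)], [- cnj (v (i, j)), cnj (u (i, j))]]
      else 0\<^sub>m 2 2)"

definition schur_matrix ::
    "nat \<Rightarrow> (nat \<Rightarrow> complex) \<Rightarrow> (nat \<times> nat \<Rightarrow> complex) \<Rightarrow> (nat \<times> nat \<Rightarrow> complex) \<Rightarrow> complex mat" where
  "schur_matrix N lam u v =
     mat (2 * N) (2 * N)
       (\<lambda>(r, c). schur_block lam u v (r div 2 + 1) (c div 2 + 1) $$ (r mod 2, c mod 2))"

definition vec_sq_norm :: "complex vec \<Rightarrow> real" where
  "vec_sq_norm x = (\<Sum>k<dim_vec x. (cmod (x $ k))\<^sup>2)"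

definition reference_right_eigenvector :: "nat \<Rightarrow> complex vec" where
  "reference_right_eigenvector N = unit_vec (2 * N) 0"

text \<open>
  When \<open>\<lambda>\<^sub>1 = 0\<close> and \<open>\<lambda>\<^sub>2, \<dots>, \<lambda>\<^sub>N\<close> are nonzero, the left null vector of \<open>S\<close> with first two
  entries \<open>1, 0\<close> exists and is unique, by forward substitution over the column blocks.
\<close>

definition reference_left_eigenvector :: "nat \<Rightarrow> complex mat \<Rightarrow> complex vec" where
  "reference_left_eigenvector N S =
     (THE L. L \<in> carrier_vec (2 * N) \<and> L $ 0 = 1 \<and> L $ 1 = 0 \<and>
             mat_of_row L * S = 0\<^sub>m 1 (2 * N))"

text \<open>
  Diagonal overlap at \<open>\<lambda>\<^sub>1 = 0\<close>. On the null event that some \<open>\<lambda>\<^sub>i\<close> with \<open>i \<ge> 2\<close> vanishes, the left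
  eigenvector need not be determined and the overlap is set to \<open>0\<close>; leaving it to \<open>THE\<close>
  there could make the overlap nonmeasurable.
\<close>

definition diagonal_overlap ::
    "nat \<Rightarrow> (nat \<Rightarrow> complex) \<times> (nat \<times> nat \<Rightarrow> complex) \<times> (nat \<times> nat \<Rightarrow> complex) \<Rightarrow> real" where
  "diagonal_overlap N = (\<lambda>(lam, u, v).
     if \<forall>i\<in>{2..N}. lam i \<noteq> 0
     then vec_sq_norm (reference_right_eigenvector N) *
          vec_sq_norm (reference_left_eigenvector N (schur_matrix N (lam(1 := 0)) u v))
     else 0)"

end

theory Submission
  imports Defs "Jordan_Normal_Form.Determinant" "HOL-Real_Asymp.Real_Asymp"
begin

text \<open>
  The left eigenvector \<open>L\<close> is built block by block. Write \<open>L = (B\<^sub>1, \<dots>, B\<^sub>N)\<close> with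
  \<open>B\<^sub>1 = (1, 0)\<close> and each \<open>B\<^sub>j\<close> a row of length two. Column block \<open>j\<close> of \<open>L S = 0\<close> reads
  \<open>B\<^sub>j diag(\<lambda>\<^sub>j, cnj \<lambda>\<^sub>j) = - (\<Sum>i<j. B\<^sub>i T\<^sub>i\<^sub>j)\<close>. The blocks \<open>T\<^sub>i\<^sub>j\<close> are quaternions, so right
  multiplication by a Gaussian \<open>T\<^sub>i\<^sub>j\<close> turns \<open>B\<^sub>i\<close> into \<open>\<bar>B\<^sub>i\<bar>\<close> times a standard Gaussian pair
  (\<open>nn_integral_gaussian_quaternion\<close>). Conditionally on the eigenvalues and on the earlier columns,
  the sum over \<open>i < j\<close> is therefore a standard Gaussian pair scaled by \<open>\<bar>(B\<^sub>1, \<dots>, B\<^bsub>j-1\<^esub>)\<bar>\<close>, and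
  the squared norm of \<open>L\<close>, which is the overlap, is a product of independent factors
  \<open>1 + X\<^sub>j / \<bar>\<lambda>\<^sub>j\<bar>\<^sup>2\<close> with \<open>X\<^sub>j\<close> gamma distributed of parameter two (\<open>nn_integral_left_sq_norm\<close>).

  Consequently the conditional expectation of a power of the inverse overlap, given the eigenvalues,
  is a product of one function of each \<open>\<bar>\<lambda>\<^sub>j\<bar>\<^sup>2\<close>. Expectations of such products are computed by a
  quaternionic version of Kostlan's theorem: the eigenvalue weight is the Vandermonde product of
  \<open>\<lambda>\<^sub>2, cnj \<lambda>\<^sub>2, \<lambda>\<^sub>3, cnj \<lambda>\<^sub>3, \<dots>\<close> multiplied by one factor per eigenvalue. After the Leibniz
  expansion, integrating out the angles keeps only those permutations that send every pair of
  positions \<open>2i, 2i + 1\<close> to a pair of adjacent exponents. Adjacent pairs can tile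
  \<open>{0..<2n}\<close> in just one way, so every surviving term is the same product of radial moments up to a
  sign (\<open>radial_product_expansion\<close>). In other words, as far as product functions are concerned, the
  \<open>\<bar>\<lambda>\<^sub>j\<bar>\<^sup>2\<close> behave as independent gamma variables of parameters \<open>4, 6, \<dots>, 2N\<close>.

  If \<open>Y\<close> and \<open>X\<close> are independent gamma variables of parameters \<open>a\<close> and \<open>2\<close>, then \<open>Y / (Y + X)\<close> is
  beta distributed of parameters \<open>a\<close> and \<open>2\<close>, and the moments of these beta variables for
  \<open>a = 4, 6, \<dots>, 2N\<close> telescope. All moments of the inverse overlap thus agree with those of the beta
  distribution of parameters \<open>4\<close> and \<open>2N - 2\<close>. Moments determine a distribution on \<open>[0, 1]\<close>
  (\<open>integral_eq_of_moments_eq\<close>), so this is its law. The density of \<open>2N\<close> times such a beta variable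
  converges, with an integrable bound, to the gamma density of parameter four, and taking inverses
  preserves convergence in distribution because the limit has no atom at zero.
\<close>

section \<open>Rotation invariance of Lebesgue measure\<close>

lemma lborel_complex_eq: "(lborel :: complex measure)
    = distr (lborel \<Otimes>\<^sub>M lborel) borel (\<lambda>(x, y). Complex x y)"
proof (rule lborel_eqI)
  have m[measurable]: "(\<lambda>(x, y). Complex x y) \<in> borel_measurable (lborel \<Otimes>\<^sub>M lborel)"
    unfolding Complex_eq by measurable
  fix l u :: complex assume le: "\<And>b. b \<in> Basis \<Longrightarrow> inner l b \<le> inner u b"
  have le': "Re l \<le> Re u" "Im l \<le> Im u"
    using le[of 1] le[of \<i>] by (auto simp: Basis_complex_def)
  have "(\<lambda>(x, y). Complex x y) -` box l u \<inter> space (lborel \<Otimes>\<^sub>M lborel)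
      = box (Re l) (Re u) \<times> box (Im l) (Im u)"
    by (auto simp: box_def Basis_complex_def space_pair_measure)
  then show "emeasure (distr (lborel \<Otimes>\<^sub>M lborel) borel (\<lambda>(x, y). Complex x y)) (box l u)
      = ennreal (\<Prod>b\<in>Basis. inner (u - l) b)"
    using le' by (simp add: emeasure_distr lborel.emeasure_pair_measure_Times Basis_complex_def
        ennreal_mult)
qed simp

lemma borel_measurable_Complex[measurable]:
  "(\<lambda>(x, y). Complex x y) \<in> borel_measurable (borel \<Otimes>\<^sub>M borel)"
  unfolding Complex_eq by measurable

lemma nn_integral_lborel_complex:
  assumes [measurable]: "f \<in> borel_measurable borel"
  shows "(\<integral>\<^sup>+ z. f z \<partial>(lborel :: complex measure)) = (\<integral>\<^sup>+ x. \<integral>\<^sup>+ y. f (Complex x y) \<partial>lborel \<partial>lborel)"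
  by (subst lborel_complex_eq, subst nn_integral_distr)
    (auto simp: case_prod_unfold simp flip: lborel.nn_integral_fst)

lemma nn_integral_translate:
  fixes f :: "'a::euclidean_space \<Rightarrow> ennreal"
  assumes [measurable]: "f \<in> borel_measurable borel"
  shows "(\<integral>\<^sup>+ x. f (x + c) \<partial>lborel) = (\<integral>\<^sup>+ x. f x \<partial>lborel)"
  by (subst (2) lborel_distr_plus[of c, symmetric], subst nn_integral_distr) (auto simp: add.commute)

lemma nn_integral_shear_fst:
  fixes F :: "'a::euclidean_space \<times> 'b::euclidean_space \<Rightarrow> ennreal"
  assumes [measurable]: "F \<in> borel_measurable (borel \<Otimes>\<^sub>M borel)" "h \<in> borel_measurable borel"
  shows "(\<integral>\<^sup>+ x. \<integral>\<^sup>+ y. F (x + h y, y) \<partial>lborel \<partial>lborel) = (\<integral>\<^sup>+ x. \<integral>\<^sup>+ y. F (x, y) \<partial>lborel \<partial>lborel)"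
proof -
  have "(\<integral>\<^sup>+ x. \<integral>\<^sup>+ y. F (x + h y, y) \<partial>lborel \<partial>lborel) = (\<integral>\<^sup>+ y. \<integral>\<^sup>+ x. F (x + h y, y) \<partial>lborel \<partial>lborel)"
    by (rule lborel_pair.Fubini'[symmetric]) measurable
  also have "\<dots> = (\<integral>\<^sup>+ y. \<integral>\<^sup>+ x. F (x, y) \<partial>lborel \<partial>lborel)"
    by (intro nn_integral_cong nn_integral_translate[where f = "\<lambda>x. F (x, _)"]) measurable
  also have "\<dots> = (\<integral>\<^sup>+ x. \<integral>\<^sup>+ y. F (x, y) \<partial>lborel \<partial>lborel)"
    by (rule lborel_pair.Fubini') measurable
  finally show ?thesis .
qed

lemma nn_integral_shear_snd:
  fixes F :: "'a::euclidean_space \<times> 'b::euclidean_space \<Rightarrow> ennreal"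
  assumes [measurable]: "F \<in> borel_measurable (borel \<Otimes>\<^sub>M borel)" "h \<in> borel_measurable borel"
  shows "(\<integral>\<^sup>+ x. \<integral>\<^sup>+ y. F (x, y + h x) \<partial>lborel \<partial>lborel) = (\<integral>\<^sup>+ x. \<integral>\<^sup>+ y. F (x, y) \<partial>lborel \<partial>lborel)"
  by (intro nn_integral_cong nn_integral_translate[where f = "\<lambda>y. F (_, y)"]) measurable

text \<open>
  A plane rotation is a product of three shears, and a shear preserves Lebesgue measure because it
  translates each fibre.
\<close>

lemma nn_integral_three_shears:
  fixes F :: "'a::euclidean_space \<times> 'b::euclidean_space \<Rightarrow> ennreal"
  assumes [measurable]: "F \<in> borel_measurable (borel \<Otimes>\<^sub>M borel)" "h \<in> borel_measurable borel"
      "k \<in> borel_measurable borel"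
  shows "(\<integral>\<^sup>+ x. \<integral>\<^sup>+ y. F (x + h y + h (y + k (x + h y)), y + k (x + h y)) \<partial>lborel \<partial>lborel)
      = (\<integral>\<^sup>+ x. \<integral>\<^sup>+ y. F (x, y) \<partial>lborel \<partial>lborel)"
proof -
  let ?G = "\<lambda>(x, y). F (x + h y, y)"
  let ?H = "\<lambda>(x, y). ?G (x, y + k x)"
  have "(\<integral>\<^sup>+ x. \<integral>\<^sup>+ y. F (x + h y + h (y + k (x + h y)), y + k (x + h y)) \<partial>lborel \<partial>lborel)
    = (\<integral>\<^sup>+ x. \<integral>\<^sup>+ y. ?H (x + h y, y) \<partial>lborel \<partial>lborel)"
    by simp
  also have "\<dots> = (\<integral>\<^sup>+ x. \<integral>\<^sup>+ y. ?H (x, y) \<partial>lborel \<partial>lborel)"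
    by (rule nn_integral_shear_fst) measurable
  also have "\<dots> = (\<integral>\<^sup>+ x. \<integral>\<^sup>+ y. ?G (x, y + k x) \<partial>lborel \<partial>lborel)"
    by simp
  also have "\<dots> = (\<integral>\<^sup>+ x. \<integral>\<^sup>+ y. ?G (x, y) \<partial>lborel \<partial>lborel)"
    by (rule nn_integral_shear_snd) measurable
  also have "\<dots> = (\<integral>\<^sup>+ x. \<integral>\<^sup>+ y. F (x, y) \<partial>lborel \<partial>lborel)"
    using nn_integral_shear_fst[of F h] by simp
  finally show ?thesis .
qed

text \<open>
  The three-shear factorization divides by the sine of the angle; multiplication by \<open>1\<close> or \<open>-1\<close> is
  first written as a product of two rotations with nonzero sine.
\<close>

lemma nn_integral_complex_rotate:
  assumes [measurable]: "f \<in> borel_measurable borel" and w: "cmod w = 1"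
  shows "(\<integral>\<^sup>+ z. f (w * z) \<partial>lborel) = (\<integral>\<^sup>+ z. f z \<partial>lborel)"
proof -
  have *: "(\<integral>\<^sup>+ z. f (w * z) \<partial>lborel) = (\<integral>\<^sup>+ z. f z \<partial>lborel)"
    if w: "cmod w = 1" "Im w \<noteq> 0" and [measurable]: "f \<in> borel_measurable borel" for w f
  proof -
    define c s where "c = Re w" and "s = Im w"
    have s: "s \<noteq> 0" and cs: "c * c + s * s = 1"
      using w by (auto simp: c_def s_def cmod_def power2_eq_square)
    (* minus the tangent of half the angle *)
    define d where "d = (c - 1) / s"
    have d: "d * s = c - 1" using s by (simp add: d_def)
    have d': "d * c = - s - d"
    proof -
      have "s * (d * c + s + d) = (d * s) * c + s * s + d * s" by (simp add: algebra_simps)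
      also have "\<dots> = 0" unfolding d using cs by (simp add: algebra_simps)
      finally show ?thesis using s by simp
    qed
    have "(\<integral>\<^sup>+ x. \<integral>\<^sup>+ y. f (w * Complex x y) \<partial>lborel \<partial>lborel) =
      (\<integral>\<^sup>+ x. \<integral>\<^sup>+ y. case_prod (\<lambda>x y. f (Complex x y))
          (x + d * y + d * (y + s * (x + d * y)), y + s * (x + d * y)) \<partial>lborel \<partial>lborel)"
    proof (intro nn_integral_cong)
      fix x y :: real
      have "y + s * (x + d * y) = s * x + (1 + d * s) * y" by (simp add: algebra_simps)
      then have "y + s * (x + d * y) = s * x + c * y" using d by simp
      moreover have "x + d * y + d * (s * x + c * y) = c * x - s * y"
      proof -
        have "x + d * y + d * (s * x + c * y) = x + d * y + (d * s) * x + (d * c) * y"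
            by (simp add: algebra_simps)
        then show ?thesis unfolding d d' by (simp add: algebra_simps)
      qed
      moreover have "w * Complex x y = Complex (c * x - s * y) (s * x + c * y)"
        by (simp add: complex_eq_iff c_def s_def)
      ultimately show "f (w * Complex x y)
          = case_prod (\<lambda>x y. f (Complex x y)) (x + d * y + d * (y + s * (x + d * y)), y + s * (x + d * y))"
        by simp
    qed
    also have "\<dots> = (\<integral>\<^sup>+ x. \<integral>\<^sup>+ y. case_prod (\<lambda>x y. f (Complex x y)) (x, y) \<partial>lborel \<partial>lborel)"
      by (rule nn_integral_three_shears) measurable
    finally show ?thesis
      by (simp add: nn_integral_lborel_complex)
  qed
  show ?thesis
  proof (cases "Im w = 0")
    case False then show ?thesis using * w by simp
  next
    case True
    (* w = \<i> * v, and both factors have nonzero imaginary part *)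
    define v where "v = - \<i> * w"
    have v: "cmod v = 1" "Im v \<noteq> 0" using w True by (auto simp: v_def norm_mult cmod_def)
    have "(\<integral>\<^sup>+ z. f (w * z) \<partial>lborel) = (\<integral>\<^sup>+ z. f (\<i> * (v * z)) \<partial>lborel)"
      by (simp add: v_def mult.assoc[symmetric])
    also have "\<dots> = (\<integral>\<^sup>+ z. f (\<i> * z) \<partial>lborel)"
      by (rule *[OF v]) measurable
    also have "\<dots> = (\<integral>\<^sup>+ z. f z \<partial>lborel)"
      by (rule *) auto
    finally show ?thesis .
  qed
qed

section \<open>The complex Gaussian measure and its invariance\<close>

abbreviation "\<nu> \<equiv> std_complex_gaussian"

lemma sets_std_complex_gaussian[simp, measurable_cong]: "sets \<nu> = sets borel"
  by (simp add: std_complex_gaussian_def)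

lemma space_std_complex_gaussian[simp]: "space \<nu> = UNIV"
  by (simp add: std_complex_gaussian_def)

lemma borel_measurable_cnj[measurable (raw)]:
  "f \<in> borel_measurable M \<Longrightarrow> (\<lambda>x. cnj (f x)) \<in> borel_measurable M"
  using measurable_compose[OF _ borel_measurable_continuous_onI[OF
      continuous_on_cnj[OF continuous_on_id]]] by blast

lemma nn_integral_gaussian:
  "f \<in> borel_measurable borel \<Longrightarrow>
    (\<integral>\<^sup>+ z. f z \<partial>\<nu>) = (\<integral>\<^sup>+ z. ennreal (exp (- (cmod z)\<^sup>2) / pi) * f z \<partial>lborel)"
  unfolding std_complex_gaussian_def by (subst nn_integral_density) auto

text \<open>
  Area enters only through the disc of radius \<open>sqrt a\<close>: the push-forward gives \<open>{..a}\<close> the mass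
  \<open>pi * a\<close>, and half-lines generate the Borel sets.
\<close>

lemma distr_lborel_cmod_squared:
  "distr lborel borel (\<lambda>z. (cmod z)\<^sup>2) = density lborel (\<lambda>t. ennreal (pi * indicator {0..} t))"
proof (rule measure_eqI_generator_eq)
  let ?E = "range (\<lambda>a::real. {..a})"
  have E: "sets (borel :: real measure) = sigma_sets UNIV ?E"
    unfolding borel_eq_atMost by (simp add: sets_measure_of)
  have d: "emeasure (distr lborel borel (\<lambda>z::complex. (cmod z)\<^sup>2)) {..a}
      = ennreal (if 0 \<le> a then pi * a else 0)" for a
  proof (cases "0 \<le> a")
    case True
    have "(cmod z)\<^sup>2 \<le> a \<longleftrightarrow> cmod z \<le> sqrt a" for z :: complex
      using True real_le_rsqrt[of "cmod z" a] power_mono[of "cmod z" "sqrt a" 2] by auto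
    then have "(\<lambda>z::complex. (cmod z)\<^sup>2) -` {..a} = cball 0 (sqrt a)"
      by auto
    then show ?thesis
      using True by (simp add: emeasure_distr emeasure_cball unit_ball_vol_2)
  next
    case False
    then have "(\<lambda>z::complex. (cmod z)\<^sup>2) -` {..a} = {}"
      by (auto simp: not_le) (metis not_le order_trans zero_le_power2)
    then show ?thesis
      using False by (simp add: emeasure_distr)
  qed
  have e: "emeasure (density lborel (\<lambda>t. ennreal (pi * indicator {0..} t))) {..a}
      = ennreal (if 0 \<le> a then pi * a else 0)" for a
  proof -
    have "emeasure (density lborel (\<lambda>t. ennreal (pi * indicator {0..} t))) {..a}
        = (\<integral>\<^sup>+ t. ennreal pi * indicator {0..a} t \<partial>lborel)"
      by (subst emeasure_density) (auto intro!: nn_integral_cong split: split_indicator)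
    also have "\<dots> = ennreal (if 0 \<le> a then pi * a else 0)"
      by (subst nn_integral_cmult_indicator) (auto simp: ennreal_mult)
    finally show ?thesis .
  qed
  show "Int_stable ?E" by (auto simp: Int_stable_def)
  show "?E \<subseteq> Pow UNIV" by auto
  show "sets (distr lborel borel (\<lambda>z::complex. (cmod z)\<^sup>2)) = sigma_sets UNIV ?E" using E by simp
  show "sets (density lborel (\<lambda>t. ennreal (pi * indicator {0..} t))) = sigma_sets UNIV ?E" using E by simp
  show "emeasure (distr lborel borel (\<lambda>z::complex. (cmod z)\<^sup>2)) X
      = emeasure (density lborel (\<lambda>t. ennreal (pi * indicator {0..} t))) X" if "X \<in> ?E" for X
    using that d e by auto
  show "range (\<lambda>n::nat. {..real n}) \<subseteq> ?E" by auto
  show "(\<Union>n::nat. {..real n}) = UNIV" by (auto intro: real_arch_simple)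
  show "emeasure (distr lborel borel (\<lambda>z::complex. (cmod z)\<^sup>2)) {..real n} \<noteq> \<infinity>" for n :: nat
    using d by simp
qed

text \<open>
  The squared modulus of a standard complex Gaussian is exponentially distributed.
\<close>

lemma nn_integral_gaussian_radial:
  assumes [measurable]: "f \<in> borel_measurable borel"
  shows "(\<integral>\<^sup>+ z. f ((cmod z)\<^sup>2) \<partial>\<nu>) = (\<integral>\<^sup>+ t. ennreal (exp (- t)) * indicator {0..} t * f t \<partial>lborel)"
proof -
  have "(\<integral>\<^sup>+ z. f ((cmod z)\<^sup>2) \<partial>\<nu>) = (\<integral>\<^sup>+ z. (\<lambda>t. ennreal (exp (- t) / pi) * f t) ((cmod z)\<^sup>2) \<partial>lborel)"
    by (subst nn_integral_gaussian) auto
  also have "\<dots> = (\<integral>\<^sup>+ t. ennreal (exp (- t) / pi) * f t \<partial>distr lborel borel (\<lambda>z. (cmod z)\<^sup>2))"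
    by (subst nn_integral_distr) auto
  also have "\<dots> = (\<integral>\<^sup>+ t. ennreal (exp (- t)) * indicator {0..} t * f t \<partial>lborel)"
    unfolding distr_lborel_cmod_squared
    by (subst nn_integral_density) (auto simp: ennreal_mult'[symmetric] mult.assoc[symmetric] intro!:
        nn_integral_cong split: split_indicator)
  finally show ?thesis .
qed

lemma nn_integral_exp_power:
  "(\<integral>\<^sup>+ t. ennreal (exp (- t)) * indicator {0..} t * ennreal (t ^ k) \<partial>lborel) = ennreal (fact k)"
proof -
  have "(\<integral>\<^sup>+ t. ennreal (exp (- t)) * indicator {0..} t * ennreal (t ^ k) \<partial>lborel)
      = (\<integral>\<^sup>+ x. ennreal (erlang_density 0 1 x * x ^ k) \<partial>lborel)"
    by (intro nn_integral_cong) (auto simp: erlang_density_def ennreal_mult' split: split_indicator)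
  also have "\<dots> = ennreal (fact k)"
    by (subst nn_integral_erlang_ith_moment) auto
  finally show ?thesis .
qed

lemma prob_space_std_complex_gaussian: "prob_space \<nu>"
proof
  show "emeasure \<nu> (space \<nu>) = 1"
    using nn_integral_gaussian_radial[of "\<lambda>_. 1"] nn_integral_exp_power[of 0] by simp
qed

interpretation gaussian: prob_space "\<nu>"
  by (rule prob_space_std_complex_gaussian)

interpretation gaussian_pair: pair_sigma_finite "\<nu>" "\<nu>" ..

interpretation gaussians: product_sigma_finite "\<lambda>_. \<nu>" ..

lemma prob_space_gaussian_family: "prob_space (PiM I (\<lambda>_. \<nu>))"
  by (intro prob_space_PiM prob_space_std_complex_gaussian)

lemma nn_integral_gaussian_rotate:
  assumes [measurable]: "f \<in> borel_measurable borel" and w: "cmod w = 1"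
  shows "(\<integral>\<^sup>+ z. f (w * z) \<partial>\<nu>) = (\<integral>\<^sup>+ z. f z \<partial>\<nu>)"
  using nn_integral_complex_rotate[of "\<lambda>z. ennreal (exp (- (cmod z)\<^sup>2) / pi) * f z" w] w
  by (simp add: nn_integral_gaussian norm_mult)

lemma nn_integral_gaussian_pair:
  assumes [measurable]: "F \<in> borel_measurable (borel \<Otimes>\<^sub>M borel)"
  shows "(\<integral>\<^sup>+ u. \<integral>\<^sup>+ v. F (u, v) \<partial>\<nu> \<partial>\<nu>) =
    (\<integral>\<^sup>+ u. \<integral>\<^sup>+ v. ennreal (exp (- ((cmod u)\<^sup>2 + (cmod v)\<^sup>2)) / pi\<^sup>2) * F (u, v) \<partial>lborel \<partial>lborel)"
proof -
  have "(\<integral>\<^sup>+ u. \<integral>\<^sup>+ v. F (u, v) \<partial>\<nu> \<partial>\<nu>) =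
    (\<integral>\<^sup>+ u. ennreal (exp (- (cmod u)\<^sup>2) / pi)
        * (\<integral>\<^sup>+ v. ennreal (exp (- (cmod v)\<^sup>2) / pi) * F (u, v) \<partial>lborel) \<partial>lborel)"
    by (simp add: nn_integral_gaussian)
  also have "\<dots> = (\<integral>\<^sup>+ u. \<integral>\<^sup>+ v. ennreal (exp (- (cmod u)\<^sup>2) / pi)
      * (ennreal (exp (- (cmod v)\<^sup>2) / pi) * F (u, v)) \<partial>lborel \<partial>lborel)"
    by (intro nn_integral_cong nn_integral_cmult[symmetric]) measurable
  also have "\<dots> = (\<integral>\<^sup>+ u. \<integral>\<^sup>+ v. ennreal (exp (- ((cmod u)\<^sup>2 + (cmod v)\<^sup>2)) / pi\<^sup>2)
      * F (u, v) \<partial>lborel \<partial>lborel)"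
  proof (intro nn_integral_cong)
    fix u v
    have "exp (- ((cmod u)\<^sup>2 + (cmod v)\<^sup>2)) / pi\<^sup>2 = exp (- (cmod u)\<^sup>2) / pi * (exp (- (cmod v)\<^sup>2) / pi)"
      by (simp add: exp_add[symmetric] power2_eq_square)
    then show "ennreal (exp (- (cmod u)\<^sup>2) / pi) * (ennreal (exp (- (cmod v)\<^sup>2) / pi) * F (u, v))
        = ennreal (exp (- ((cmod u)\<^sup>2 + (cmod v)\<^sup>2)) / pi\<^sup>2) * F (u, v)"
      by (simp only: mult.assoc[symmetric] ennreal_mult'[symmetric] divide_nonneg_pos exp_ge_zero
          pi_gt_zero)
  qed
  finally show ?thesis .
qed

text \<open>
  The map \<open>(u, v) \<mapsto> (a u - b cnj v, a v + b cnj u)\<close> is multiplication by a unit quaternion. For real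
  \<open>a\<close> it factors into three complex shears, exactly as a plane rotation does; the phase of \<open>a\<close> is
  removed beforehand by rotating \<open>u\<close> and \<open>v\<close>. The Gaussian weight depends on \<open>\<bar>u\<bar>\<^sup>2 + \<bar>v\<bar>\<^sup>2\<close> alone,
  which the map preserves.
\<close>

lemma nn_integral_gaussian_quaternion_unit:
  fixes a b :: complex
  assumes [measurable]: "F \<in> borel_measurable (borel \<Otimes>\<^sub>M borel)" and ab: "(cmod a)\<^sup>2 + (cmod b)\<^sup>2 = 1"
  shows "(\<integral>\<^sup>+ u. \<integral>\<^sup>+ v. F (a * u - b * cnj v, a * v + b * cnj u) \<partial>\<nu> \<partial>\<nu>) = (\<integral>\<^sup>+ u. \<integral>\<^sup>+ v. F (u, v) \<partial>\<nu> \<partial>\<nu>)"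
proof -
  have real_case: "(\<integral>\<^sup>+ u. \<integral>\<^sup>+ v. F (of_real r * u - b * cnj v, of_real r * v + b * cnj u) \<partial>\<nu> \<partial>\<nu>)
      = (\<integral>\<^sup>+ u. \<integral>\<^sup>+ v. F (u, v) \<partial>\<nu> \<partial>\<nu>)"
    if r: "0 \<le> r" "r\<^sup>2 + (cmod b)\<^sup>2 = 1" for r b
  proof (cases "b = 0")
    case True
    then have "r = 1" using r by (simp add: power2_eq_1_iff)
    then show ?thesis using True by simp
  next
    case False
    define G where "G = (\<lambda>(u, v). ennreal (exp (- ((cmod u)\<^sup>2 + (cmod v)\<^sup>2)) / pi\<^sup>2) * F (u, v))"
    have [measurable]: "G \<in> borel_measurable (borel \<Otimes>\<^sub>M borel)"
      unfolding G_def by measurable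
    have bb: "b * cnj b = 1 - of_real (r\<^sup>2)"
      using arg_cong[OF r(2), of complex_of_real]
          by (simp only: of_real_add complex_norm_square of_real_1 eq_diff_eq add.commute)
    (* the quaternionic analogue of minus the tangent of half the angle *)
    define d where "d = (of_real r - 1) / cnj b"
    have d: "d * cnj b = of_real r - 1" using False by (simp add: d_def)
    have d': "cnj d * b = of_real r - 1" using False by (simp add: d_def)
    have d'': "d + d * of_real r = - b"
    proof -
      have "cnj b * (d + d * of_real r + b) = (d * cnj b) + (d * cnj b) * of_real r + b * cnj b"
          by (simp add: algebra_simps)
      also have "\<dots> = 0" unfolding d bb by (simp add: algebra_simps power2_eq_square)
      finally show ?thesis using False by (simp add: add_eq_0_iff)
    qed
    have "(\<integral>\<^sup>+ u. \<integral>\<^sup>+ v. F (of_real r * u - b * cnj v, of_real r * v + b * cnj u) \<partial>\<nu> \<partial>\<nu>)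
      = (\<integral>\<^sup>+ u. \<integral>\<^sup>+ v. G (of_real r * u - b * cnj v, of_real r * v + b * cnj u) \<partial>lborel \<partial>lborel)"
    proof -
      let ?F' = "\<lambda>(u, v). F (of_real r * u - b * cnj v, of_real r * v + b * cnj u)"
      have "(cmod (of_real r * u - b * cnj v))\<^sup>2 + (cmod (of_real r * v + b * cnj u))\<^sup>2
          = (cmod u)\<^sup>2 + (cmod v)\<^sup>2" for u v
      proof -
        have "complex_of_real ((cmod (of_real r * u - b * cnj v))\<^sup>2 + (cmod (of_real r * v + b * cnj u))\<^sup>2)
           = (of_real (r\<^sup>2) + b * cnj b) * (u * cnj u + v * cnj v)"
          by (simp only: of_real_add complex_norm_square) (simp add: algebra_simps power2_eq_square)
        also have "\<dots> = complex_of_real ((cmod u)\<^sup>2 + (cmod v)\<^sup>2)"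
          unfolding bb by (simp only: of_real_add complex_norm_square) simp
        finally show ?thesis using of_real_eq_iff by blast
      qed
      then have "G (of_real r * u - b * cnj v, of_real r * v + b * cnj u) =
          ennreal (exp (- ((cmod u)\<^sup>2 + (cmod v)\<^sup>2)) / pi\<^sup>2) * ?F' (u, v)" for u v
        unfolding G_def by (simp only: prod.case)
      moreover have "(\<integral>\<^sup>+ u. \<integral>\<^sup>+ v. ?F' (u, v) \<partial>\<nu> \<partial>\<nu>)
          = (\<integral>\<^sup>+ u. \<integral>\<^sup>+ v. ennreal (exp (- ((cmod u)\<^sup>2 + (cmod v)\<^sup>2)) / pi\<^sup>2) * ?F' (u, v) \<partial>lborel \<partial>lborel)"
        by (rule nn_integral_gaussian_pair) measurable
      ultimately show ?thesis by (simp only: prod.case)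
    qed
    also have "\<dots> = (\<integral>\<^sup>+ u. \<integral>\<^sup>+ v. G
        (u + d * cnj v + d * cnj (v + b * cnj (u + d * cnj v)), v + b * cnj (u + d * cnj v)) \<partial>lborel
        \<partial>lborel)"
    proof (intro nn_integral_cong)
      fix u v :: complex
      have "v + b * cnj (u + d * cnj v) = (1 + cnj d * b) * v + b * cnj u" by (simp add: algebra_simps)
      then have 1: "v + b * cnj (u + d * cnj v) = of_real r * v + b * cnj u" unfolding d' by simp
      have "u + d * cnj v + d * cnj (of_real r * v + b * cnj u)
          = (1 + d * cnj b) * u + (d + d * of_real r) * cnj v"
        by (simp add: algebra_simps)
      then have 2: "u + d * cnj v + d * cnj (of_real r * v + b * cnj u) = of_real r * u - b * cnj v"
        unfolding d d'' by simp
      show "G (of_real r * u - b * cnj v, of_real r * v + b * cnj u)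
          = G (u + d * cnj v + d * cnj (v + b * cnj (u + d * cnj v)), v + b * cnj (u + d * cnj v))"
        unfolding 1 2 ..
    qed
    also have "\<dots> = (\<integral>\<^sup>+ u. \<integral>\<^sup>+ v. G (u, v) \<partial>lborel \<partial>lborel)"
      by (rule nn_integral_three_shears) measurable
    also have "\<dots> = (\<integral>\<^sup>+ u. \<integral>\<^sup>+ v. F (u, v) \<partial>\<nu> \<partial>\<nu>)"
      by (subst nn_integral_gaussian_pair) (simp_all only: G_def prod.case assms(1))
    finally show ?thesis .
  qed
  (* the phase that makes a * w real and nonnegative *)
  define w where "w = (if a = 0 then 1 else cnj (sgn a))"
  have w: "cmod w = 1" by (auto simp: w_def norm_sgn)
  have aw: "a * w = of_real (cmod a)"
  proof (cases "a = 0")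
    case False
    then have "a * w = a * cnj a / of_real (cmod a)" by (simp add: w_def sgn_eq)
    also have "\<dots> = of_real (cmod a)" using False by (simp flip: complex_norm_square add: power2_eq_square)
    finally show ?thesis .
  qed simp
  have "(\<integral>\<^sup>+ u. \<integral>\<^sup>+ v. F (a * u - b * cnj v, a * v + b * cnj u) \<partial>\<nu> \<partial>\<nu>)
    = (\<integral>\<^sup>+ u. \<integral>\<^sup>+ v. F (a * u - b * cnj (w * v), a * (w * v) + b * cnj u) \<partial>\<nu> \<partial>\<nu>)"
    by (intro nn_integral_cong nn_integral_gaussian_rotate[where f
        = "\<lambda>v. F (a * _ - b * cnj v, a * v + b * cnj _)", symmetric, OF _ w]) measurable
  also have "\<dots> = (\<integral>\<^sup>+ u. \<integral>\<^sup>+ v. F (a * (w * u) - b * cnj (w * v), a * (w * v) + b * cnj (w * u)) \<partial>\<nu> \<partial>\<nu>)"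
    by (rule nn_integral_gaussian_rotate[of "\<lambda>u. \<integral>\<^sup>+ v. F
        (a * u - b * cnj (w * v), a * (w * v) + b * cnj u) \<partial>\<nu>", OF _ w, symmetric])
       measurable
  also have "\<dots> = (\<integral>\<^sup>+ u. \<integral>\<^sup>+ v. F (of_real (cmod a) * u - (b * cnj w) * cnj v, of_real (cmod a) * v
      + (b * cnj w) * cnj u) \<partial>\<nu> \<partial>\<nu>)"
  proof -
    have "a * (w * u) - b * cnj (w * v) = of_real (cmod a) * u - (b * cnj w) * cnj v"
      "a * (w * v) + b * cnj (w * u) = of_real (cmod a) * v + (b * cnj w) * cnj u" for u v
      unfolding aw[symmetric] by (simp_all only: complex_cnj_mult mult.assoc)
    then show ?thesis by presburger
  qed
  also have "\<dots> = (\<integral>\<^sup>+ u. \<integral>\<^sup>+ v. F (u, v) \<partial>\<nu> \<partial>\<nu>)"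
    by (rule real_case) (use ab w in \<open>auto simp: norm_mult\<close>)
  finally show ?thesis .
qed

lemma nn_integral_gaussian_cnj:
  assumes [measurable]: "f \<in> borel_measurable borel"
  shows "(\<integral>\<^sup>+ z. f (cnj z) \<partial>\<nu>) = (\<integral>\<^sup>+ z. f z \<partial>\<nu>)"
proof -
  have "(\<integral>\<^sup>+ z. g (cnj z) \<partial>lborel) = (\<integral>\<^sup>+ z. g z \<partial>lborel)" if [measurable]: "g \<in> borel_measurable borel"
      for g
  proof -
    have "(\<integral>\<^sup>+ y. g (Complex x y) \<partial>lborel) = (\<integral>\<^sup>+ y. g (Complex x (- y)) \<partial>lborel)" for x
      using nn_integral_real_affine[of "\<lambda>y. g (Complex x y)" "-1" 0] by simp
    moreover have "cnj (Complex x y) = Complex x (- y)" for x y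
      by (simp add: complex_eq_iff)
    ultimately show ?thesis
      by (simp add: nn_integral_lborel_complex)
  qed
  from this[of "\<lambda>z. ennreal (exp (- (cmod z)\<^sup>2) / pi) * f z"] show ?thesis
    by (simp add: nn_integral_gaussian)
qed

lemma nn_integral_gaussian_quaternion:
  fixes a b :: complex
  assumes [measurable]: "F \<in> borel_measurable (borel \<Otimes>\<^sub>M borel)"
  defines "r \<equiv> complex_of_real (sqrt ((cmod a)\<^sup>2 + (cmod b)\<^sup>2))"
  shows "(\<integral>\<^sup>+ u. \<integral>\<^sup>+ v. F (a * u - b * cnj v, a * v + b * cnj u) \<partial>\<nu> \<partial>\<nu>)
      = (\<integral>\<^sup>+ u. \<integral>\<^sup>+ v. F (r * u, r * v) \<partial>\<nu> \<partial>\<nu>)"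
proof (cases "r = 0")
  case True
  then have "a = 0" "b = 0"
    by (auto simp: r_def sum_power2_eq_zero_iff)
  with True show ?thesis by simp
next
  case False
  then have nz: "(cmod a)\<^sup>2 + (cmod b)\<^sup>2 \<noteq> 0" by (auto simp: r_def)
  let ?G = "\<lambda>(x, y). F (r * x, r * y)"
  have r: "(cmod r)\<^sup>2 = (cmod a)\<^sup>2 + (cmod b)\<^sup>2"
    by (simp add: r_def)
  have "(cmod (a / r))\<^sup>2 + (cmod (b / r))\<^sup>2 = 1"
    unfolding norm_divide power_divide r add_divide_distrib[symmetric] using nz by simp
  from nn_integral_gaussian_quaternion_unit[OF _ this, of ?G]
  have "(\<integral>\<^sup>+ u. \<integral>\<^sup>+ v. F (r * (a / r * u - b / r * cnj v), r * (a / r * v + b / r * cnj u)) \<partial>\<nu> \<partial>\<nu>)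
      = (\<integral>\<^sup>+ u. \<integral>\<^sup>+ v. F (r * u, r * v) \<partial>\<nu> \<partial>\<nu>)"
    by (simp only: prod.case) measurable
  then show ?thesis
    using False by (simp add: right_diff_distrib distrib_left)
qed

text \<open>
  A combination \<open>s u + t v\<close> is the first coordinate of a quaternion acting on the pair, up to the
  conjugation of \<open>v\<close>, which does not change its law.
\<close>

lemma nn_integral_gaussian_convolution:
  fixes s t :: real
  assumes [measurable]: "f \<in> borel_measurable borel"
  shows "(\<integral>\<^sup>+ u. \<integral>\<^sup>+ v. f (s * u + t * v) \<partial>\<nu> \<partial>\<nu>) = (\<integral>\<^sup>+ u. f (sqrt (s\<^sup>2 + t\<^sup>2) * u) \<partial>\<nu>)"
proof -
  have "(\<integral>\<^sup>+ v. f (s * u + t * v) \<partial>\<nu>) = (\<integral>\<^sup>+ v. f (s * u + t * cnj v) \<partial>\<nu>)" for u :: complex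
    by (rule nn_integral_gaussian_cnj[symmetric]) measurable
  then have "(\<integral>\<^sup>+ u. \<integral>\<^sup>+ v. f (s * u + t * v) \<partial>\<nu> \<partial>\<nu>) = (\<integral>\<^sup>+ u. \<integral>\<^sup>+ v. f (s * u + t * cnj v) \<partial>\<nu> \<partial>\<nu>)"
    by simp
  also have "\<dots> = (\<integral>\<^sup>+ u. \<integral>\<^sup>+ v. (f \<circ> fst)
      (of_real s * u - of_real (- t) * cnj v, of_real s * v + of_real (- t) * cnj u) \<partial>\<nu> \<partial>\<nu>)"
    by simp
  also have "\<dots> = (\<integral>\<^sup>+ u. f (sqrt (s\<^sup>2 + t\<^sup>2) * u) \<partial>\<nu>)"
    by (subst nn_integral_gaussian_quaternion) (auto simp: gaussian.emeasure_space_1[simplified])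
  finally show ?thesis .
qed

lemma nn_integral_gaussian_convolution2:
  fixes s t :: real
  assumes [measurable]: "F \<in> borel_measurable (borel \<Otimes>\<^sub>M borel)"
  defines "q \<equiv> complex_of_real (sqrt (s\<^sup>2 + t\<^sup>2))"
  shows "(\<integral>\<^sup>+ u. \<integral>\<^sup>+ v. \<integral>\<^sup>+ u'. \<integral>\<^sup>+ v'. F (s * u + t * u', s * v + t * v') \<partial>\<nu> \<partial>\<nu> \<partial>\<nu> \<partial>\<nu>)
      = (\<integral>\<^sup>+ u. \<integral>\<^sup>+ v. F (q * u, q * v) \<partial>\<nu> \<partial>\<nu>)"
proof -
  have "(\<integral>\<^sup>+ u. \<integral>\<^sup>+ v. \<integral>\<^sup>+ u'. \<integral>\<^sup>+ v'. F (s * u + t * u', s * v + t * v') \<partial>\<nu> \<partial>\<nu> \<partial>\<nu> \<partial>\<nu>)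
    = (\<integral>\<^sup>+ u. \<integral>\<^sup>+ u'. \<integral>\<^sup>+ v. \<integral>\<^sup>+ v'. F (s * u + t * u', s * v + t * v') \<partial>\<nu> \<partial>\<nu> \<partial>\<nu> \<partial>\<nu>)"
    by (intro nn_integral_cong gaussian_pair.Fubini') measurable
  also have "\<dots> = (\<integral>\<^sup>+ u. \<integral>\<^sup>+ u'. \<integral>\<^sup>+ v. F (s * u + t * u', q * v) \<partial>\<nu> \<partial>\<nu> \<partial>\<nu>)"
    unfolding q_def
    by (intro nn_integral_cong nn_integral_gaussian_convolution[where f = "\<lambda>y. F (_, y)"]) measurable
  also have "\<dots> = (\<integral>\<^sup>+ u. \<integral>\<^sup>+ v. F (q * u, q * v) \<partial>\<nu> \<partial>\<nu>)"
    unfolding q_def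
    by (intro nn_integral_gaussian_convolution[where f = "\<lambda>x. \<integral>\<^sup>+ v. F (x, _ * v) \<partial>\<nu>"]) measurable
  finally show ?thesis .
qed

text \<open>
  A row \<open>(B\<^sub>i)\<close> multiplied by a column of independent Gaussian quaternions is a Gaussian quaternion
  scaled by the norm of the row. The induction adds one block at a time: the new block is replaced by
  its scaled law, and the two independent scaled quaternions are then merged by convolution. The pair
  must be carried as a whole, with a general \<open>F\<close>, for the induction hypothesis to apply.
\<close>

lemma nn_integral_gaussian_quaternion_sum:
  fixes a b :: "'i \<Rightarrow> complex"
  assumes "finite I" and "F \<in> borel_measurable (borel \<Otimes>\<^sub>M borel)"
  shows "(\<integral>\<^sup>+ u. \<integral>\<^sup>+ v. F (\<Sum>i\<in>I. a i * u i - b i * cnj (v i), \<Sum>i\<in>I. a i * v i + b i * cnj (u i))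
            \<partial>PiM I (\<lambda>_. \<nu>) \<partial>PiM I (\<lambda>_. \<nu>)) =
    (\<integral>\<^sup>+ u. \<integral>\<^sup>+ v. F (sqrt (\<Sum>i\<in>I. (cmod (a i))\<^sup>2 + (cmod (b i))\<^sup>2)
        * u, sqrt (\<Sum>i\<in>I. (cmod (a i))\<^sup>2 + (cmod (b i))\<^sup>2) * v) \<partial>\<nu> \<partial>\<nu>)"
  using assms
proof (induction I arbitrary: F rule: finite_induct)
  case empty
  then show ?case
    by (simp add: PiM_empty nn_integral_count_space_finite gaussian.emeasure_space_1[simplified])
next
  case (insert i I)
  note [measurable] = insert.prems and [simp] = insert.hyps
  interpret I: prob_space "PiM I (\<lambda>_. \<nu>)"
    by (rule prob_space_gaussian_family)
  interpret II: prob_space "PiM (insert i I) (\<lambda>_. \<nu>)"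
    by (rule prob_space_gaussian_family)
  interpret P: pair_sigma_finite "\<nu>" "PiM I (\<lambda>_. \<nu>)" ..
  define U where "U u v = (\<Sum>i\<in>I. a i * u i - b i * cnj (v i))" for u v
  define V where "V u v = (\<Sum>i\<in>I. a i * v i + b i * cnj (u i))" for u v
  have [measurable]: "(\<lambda>p. U (fst p) (snd p)) \<in> borel_measurable (PiM I (\<lambda>_. \<nu>) \<Otimes>\<^sub>M PiM I (\<lambda>_. \<nu>))"
    "(\<lambda>p. V (fst p) (snd p)) \<in> borel_measurable (PiM I (\<lambda>_. \<nu>) \<Otimes>\<^sub>M PiM I (\<lambda>_. \<nu>))"
    unfolding U_def V_def by measurable
  note UVm[measurable] = measurable_compose[OF measurable_Pair this(1), simplified]
      measurable_compose[OF measurable_Pair this(2), simplified]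
  define \<rho> where "\<rho> = sqrt (\<Sum>i\<in>I. (cmod (a i))\<^sup>2 + (cmod (b i))\<^sup>2)"
  define r where "r = sqrt ((cmod (a i))\<^sup>2 + (cmod (b i))\<^sup>2)"
  let ?F = "\<lambda>x y u v. F (x + (a i * u - b i * cnj v), y + (a i * v + b i * cnj u))"
  let ?F' = "\<lambda>(x, y). \<integral>\<^sup>+ u. \<integral>\<^sup>+ v. F (x + r * u, y + r * v) \<partial>\<nu> \<partial>\<nu>"
  have F': "(\<integral>\<^sup>+ u. \<integral>\<^sup>+ v. ?F x y u v \<partial>\<nu> \<partial>\<nu>) = ?F' (x, y)" for x y
    unfolding r_def prod.case
    by (rule nn_integral_gaussian_quaternion[where F
        = "\<lambda>(p, q). F (x + p, y + q)", simplified prod.case]) measurable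
  have upd: "(\<Sum>j\<in>insert i I. a j * (u(i := y)) j - b j * cnj ((v(i := z)) j))
      = U u v + (a i * y - b i * cnj z)"
    "(\<Sum>j\<in>insert i I. a j * (v(i := z)) j + b j * cnj ((u(i := y)) j)) = V u v + (a i * z + b i * cnj y)"
        for u v y z
    unfolding U_def V_def by (auto intro!: sum.cong)
  let ?L = "\<lambda>u v. F (\<Sum>j\<in>insert i I. a j * u j - b j * cnj (v j), \<Sum>j\<in>insert i I. a j * v j + b j
      * cnj (u j))"
  have "(\<integral>\<^sup>+ u. \<integral>\<^sup>+ v. ?L u v \<partial>PiM (insert i I) (\<lambda>_. \<nu>) \<partial>PiM (insert i I) (\<lambda>_. \<nu>)) =
      (\<integral>\<^sup>+ u. \<integral>\<^sup>+ y. \<integral>\<^sup>+ v. ?L (u(i := y)) v \<partial>PiM (insert i I) (\<lambda>_. \<nu>) \<partial>\<nu> \<partial>PiM I (\<lambda>_. \<nu>))"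
    by (rule gaussians.product_nn_integral_insert) (use insert.hyps in simp_all, measurable)
  also have "\<dots> = (\<integral>\<^sup>+ u. \<integral>\<^sup>+ y. \<integral>\<^sup>+ v. \<integral>\<^sup>+ z. ?L (u(i := y)) (v(i := z)) \<partial>\<nu> \<partial>PiM I (\<lambda>_. \<nu>) \<partial>\<nu> \<partial>PiM I
      (\<lambda>_. \<nu>))"
  proof -
    have "(\<integral>\<^sup>+ v. ?L u v \<partial>PiM (insert i I) (\<lambda>_. \<nu>))
        = (\<integral>\<^sup>+ v. \<integral>\<^sup>+ z. ?L u (v(i := z)) \<partial>\<nu> \<partial>PiM I (\<lambda>_. \<nu>))" for u
      by (rule gaussians.product_nn_integral_insert) (use insert.hyps in simp_all)
    then show ?thesis by (simp only:)
  qed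
  also have "\<dots> = (\<integral>\<^sup>+ u. \<integral>\<^sup>+ y. \<integral>\<^sup>+ v. \<integral>\<^sup>+ z. ?F (U u v) (V u v) y z \<partial>\<nu> \<partial>PiM I (\<lambda>_. \<nu>) \<partial>\<nu> \<partial>PiM I (\<lambda>_. \<nu>))"
    unfolding upd ..
  also have "\<dots> = (\<integral>\<^sup>+ u. \<integral>\<^sup>+ v. \<integral>\<^sup>+ y. \<integral>\<^sup>+ z. ?F (U u v) (V u v) y z \<partial>\<nu> \<partial>\<nu> \<partial>PiM I (\<lambda>_. \<nu>) \<partial>PiM I (\<lambda>_. \<nu>))"
    by (intro nn_integral_cong P.Fubini'[symmetric]) measurable
  also have "\<dots> = (\<integral>\<^sup>+ u. \<integral>\<^sup>+ v. ?F' (U u v, V u v) \<partial>PiM I (\<lambda>_. \<nu>) \<partial>PiM I (\<lambda>_. \<nu>))"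
    by (simp only: F')
  also have "\<dots> = (\<integral>\<^sup>+ u. \<integral>\<^sup>+ v. ?F' (\<rho> * u, \<rho> * v) \<partial>\<nu> \<partial>\<nu>)"
    unfolding U_def V_def \<rho>_def by (rule insert.IH) measurable
  also have "\<dots> = (\<integral>\<^sup>+ u. \<integral>\<^sup>+ v. F (sqrt (\<rho>\<^sup>2 + r\<^sup>2) * u, sqrt (\<rho>\<^sup>2 + r\<^sup>2) * v) \<partial>\<nu> \<partial>\<nu>)"
    unfolding prod.case by (rule nn_integral_gaussian_convolution2) measurable
  also have "\<rho>\<^sup>2 + r\<^sup>2 = (\<Sum>i\<in>insert i I. (cmod (a i))\<^sup>2 + (cmod (b i))\<^sup>2)"
    by (simp add: \<rho>_def r_def sum_nonneg)
  finally show ?case .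
qed

section \<open>The eigenvalue weight as a Vandermonde product\<close>

text \<open>
  Multiplying the Vandermonde matrix on the right by the coefficient matrix of the Newton polynomials
  \<open>(X - x\<^sub>0) \<cdots> (X - x\<^bsub>j-1\<^esub>)\<close>, which is unipotent upper triangular, evaluates these polynomials at the
  nodes. The result is lower triangular, with the wanted factors on its diagonal.
\<close>

lemma vandermonde_det:
  fixes x :: "nat \<Rightarrow> 'a::idom"
  shows "det (mat n n (\<lambda>(i, j). x i ^ j)) = (\<Prod>s<n. \<Prod>r<s. x s - x r)"
proof -
  define q where "q j = (\<Prod>r<j. [:- x r, 1:])" for j
  have deg: "degree (q j) = j" for j
    unfolding q_def by (subst degree_prod_eq_sum_degree) auto
  have lead: "Polynomial.coeff (q j) j = 1" for j
    using lead_coeff_prod[of "\<lambda>r. [:- x r, 1:]" "{..<j}"] deg[of j] by (simp add: q_def)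
  let ?V = "mat n n (\<lambda>(i, j). x i ^ j)" and ?U = "mat n n (\<lambda>(k, j). Polynomial.coeff (q j) k)"
  have VU: "?V * ?U = mat n n (\<lambda>(i, j). \<Prod>r<j. x i - x r)"
  proof (rule eq_matI)
    fix i j assume "i < dim_row (mat n n (\<lambda>(i, j). \<Prod>r<j. x i - x r))"
        "j < dim_col (mat n n (\<lambda>(i, j). \<Prod>r<j. x i - x r))"
    then have ij: "i < n" "j < n" by auto
    have "(?V * ?U) $$ (i, j) = (\<Sum>k = 0..<n. x i ^ k * Polynomial.coeff (q j) k)"
      using ij by (simp add: scalar_prod_def)
    also have "\<dots> = (\<Sum>k\<le>j. Polynomial.coeff (q j) k * x i ^ k)"
      using ij deg[of j] by (intro sum.mono_neutral_cong_right) (auto simp: coeff_eq_0)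
    also have "\<dots> = poly (q j) (x i)"
      using deg[of j] by (simp add: poly_altdef)
    also have "\<dots> = (\<Prod>r<j. x i - x r)"
      by (simp add: q_def poly_prod)
    finally show "(?V * ?U) $$ (i, j) = mat n n (\<lambda>(i, j). \<Prod>r<j. x i - x r) $$ (i, j)"
      using ij by simp
  qed auto
  have "det ?U = 1"
  proof -
    have "upper_triangular ?U"
      using deg by (auto simp: upper_triangular_def intro!: coeff_eq_0)
    from det_upper_triangular[OF this] show ?thesis
      by (subst det_upper_triangular[where n = n])
          (use \<open>upper_triangular ?U\<close> lead in \<open>auto simp: prod_list_diag_prod\<close>)
  qed
  then have "det ?V = det (?V * ?U)"
    by (subst det_mult[where n = n]) auto
  also have "\<dots> = (\<Prod>s<n. \<Prod>r<s. x s - x r)"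
    unfolding VU
    by (subst det_lower_triangular[where n = n]) (auto simp: prod_list_diag_prod atLeast0LessThan)
  finally show ?thesis .
qed

lemma vandermonde_leibniz:
  fixes x :: "nat \<Rightarrow> 'a::idom"
  shows "(\<Prod>s<n. \<Prod>r<s. x s - x r) = (\<Sum>p | p permutes {0..<n}. of_int (sign p) * (\<Prod>r<n. x r ^ p r))"
  unfolding vandermonde_det[symmetric]
  by (subst det_def'[where n = n])
     (auto simp: atLeast0LessThan intro!: sum.cong prod.cong arg_cong2[where f = "(*)"] dest: permutes_in_image)

text \<open>
  The nodes \<open>\<lambda>\<^sub>2, cnj \<lambda>\<^sub>2, \<lambda>\<^sub>3, cnj \<lambda>\<^sub>3, \<dots>\<close>, counted from \<open>0\<close>; hence the shift by two.
\<close>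

definition conj_pairs :: "(nat \<Rightarrow> complex) \<Rightarrow> nat \<Rightarrow> complex" where
  "conj_pairs lam r = (if even r then lam (r div 2 + 2) else cnj (lam (r div 2 + 2)))"

lemma prod_lessThan_double:
  fixes f :: "nat \<Rightarrow> 'a::comm_monoid_mult"
  shows "(\<Prod>r<2 * n. f r) = (\<Prod>i<n. f (2 * i) * f (2 * i + 1))"
  by (induction n) (simp_all add: mult.assoc)

lemma prod_shift_two:
  fixes f :: "nat \<Rightarrow> 'a::comm_monoid_mult"
  shows "(\<Prod>i\<in>{2..n + 1}. f i) = (\<Prod>i<n. f (i + 2))"
  by (rule prod.reindex_bij_witness[where i = "\<lambda>i. i + 2" and j = "\<lambda>i. i - 2"])
      (auto simp del: add_2_eq_Suc')

lemma prod_triangle_Suc: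
  fixes f :: "nat \<Rightarrow> nat \<Rightarrow> 'a::comm_monoid_mult"
  shows "(\<Prod>i\<in>{2..n + 2}. \<Prod>j\<in>{i<..n + 2}. f i j)
      = (\<Prod>i\<in>{2..n + 1}. \<Prod>j\<in>{i<..n + 1}. f i j) * (\<Prod>i\<in>{2..n + 1}. f i (n + 2))"
    and "(\<Prod>i\<in>{2..n + 2}. \<Prod>j\<in>{i..n + 2}. f i j)
        = (\<Prod>i\<in>{2..n + 1}. \<Prod>j\<in>{i..n + 1}. f i j) * (\<Prod>i\<in>{2..n + 1}. f i (n + 2)) * f (n + 2) (n + 2)"
proof -
  have 1: "{2..n + 2} = insert (n + 2) {2..n + 1}" by auto
  have "(\<Prod>j\<in>{i<..n + 2}. f i j) = (\<Prod>j\<in>{i<..n + 1}. f i j) * f i (n + 2)"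
    "(\<Prod>j\<in>{i..n + 2}. f i j) = (\<Prod>j\<in>{i..n + 1}. f i j) * f i (n + 2)" if "i \<in> {2..n + 1}" for i
  proof -
    have "{i<..n + 2} = insert (n + 2) {i<..n + 1}"
        "{i..n + 2} = insert (n + 2) {i..n + 1}" using that by auto
    then show "(\<Prod>j\<in>{i<..n + 2}. f i j) = (\<Prod>j\<in>{i<..n + 1}. f i j) * f i (n + 2)"
    "(\<Prod>j\<in>{i..n + 2}. f i j) = (\<Prod>j\<in>{i..n + 1}. f i j) * f i (n + 2)" by (simp_all add: mult.commute)
  qed
  then show "(\<Prod>i\<in>{2..n + 2}. \<Prod>j\<in>{i<..n + 2}. f i j)
      = (\<Prod>i\<in>{2..n + 1}. \<Prod>j\<in>{i<..n + 1}. f i j) * (\<Prod>i\<in>{2..n + 1}. f i (n + 2))"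
    and "(\<Prod>i\<in>{2..n + 2}. \<Prod>j\<in>{i..n + 2}. f i j)
        = (\<Prod>i\<in>{2..n + 1}. \<Prod>j\<in>{i..n + 1}. f i j) * (\<Prod>i\<in>{2..n + 1}. f i (n + 2)) * f (n + 2) (n + 2)"
    unfolding 1 by (simp_all add: prod.distrib mult.commute)
qed

text \<open>
  For \<open>i < j\<close> the product of \<open>\<bar>\<lambda>\<^sub>i - \<lambda>\<^sub>j\<bar>\<^sup>2\<close> and \<open>\<bar>\<lambda>\<^sub>i - cnj \<lambda>\<^sub>j\<bar>\<^sup>2\<close> is that of the four differences
  between the pairs \<open>\<lambda>\<^sub>i, cnj \<lambda>\<^sub>i\<close> and \<open>\<lambda>\<^sub>j, cnj \<lambda>\<^sub>j\<close>. The diagonal factor \<open>\<bar>\<lambda>\<^sub>i - cnj \<lambda>\<^sub>i\<bar>\<^sup>2\<close> supplies the difference within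
  the pair, and its other half stays outside the Vandermonde product.
\<close>

lemma cond_eigenvalue_weight_vandermonde:
  "complex_of_real (cond_eigenvalue_weight (n + 1) lam) =
     (\<Prod>i<n. of_real (cmod (lam (i + 2)) ^ 4)) * (\<Prod>s<2 * n. \<Prod>r<s. conj_pairs lam s - conj_pairs lam r)
      * (\<Prod>i<n. lam (i + 2) - cnj (lam (i + 2)))"
proof (induction n)
  case 0
  then show ?case by (simp add: cond_eigenvalue_weight_def)
next
  case (Suc n)
  define z where "z = lam (n + 2)"
  define A where "A = (\<Prod>i<n. complex_of_real ((cmod (lam (i + 2) - z))\<^sup>2))"
  define B where "B = (\<Prod>i<n. complex_of_real ((cmod (lam (i + 2) - cnj z))\<^sup>2))"
  let ?x = "conj_pairs lam"
  let ?a = "\<Prod>i\<in>{2..n + 1}. (cmod (lam i - z))\<^sup>2" and ?b = "\<Prod>i\<in>{2..n + 1}. (cmod (lam i - cnj z))\<^sup>2"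
  have "{2..n + 2} = insert (n + 2) {2..n + 1}" by auto
  then have "(\<Prod>i\<in>{2..n + 2}. cmod (lam i) ^ 4) = (\<Prod>i\<in>{2..n + 1}. cmod (lam i) ^ 4) * cmod z ^ 4"
    by (simp add: z_def mult.commute)
  then have "cond_eigenvalue_weight (n + 2) lam
      = cond_eigenvalue_weight (n + 1) lam * cmod z ^ 4 * ?a * ?b * (cmod (z - cnj z))\<^sup>2"
    unfolding cond_eigenvalue_weight_def prod_triangle_Suc by (simp only: z_def ac_simps)
  moreover have "complex_of_real ?a = A" "complex_of_real ?b = B"
    unfolding A_def B_def by (simp_all only: of_real_prod prod_shift_two)
  ultimately have W: "complex_of_real (cond_eigenvalue_weight (Suc n + 1) lam) =
    complex_of_real (cond_eigenvalue_weight (n + 1) lam) * of_real (cmod z ^ 4) * A * B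
        * of_real ((cmod (z - cnj z))\<^sup>2)"
    by (metis add_Suc Suc_eq_plus1 add_2_eq_Suc' of_real_mult)
  have V: "(\<Prod>s<2 * Suc n. \<Prod>r<s. ?x s - ?x r) = (\<Prod>s<2 * n. \<Prod>r<s. ?x s - ?x r) *
     (\<Prod>r<2 * n. z - ?x r) * ((\<Prod>r<2 * n. cnj z - ?x r) * (cnj z - z))"
  proof -
    have "?x (2 * n) = z" "?x (Suc (2 * n)) = cnj z" by (simp_all add: conj_pairs_def z_def)
    then show ?thesis by (simp add: mult.assoc)
  qed
  have AB: "(\<Prod>r<2 * n. z - ?x r) * (\<Prod>r<2 * n. cnj z - ?x r) = A * B"
    unfolding prod_lessThan_double A_def B_def prod.distrib[symmetric]
    by (intro prod.cong refl, simp only: complex_norm_square) (simp add: conj_pairs_def algebra_simps)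
  have E: "complex_of_real ((cmod (z - cnj z))\<^sup>2) = (cnj z - z) * (z - cnj z)"
    by (simp only: complex_norm_square) simp
  have S: "(\<Prod>i<Suc n. complex_of_real (cmod (lam (i + 2)) ^ 4))
      = (\<Prod>i<n. complex_of_real (cmod (lam (i + 2)) ^ 4)) * of_real (cmod z ^ 4)"
    "(\<Prod>i<Suc n. lam (i + 2) - cnj (lam (i + 2))) = (\<Prod>i<n. lam (i + 2) - cnj (lam (i + 2))) * (z - cnj z)"
    by (simp_all add: z_def)
  show ?case
    unfolding W V S Suc.IH E mult.assoc[of _ A B] AB[symmetric] by (simp only: ac_simps)
qed

section \<open>Angular integration\<close>

text \<open>
  The sign of the angular integral of \<open>z\<^sup>a (cnj z)\<^sup>b (z - cnj z)\<close> against a positive radial weight.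
\<close>

definition step_sign :: "nat \<Rightarrow> nat \<Rightarrow> int" where
  "step_sign a b = (if a + 1 = b then 1 else if a = b + 1 then - 1 else 0)"

text \<open>
  A permutation that maps each pair of positions \<open>2i, 2i + 1\<close> to adjacent numbers tiles \<open>{0..<2n}\<close> by
  dominoes. The tiling is forced from the left: \<open>2k\<close> cannot be matched with \<open>2k - 1\<close>, which by
  induction is already taken, so it is matched with \<open>2k + 1\<close>. The bijection \<open>h\<close> sends the domino
  \<open>{2k, 2k + 1}\<close> to the pair of positions covering it.
\<close>

lemma domino_tiling_unique:
  assumes p: "p permutes {0..<2 * n}"
    and step: "\<And>i. i < n \<Longrightarrow> step_sign (p (2 * i)) (p (2 * i + 1)) \<noteq> 0"
  obtains h where "bij_betw h {..<n} {..<n}" "\<And>k. k < n \<Longrightarrow> max (p (2 * h k)) (p (2 * h k + 1)) = 2 * k + 1"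
proof -
  define h where "h k = inv_into UNIV p (2 * k) div 2" for k
  have q: "inv_into UNIV p permutes {0..<2 * n}" using p by (rule permutes_inv)
  have pq: "p (inv_into UNIV p x) = x" for x using permutes_inverses[OF p] by simp
  have ltq: "inv_into UNIV p x < 2 * n" if "x < 2 * n" for x
    using permutes_in_image[OF q, of x] that by simp
  have hn: "h k < n" if "k < n" for k
    using ltq[of "2 * k"] that by (simp add: h_def less_mult_imp_div_less mult.commute)
  have inj: "p x = p y \<Longrightarrow> x = y" for x y
    using permutes_inj[OF p] by (auto dest: injD)
  have hmem: "p (2 * h k) = 2 * k \<or> p (2 * h k + 1) = 2 * k" for k
  proof (cases "even (inv_into UNIV p (2 * k))")
    case True
    then have "2 * h k = inv_into UNIV p (2 * k)" by (simp add: h_def)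
    then show ?thesis using pq by simp
  next
    case False
    then have "2 * h k + 1 = inv_into UNIV p (2 * k)" by (simp add: h_def)
    then show ?thesis using pq by simp
  qed
  have key: "{p (2 * h k), p (2 * h k + 1)} = {2 * k, 2 * k + 1}" if "k < n" for k
    using that
  proof (induction k)
    case 0
    then show ?case using hmem[of 0] step[OF hn[OF 0]] by (auto simp: step_sign_def split: if_splits)
  next
    case (Suc k)
    let ?A = "{p (2 * h (Suc k)), p (2 * h (Suc k) + 1)}"
    have IH: "{p (2 * h k), p (2 * h k + 1)} = {2 * k, 2 * k + 1}" using Suc by simp
    have mem: "2 * Suc k \<in> ?A" using hmem[of "Suc k"] by auto
    have "h (Suc k) \<noteq> h k"
    proof
      assume "h (Suc k) = h k"
      then have "2 * Suc k \<in> {2 * k, 2 * k + 1}" using mem IH by metis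
      then show False by simp
    qed
    have "2 * k + 1 \<notin> ?A"
    proof
      assume "2 * k + 1 \<in> ?A"
      moreover have "2 * k + 1 \<in> {p (2 * h k), p (2 * h k + 1)}" using IH by simp
      ultimately have "2 * h (Suc k) \<in> {2 * h k, 2 * h k + 1} \<or> 2 * h (Suc k) + 1 \<in> {2 * h k, 2 * h k + 1}"
        using inj by (metis insert_iff singletonD)
      then show False using \<open>h (Suc k) \<noteq> h k\<close> by (auto; presburger)
    qed
    then show ?case using mem step[OF hn[OF Suc.prems]]
      by (auto simp: step_sign_def split: if_splits)
  qed
  have "inj_on h {..<n}"
  proof (rule inj_onI)
    fix k l assume "k \<in> {..<n}" "l \<in> {..<n}" "h k = h l"
    then have "{2 * k, 2 * k + 1} = {2 * l, 2 * l + 1}" using key by (metis lessThan_iff)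
    then show "k = l" by (auto simp: doubleton_eq_iff)
  qed
  moreover have "h ` {..<n} \<subseteq> {..<n}" using hn by auto
  ultimately have "bij_betw h {..<n} {..<n}"
    by (simp add: bij_betw_def endo_inj_surj)
  moreover have "max (p (2 * h k)) (p (2 * h k + 1)) = 2 * k + 1" if "k < n" for k
    using key[OF that] by (auto simp: doubleton_eq_iff)
  ultimately show ?thesis using that by blast
qed

lemma integrable_gaussian_power:
  "integrable \<nu> (\<lambda>z. cmod z ^ k)"
proof (rule integrableI_nonneg)
  have "(\<integral>\<^sup>+ z. ennreal (cmod z ^ k) \<partial>\<nu>) \<le> (\<integral>\<^sup>+ z. 1 + ennreal (((cmod z)\<^sup>2) ^ k) \<partial>\<nu>)"
  proof (rule nn_integral_mono)
    fix z :: complex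
    have "cmod z ^ k \<le> 1 + ((cmod z)\<^sup>2) ^ k"
    proof (cases "cmod z \<le> 1")
      case True
      then show ?thesis by (simp add: power_le_one add_increasing2)
    next
      case False
      then have "cmod z ^ k \<le> cmod z ^ (2 * k)" by (intro power_increasing) auto
      then show ?thesis by (simp add: power_mult)
    qed
    then show "ennreal (cmod z ^ k) \<le> 1 + ennreal (((cmod z)\<^sup>2) ^ k)"
      by (metis ennreal_1 ennreal_leI ennreal_plus zero_le_one zero_le_power2 zero_le_power)
  qed
  also have "\<dots> = 1 + ennreal (fact k)"
    using nn_integral_gaussian_radial[of "\<lambda>t. ennreal (t ^ k)"] nn_integral_exp_power[of k]
    by (simp add: nn_integral_add gaussian.emeasure_space_1[simplified])
  also have "\<dots> < \<infinity>" by (simp add: less_top)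
  finally show "(\<integral>\<^sup>+ z. ennreal (cmod z ^ k) \<partial>\<nu>) < \<infinity>" .
qed auto

lemma integrable_gaussian_monomial:
  assumes [measurable]: "G \<in> borel_measurable borel" and G: "\<And>t. 0 \<le> t \<Longrightarrow> \<bar>G t\<bar> \<le> 1"
  shows "integrable \<nu> (\<lambda>z. z ^ a * cnj z ^ b * of_real (G ((cmod z)\<^sup>2)))"
proof (rule Bochner_Integration.integrable_bound[OF integrable_gaussian_power[of "a + b"]])
  show "AE z in \<nu>. norm (z ^ a * cnj z ^ b * complex_of_real (G ((cmod z)\<^sup>2))) \<le> norm (cmod z ^ (a + b))"
    using G by (intro AE_I2) (auto simp: norm_mult norm_power power_add mult_left_le)
qed measurable

lemma integral_gaussian_rotate:
  fixes f :: "complex \<Rightarrow> complex"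
  assumes [measurable]: "f \<in> borel_measurable borel" and w: "cmod w = 1"
  shows "(\<integral>z. f (w * z) \<partial>\<nu>) = (\<integral>z. f z \<partial>\<nu>)"
proof -
  have "distr \<nu> borel ((*) w) = \<nu>"
  proof (rule measure_eqI)
    fix A assume "A \<in> sets (distr \<nu> borel ((*) w))"
    then have [measurable]: "A \<in> sets borel" by simp
    have "emeasure (distr \<nu> borel ((*) w)) A = (\<integral>\<^sup>+ z. indicator A (w * z) \<partial>\<nu>)"
      by (subst nn_integral_distr[of _ \<nu> borel "indicator A", symmetric]) auto
    also have "\<dots> = emeasure \<nu> A"
      by (subst nn_integral_gaussian_rotate[OF _ w]) auto
    finally show "emeasure (distr \<nu> borel ((*) w)) A = emeasure \<nu> A" .
  qed simp
  moreover have "(\<integral>z. f (w * z) \<partial>\<nu>) = (\<integral>z. f z \<partial>distr \<nu> borel ((*) w))"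
    by (rule integral_distr[symmetric]) measurable
  ultimately show ?thesis by simp
qed

text \<open>
  Rotating by an angle \<open>\<theta>\<close> multiplies the integral by \<open>cis ((a - b) \<theta>)\<close>; the angle is chosen to make
  this factor \<open>-1\<close>.
\<close>

lemma integral_gaussian_monomial:
  assumes [measurable]: "G \<in> borel_measurable borel" and ab: "a \<noteq> b"
  shows "(\<integral>z. z ^ a * cnj z ^ b * of_real (G ((cmod z)\<^sup>2)) \<partial>\<nu>) = 0"
proof -
  (* (a - b) * \<theta> = pi *)
  define \<theta> where "\<theta> = pi / (real a - real b)"
  define w where "w = cis \<theta>"
  have w1: "cmod w = 1" by (simp add: w_def)
  have "w ^ a * cnj w ^ b = cis (real a * \<theta> - real b * \<theta>)"
    unfolding w_def by (simp only: cis_cnj Complex.DeMoivre cis_mult) simp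
  also have "real a * \<theta> - real b * \<theta> = pi"
    unfolding left_diff_distrib[symmetric] \<theta>_def using ab by simp
  finally have w: "w ^ a * cnj w ^ b = -1" by simp
  let ?f = "\<lambda>z. z ^ a * cnj z ^ b * complex_of_real (G ((cmod z)\<^sup>2))"
  have "(\<integral>z. ?f z \<partial>\<nu>) = (\<integral>z. ?f (w * z) \<partial>\<nu>)"
    by (rule integral_gaussian_rotate[symmetric, OF _ w1]) measurable
  also have "\<dots> = (\<integral>z. (w ^ a * cnj w ^ b) * ?f z \<partial>\<nu>)"
    by (intro Bochner_Integration.integral_cong refl) (simp add: power_mult_distrib norm_mult w1 mult_ac)
  also have "\<dots> = - (\<integral>z. ?f z \<partial>\<nu>)" unfolding w by simp
  finally show ?thesis by simp
qed

text \<open>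
  The factor \<open>z - cnj z\<close> shifts one of the two exponents by one, so the only monomials with a nonzero
  integral are those whose exponents are adjacent. The fourth power of the modulus comes from the
  conditioning at zero.
\<close>

lemma integral_gaussian_skew_product:
  fixes G :: "real \<Rightarrow> real" and a b :: nat
  assumes [measurable]: "G \<in> borel_measurable borel" and G: "\<And>t. 0 \<le> t \<Longrightarrow> \<bar>G t\<bar> \<le> 1"
  defines "f \<equiv> \<lambda>z. z ^ a * cnj z ^ b * of_real (cmod z ^ 4) * (z - cnj z) * of_real (G ((cmod z)\<^sup>2))"
  shows "integrable \<nu> f"
    and "(\<integral>z. f z \<partial>\<nu>) = of_int (step_sign a b)
        * of_real (\<integral>z. ((cmod z)\<^sup>2) ^ (max a b + 2) * G ((cmod z)\<^sup>2) \<partial>\<nu>)"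
proof -
  let ?m = "\<lambda>a b z. z ^ a * cnj z ^ b * complex_of_real (G ((cmod z)\<^sup>2))"
  have four: "complex_of_real (cmod z ^ 4) = z ^ 2 * cnj z ^ 2" for z
  proof -
    have "complex_of_real (cmod z ^ 4) = (complex_of_real ((cmod z)\<^sup>2))\<^sup>2"
        by (simp add: power_mult[symmetric])
    also have "\<dots> = z ^ 2 * cnj z ^ 2" by (simp only: complex_norm_square power_mult_distrib)
    finally show ?thesis .
  qed
  have f: "f = (\<lambda>z. ?m (a + 3) (b + 2) z - ?m (a + 2) (b + 3) z)"
    unfolding f_def four by (rule ext) (simp add: algebra_simps power_add power2_eq_square power3_eq_cube)
  show "integrable \<nu> f"
    unfolding f using G by (intro Bochner_Integration.integrable_diff integrable_gaussian_monomial) auto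
  have int: "(\<integral>z. f z \<partial>\<nu>) = (\<integral>z. ?m (a + 3) (b + 2) z \<partial>\<nu>) - (\<integral>z. ?m (a + 2) (b + 3) z \<partial>\<nu>)"
    unfolding f using G by (intro Bochner_Integration.integral_diff integrable_gaussian_monomial) auto
  have diag: "(\<integral>z. ?m c c z \<partial>\<nu>) = of_real (\<integral>z. ((cmod z)\<^sup>2) ^ c * G ((cmod z)\<^sup>2) \<partial>\<nu>)" for c
  proof -
    have "?m c c = (\<lambda>z. of_real (((cmod z)\<^sup>2) ^ c * G ((cmod z)\<^sup>2)))"
      by (rule ext) (simp only: of_real_mult of_real_power[of "(cmod _)\<^sup>2"] complex_norm_square
          power_mult_distrib)
    then show ?thesis by (simp only: integral_complex_of_real)
  qed
  consider "a + 1 = b" | "a = b + 1" | "a + 1 \<noteq> b" "a \<noteq> b + 1" by blast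
  then show "(\<integral>z. f z \<partial>\<nu>) = of_int (step_sign a b)
      * of_real (\<integral>z. ((cmod z)\<^sup>2) ^ (max a b + 2) * G ((cmod z)\<^sup>2) \<partial>\<nu>)"
  proof cases
    case 1
    then have "a + 3 = b + 2" "max a b + 2 = b + 2" "a + 2 \<noteq> b + 3" by auto
    then show ?thesis
      unfolding int \<open>a + 3 = b + 2\<close> diag using 1 integral_gaussian_monomial[of G "a + 2" "b + 3"]
      by (simp add: step_sign_def)
  next
    case 2
    then have *: "b + 3 = a + 2" "max a b + 2 = a + 2" "a + 3 \<noteq> b + 2" by auto
    then show ?thesis
      unfolding int \<open>b + 3 = a + 2\<close> diag using 2 integral_gaussian_monomial[of G "a + 3" "b + 2"]
      by (simp add: step_sign_def)
  next
    case 3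
    then show ?thesis
      unfolding int using integral_gaussian_monomial[of G "a + 3"
          "b + 2"] integral_gaussian_monomial[of G "a + 2" "b + 3"]
      by (simp add: step_sign_def)
  qed
qed

section \<open>Product functions of the squared radii\<close>

abbreviation eigenvalue_gaussian :: "nat \<Rightarrow> (nat \<Rightarrow> complex) measure" where
  "eigenvalue_gaussian N \<equiv> PiM {2..N} (\<lambda>_. \<nu>)"

definition radial_moment :: "(real \<Rightarrow> real) \<Rightarrow> nat \<Rightarrow> real" where
  "radial_moment G k = (\<integral>z. ((cmod z)\<^sup>2) ^ k * G ((cmod z)\<^sup>2) \<partial>\<nu>)"

text \<open>
  The signed number of permutations that tile. It multiplies every radial integral in the same way, so
  it cancels from normalized expectations once it is known to be nonzero.
\<close>

definition tiling_constant :: "nat \<Rightarrow> int" where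
  "tiling_constant n = (\<Sum>p | p permutes {0..<2 * n}. sign p
      * (\<Prod>i<n. step_sign (p (2 * i)) (p (2 * i + 1))))"

lemma measurable_cond_eigenvalue_weight[measurable]:
  "cond_eigenvalue_weight N \<in> borel_measurable (PiM {2..N} (\<lambda>_. \<nu>))"
proof -
  have [measurable]: "(\<lambda>lam. lam i) \<in> borel_measurable (PiM {2..N} (\<lambda>_. \<nu>))" if "2 \<le> i" "i \<le> N" for i
    using measurable_component_singleton[of i "{2..N}" "\<lambda>_. \<nu>"] that by simp
  have "(\<lambda>lam. (\<Prod>i\<in>{2..N}. cmod (lam i) ^ 4)) \<in> borel_measurable (PiM {2..N} (\<lambda>_. \<nu>))"
    by (intro borel_measurable_prod) auto
  moreover have "(\<lambda>lam. (\<Prod>i\<in>{2..N}. \<Prod>j\<in>{i<..N}. (cmod (lam i - lam j))\<^sup>2))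
      \<in> borel_measurable (PiM {2..N} (\<lambda>_. \<nu>))"
    by (intro borel_measurable_prod) auto
  moreover have "(\<lambda>lam. (\<Prod>i\<in>{2..N}. \<Prod>j\<in>{i..N}. (cmod (lam i - cnj (lam j)))\<^sup>2))
      \<in> borel_measurable (PiM {2..N} (\<lambda>_. \<nu>))"
    by (intro borel_measurable_prod) auto
  ultimately show ?thesis
    unfolding cond_eigenvalue_weight_def by (intro borel_measurable_times)
qed

lemma cond_eigenvalue_weight_nonneg: "0 \<le> cond_eigenvalue_weight N lam"
  unfolding cond_eigenvalue_weight_def by (intro mult_nonneg_nonneg prod_nonneg) auto

text \<open>
  The Leibniz expansion makes the integrand a sum of products over the eigenvalues, so each term is a
  product of one-variable integrals. By uniqueness of the domino tiling, every nonzero term contains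
  each of the radial moments of orders \<open>3, 5, \<dots>, 2n + 1\<close> exactly once.
\<close>

lemma radial_product_expansion:
  assumes [measurable]: "G \<in> borel_measurable borel" and G: "\<And>t. 0 \<le> t \<Longrightarrow> \<bar>G t\<bar> \<le> 1"
  shows "integrable (eigenvalue_gaussian (n + 1))
      (\<lambda>lam. cond_eigenvalue_weight (n + 1) lam * (\<Prod>i\<in>{2..n + 1}. G ((cmod (lam i))\<^sup>2)))"
      (is "integrable ?P ?h")
    and "(\<integral>lam. cond_eigenvalue_weight (n + 1) lam
        * (\<Prod>i\<in>{2..n + 1}. G ((cmod (lam i))\<^sup>2)) \<partial>eigenvalue_gaussian (n + 1))
      = of_int (tiling_constant n) * (\<Prod>k<n. radial_moment G (2 * k + 3))"
proof -
  let ?a = "\<lambda>p i. p (2 * (i - 2)) :: nat" and ?b = "\<lambda>p i. p (2 * (i - 2) + 1) :: nat"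
  let ?f = "\<lambda>p i z. z ^ ?a p i * cnj z ^ ?b p i * of_real (cmod z ^ 4) * (z - cnj z)
      * complex_of_real (G ((cmod z)\<^sup>2))"
  let ?S = "{p. p permutes {0..<2 * n}}"
  have expand: "complex_of_real (?h lam) = (\<Sum>p\<in>?S. of_int (sign p) * (\<Prod>i\<in>{2..n + 1}. ?f p i (lam i)))"
      for lam
  proof -
    have "(\<Prod>s<2 * n. \<Prod>r<s. conj_pairs lam s - conj_pairs lam r)
        = (\<Sum>p\<in>?S. of_int (sign p) * (\<Prod>i<n. lam (i + 2) ^ p (2 * i) * cnj (lam (i + 2)) ^ p (2 * i + 1)))"
      unfolding vandermonde_leibniz prod_lessThan_double by (simp add: conj_pairs_def)
    then have "complex_of_real (?h lam)
        = (\<Sum>p\<in>?S. of_int (sign p) * ((\<Prod>i<n. of_real (cmod (lam (i + 2)) ^ 4)) *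
        (\<Prod>i<n. lam (i + 2) ^ p (2 * i) * cnj (lam (i + 2)) ^ p (2 * i + 1))
            * (\<Prod>i<n. lam (i + 2) - cnj (lam (i + 2))) *
        (\<Prod>i<n. complex_of_real (G ((cmod (lam (i + 2)))\<^sup>2)))))"
      unfolding of_real_mult cond_eigenvalue_weight_vandermonde of_real_prod prod_shift_two
      by (simp only: sum_distrib_left sum_distrib_right ac_simps)
    also have "\<dots> = (\<Sum>p\<in>?S. of_int (sign p) * (\<Prod>i\<in>{2..n + 1}. ?f p i (lam i)))"
      unfolding prod_shift_two prod.distrib[symmetric] by (simp add: mult_ac)
    finally show ?thesis .
  qed
  have int1: "integrable \<nu> (?f p i)" for p i
    using integral_gaussian_skew_product(1)[of G "?a p i" "?b p i"] G by simp
  have intp: "integrable ?P (\<lambda>lam. \<Prod>i\<in>{2..n + 1}. ?f p i (lam i))" for p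
    by (intro gaussians.product_integrable_prod int1) simp
  have intc: "integrable ?P (\<lambda>lam. complex_of_real (?h lam))"
    unfolding expand by (intro Bochner_Integration.integrable_sum integrable_mult_right intp)
  then show "integrable ?P ?h" by (simp only: complex_of_real_integrable_eq)
  have tile: "of_int (sign p) * (\<Prod>i\<in>{2..n + 1}. \<integral>z. ?f p i z \<partial>\<nu>) =
      of_int (sign p * (\<Prod>i<n. step_sign (p (2 * i)) (p (2 * i + 1))))
          * complex_of_real (\<Prod>k<n. radial_moment G (2 * k + 3))"
    if p: "p permutes {0..<2 * n}" for p
  proof -
    have "(\<Prod>i\<in>{2..n + 1}. \<integral>z. ?f p i z \<partial>\<nu>)
        = (\<Prod>i<n. of_int (step_sign (p (2 * i)) (p (2 * i + 1)))
        * complex_of_real (radial_moment G (max (p (2 * i)) (p (2 * i + 1)) + 2)))"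
      unfolding prod_shift_two using integral_gaussian_skew_product(2)[OF assms]
      by (simp add: radial_moment_def)
    also have "\<dots> = of_int (\<Prod>i<n. step_sign (p (2 * i)) (p (2 * i + 1)))
        * complex_of_real (\<Prod>i<n. radial_moment G (max (p (2 * i)) (p (2 * i + 1)) + 2))"
      by (simp add: prod.distrib)
    also have "\<dots> = of_int (\<Prod>i<n. step_sign (p (2 * i)) (p (2 * i + 1)))
        * complex_of_real (\<Prod>k<n. radial_moment G (2 * k + 3))"
    proof (cases "\<exists>i<n. step_sign (p (2 * i)) (p (2 * i + 1)) = 0")
      case True
      then have "(\<Prod>i<n. step_sign (p (2 * i)) (p (2 * i + 1))) = 0" by (intro prod_zero) auto
      then show ?thesis by simp
    next
      case False
      with domino_tiling_unique[OF p] obtain h where h: "bij_betw h {..<n} {..<n}"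
        "\<And>k. k < n \<Longrightarrow> max (p (2 * h k)) (p (2 * h k + 1)) = 2 * k + 1" by blast
      have "(\<Prod>i<n. radial_moment G (max (p (2 * i)) (p (2 * i + 1)) + 2))
          = (\<Prod>k<n. radial_moment G (max (p (2 * h k)) (p (2 * h k + 1)) + 2))"
        by (rule prod.reindex_bij_betw[OF h(1), symmetric])
      also have "\<dots> = (\<Prod>k<n. radial_moment G (2 * k + 3))"
        using h(2) by (intro prod.cong refl) (simp add: numeral_3_eq_3)
      finally show ?thesis by simp
    qed
    finally show ?thesis by simp
  qed
  have "complex_of_real (\<integral>lam. ?h lam \<partial>?P) = (\<integral>lam. complex_of_real (?h lam) \<partial>?P)"
    by (rule integral_complex_of_real[symmetric])
  also have "\<dots> = (\<Sum>p\<in>?S. \<integral>lam. of_int (sign p) * (\<Prod>i\<in>{2..n + 1}. ?f p i (lam i)) \<partial>?P)"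
    unfolding expand by (intro Bochner_Integration.integral_sum integrable_mult_right intp)
  also have "\<dots> = (\<Sum>p\<in>?S. of_int (sign p) * (\<Prod>i\<in>{2..n + 1}. \<integral>z. ?f p i z \<partial>\<nu>))"
  proof (intro sum.cong refl)
    fix p
    show "(\<integral>lam. of_int (sign p) * (\<Prod>i\<in>{2..n + 1}. ?f p i (lam i)) \<partial>?P)
        = of_int (sign p) * (\<Prod>i\<in>{2..n + 1}. \<integral>z. ?f p i z \<partial>\<nu>)"
      by (subst gaussians.product_integral_prod[of "{2..n + 1}" "?f p", OF _ int1, symmetric])
        (simp_all only: integral_mult_right_zero finite_atLeastAtMost)
  qed
  also have "\<dots> = (\<Sum>p\<in>?S. of_int (sign p * (\<Prod>i<n. step_sign (p (2 * i)) (p (2 * i + 1))))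
      * complex_of_real (\<Prod>k<n. radial_moment G (2 * k + 3)))"
    by (intro sum.cong refl tile) simp
  also have "\<dots> = complex_of_real (of_int (tiling_constant n) * (\<Prod>k<n. radial_moment G (2 * k + 3)))"
    by (simp only: tiling_constant_def sum_distrib_right[symmetric] of_int_sum of_real_sum of_real_mult
        of_real_of_int_eq)
  finally show "(\<integral>lam. ?h lam \<partial>?P) = of_int (tiling_constant n) * (\<Prod>k<n. radial_moment G (2 * k + 3))"
    by (simp only: of_real_eq_iff)
qed

lemma emeasure_gaussian_ball_pos:
  assumes "0 < r"
  shows "0 < emeasure \<nu> (ball c r)"
proof -
  have "emeasure \<nu> (ball c r) \<noteq> 0"
  proof
    assume "emeasure \<nu> (ball c r) = 0"
    then have "AE z in lborel. z \<in> ball c r \<longrightarrow> ennreal (exp (- (cmod z)\<^sup>2) / pi) = 0"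
      using null_sets_density_iff[of "\<lambda>z. ennreal (exp (- (cmod z)\<^sup>2) / pi)" lborel "ball c r"]
      by (auto simp: std_complex_gaussian_def null_sets_def)
    then have "AE z in lborel. z \<notin> ball c r"
      by eventually_elim (use pi_gt_zero in \<open>auto simp: ennreal_eq_0_iff divide_le_0_iff not_le[symmetric]\<close>)
    then have "emeasure lborel (ball c r) = 0"
      by (subst (asm) AE_iff_measurable[of "ball c r"]) auto
    then show False
      using assms by (simp add: emeasure_ball unit_ball_vol_2 zero_less_mult_iff)
  qed
  then show ?thesis by (simp add: zero_less_iff_neq_zero)
qed

text \<open>
  The weight is positive when each \<open>\<lambda>\<^sub>j\<close> lies in a small disc around \<open>j\<close> times the imaginary unit: then
  the \<open>\<lambda>\<^sub>j\<close> have distinct positive imaginary parts. The product of these discs has positive mass.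
\<close>

lemma cond_eigenvalue_weight_integral_pos:
  "0 < (\<integral>lam. cond_eigenvalue_weight (n + 1) lam \<partial>eigenvalue_gaussian (n + 1))"
proof -
  let ?P = "eigenvalue_gaussian (n + 1)"
  interpret P: prob_space ?P
    by (rule prob_space_gaussian_family)
  have int: "integrable ?P (cond_eigenvalue_weight (n + 1))"
    using radial_product_expansion(1)[of "\<lambda>_. 1" n] by simp
  let ?B = "PiE {2..n + 1} (\<lambda>j. ball (\<i> * of_nat j) (1 / 4))"
  have B: "emeasure ?P ?B \<noteq> 0"
    using emeasure_gaussian_ball_pos[of "1 / 4"]
    by (subst gaussians.emeasure_PiM) (auto simp: less_le)
  have pos: "0 < cond_eigenvalue_weight (n + 1) lam" if "lam \<in> ?B" for lam
  proof -
    have Im: "real j - 1 / 4 < Im (lam j)" "Im (lam j) < real j + 1 / 4" if "j \<in> {2..n + 1}" for j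
    proof -
      have "cmod (lam j - \<i> * of_nat j) < 1 / 4"
        using \<open>lam \<in> ?B\<close> that by (auto simp: PiE_iff dist_norm norm_minus_commute)
      then have "\<bar>Im (lam j - \<i> * of_nat j)\<bar> < 1 / 4"
        using abs_Im_le_cmod order.strict_trans1 by blast
      then have "\<bar>Im (lam j) - real j\<bar> < 1 / 4" by simp
      then show "real j - 1 / 4 < Im (lam j)" "Im (lam j) < real j + 1 / 4" by linarith+
    qed
    have "lam i \<noteq> 0" if "i \<in> {2..n + 1}" for i using Im[OF that] that by auto
    moreover have "lam i \<noteq> lam j" if "i \<in> {2..n + 1}" "j \<in> {i<..n + 1}" for i j
    proof -
      have "Im (lam i) < Im (lam j)" using Im[of i] Im[of j] that by auto
      then show ?thesis by auto
    qed
    moreover have "lam i \<noteq> cnj (lam j)" if "i \<in> {2..n + 1}" "j \<in> {i..n + 1}" for i j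
    proof -
      have "0 < Im (lam i)" "0 < Im (lam j)" using Im[of i] Im[of j] that by auto
      then show ?thesis by auto
    qed
    ultimately show ?thesis
      unfolding cond_eigenvalue_weight_def by (intro mult_pos_pos prod_pos) auto
  qed
  have "(\<integral>lam. cond_eigenvalue_weight (n + 1) lam \<partial>?P) \<noteq> 0"
  proof
    assume "(\<integral>lam. cond_eigenvalue_weight (n + 1) lam \<partial>?P) = 0"
    then have "AE lam in ?P. cond_eigenvalue_weight (n + 1) lam = 0"
      using integral_nonneg_eq_0_iff_AE[OF int] cond_eigenvalue_weight_nonneg by auto
    then have "AE lam in ?P. lam \<notin> ?B"
      by eventually_elim (use pos in fastforce)
    moreover have "?B \<in> sets ?P" by (intro sets_PiM_I_finite) auto
    ultimately have "?B \<in> null_sets ?P" by (simp only: AE_iff_null_sets)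
    then have "emeasure ?P ?B = 0" by (rule null_setsD1)
    with B show False by simp
  qed
  then show ?thesis
    using cond_eigenvalue_weight_nonneg by (simp add: less_le integral_nonneg)
qed

section \<open>Normalized radial moments\<close>

lemma ennreal_radial_moment:
  assumes [measurable]: "G \<in> borel_measurable borel" and G: "\<And>t. 0 \<le> t \<Longrightarrow> 0 \<le> G t" "\<And>t. 0 \<le> t \<Longrightarrow> G t \<le> 1"
  shows "ennreal (radial_moment G k)
      = (\<integral>\<^sup>+ t. ennreal (exp (- t)) * indicator {0..} t * ennreal (t ^ k * G t) \<partial>lborel)"
proof -
  have "integrable \<nu> (\<lambda>z. ((cmod z)\<^sup>2) ^ k * G ((cmod z)\<^sup>2))"
  proof (rule Bochner_Integration.integrable_bound[OF integrable_gaussian_power[of "2 * k"]])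
    show "AE z in \<nu>. norm (((cmod z)\<^sup>2) ^ k * G ((cmod z)\<^sup>2)) \<le> norm (cmod z ^ (2 * k))"
      using G by (intro AE_I2) (auto simp: abs_mult power_mult intro!: mult_left_le)
  qed measurable
  then have "ennreal (radial_moment G k) = (\<integral>\<^sup>+ z. ennreal (((cmod z)\<^sup>2) ^ k * G ((cmod z)\<^sup>2)) \<partial>\<nu>)"
    unfolding radial_moment_def using G by (intro nn_integral_eq_integral[symmetric]) auto
  also have "\<dots> = (\<integral>\<^sup>+ t. ennreal (exp (- t)) * indicator {0..} t * ennreal (t ^ k * G t) \<partial>lborel)"
    by (rule nn_integral_gaussian_radial) measurable
  finally show ?thesis .
qed

lemma radial_moment_nonneg:
  assumes "\<And>t. 0 \<le> t \<Longrightarrow> 0 \<le> G t"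
  shows "0 \<le> radial_moment G k"
  unfolding radial_moment_def using assms by (intro Bochner_Integration.integral_nonneg) auto

lemma radial_moment_one: "radial_moment (\<lambda>_. 1) k = fact k"
proof -
  have "ennreal (radial_moment (\<lambda>_. 1) k) = ennreal (fact k)"
    using ennreal_radial_moment[of "\<lambda>_. 1" k] nn_integral_exp_power[of k] by simp
  then show ?thesis
    by (simp add: radial_moment_nonneg)
qed

lemma nn_integral_cond_eigenvalue_law:
  assumes [measurable]: "f \<in> borel_measurable (eigenvalue_gaussian N)"
  shows "(\<integral>\<^sup>+ lam. f lam \<partial>cond_eigenvalue_law N) =
    (\<integral>\<^sup>+ lam. ennreal (cond_eigenvalue_weight N lam) * f lam \<partial>eigenvalue_gaussian N) /
    (\<integral>\<^sup>+ lam. ennreal (cond_eigenvalue_weight N lam) \<partial>eigenvalue_gaussian N)"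
proof -
  let ?Z = "\<integral>\<^sup>+ lam. ennreal (cond_eigenvalue_weight N lam) \<partial>eigenvalue_gaussian N"
  have "(\<integral>\<^sup>+ lam. f lam \<partial>cond_eigenvalue_law N)
      = (\<integral>\<^sup>+ lam. inverse ?Z * (ennreal (cond_eigenvalue_weight N lam) * f lam) \<partial>eigenvalue_gaussian N)"
    unfolding cond_eigenvalue_law_def Let_def
    by (subst nn_integral_density) (auto simp: divide_ennreal_def mult_ac)
  also have "\<dots> = inverse ?Z * (\<integral>\<^sup>+ lam. ennreal (cond_eigenvalue_weight N lam)
      * f lam \<partial>eigenvalue_gaussian N)"
    by (rule nn_integral_cmult) measurable
  finally show ?thesis by (simp add: divide_ennreal_def mult.commute)
qed

text \<open>
  Kostlan's theorem for product functions: \<open>radial_moment G (2k + 3) / fact (2k + 3)\<close> is the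
  expectation of \<open>G\<close> at a gamma variable of parameter \<open>2k + 4\<close>.
\<close>

lemma nn_integral_cond_eigenvalue_product:
  assumes [measurable]: "G \<in> borel_measurable borel" and G: "\<And>t. 0 \<le> t \<Longrightarrow> 0 \<le> G t" "\<And>t. 0 \<le> t \<Longrightarrow> G t \<le> 1"
  shows "(\<integral>\<^sup>+ lam. ennreal (\<Prod>i\<in>{2..n + 1}. G ((cmod (lam i))\<^sup>2)) \<partial>cond_eigenvalue_law (n + 1)) =
    ennreal (\<Prod>k<n. radial_moment G (2 * k + 3) / fact (2 * k + 3))"
proof -
  let ?P = "eigenvalue_gaussian (n + 1)" and ?w = "cond_eigenvalue_weight (n + 1)"
  have nn: "(\<integral>\<^sup>+ lam. ennreal (?w lam) * ennreal (\<Prod>i\<in>{2..n + 1}. G ((cmod (lam i))\<^sup>2)) \<partial>?P) =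
     ennreal (of_int (tiling_constant n) * (\<Prod>k<n. radial_moment G (2 * k + 3)))"
    if [measurable]: "G \<in> borel_measurable borel" and G: "\<And>t. 0 \<le> t \<Longrightarrow> 0 \<le> G t" "\<And>t. 0 \<le> t \<Longrightarrow> G t \<le> 1" for G
  proof -
    have G': "\<bar>G t\<bar> \<le> 1" if "0 \<le> t" for t using G that by auto
    have "(\<integral>\<^sup>+ lam. ennreal (?w lam) * ennreal (\<Prod>i\<in>{2..n + 1}. G ((cmod (lam i))\<^sup>2)) \<partial>?P) =
      (\<integral>\<^sup>+ lam. ennreal (?w lam * (\<Prod>i\<in>{2..n + 1}. G ((cmod (lam i))\<^sup>2))) \<partial>?P)"
      using cond_eigenvalue_weight_nonneg by (simp add: ennreal_mult')
    also have "\<dots> = ennreal (\<integral>lam. ?w lam * (\<Prod>i\<in>{2..n + 1}. G ((cmod (lam i))\<^sup>2)) \<partial>?P)"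
      using G cond_eigenvalue_weight_nonneg
      by (intro nn_integral_eq_integral radial_product_expansion(1) G')
          (auto intro!: mult_nonneg_nonneg prod_nonneg)
    also have "\<dots> = ennreal (of_int (tiling_constant n) * (\<Prod>k<n. radial_moment G (2 * k + 3)))"
      by (subst radial_product_expansion(2)) (use G' in auto)
    finally show ?thesis .
  qed
  have one: "(\<integral>lam. ?w lam \<partial>?P) = of_int (tiling_constant n) * (\<Prod>k<n. fact (2 * k + 3))"
    using radial_product_expansion(2)[of "\<lambda>_. 1" n] by (simp add: radial_moment_one)
  have C: "0 < real_of_int (tiling_constant n)"
  proof -
    have "0 < (\<Prod>k<n. fact (2 * k + 3) :: real)" by (intro prod_pos) auto
    then show ?thesis
      using cond_eigenvalue_weight_integral_pos[of n] unfolding one by (simp add: zero_less_mult_iff)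
  qed
  have Z: "(\<integral>\<^sup>+ lam. ennreal (?w lam) \<partial>?P)
      = ennreal (of_int (tiling_constant n) * (\<Prod>k<n. fact (2 * k + 3)))"
    using nn[of "\<lambda>_. 1"] by (simp add: radial_moment_one)
  have "(\<integral>\<^sup>+ lam. ennreal (\<Prod>i\<in>{2..n + 1}. G ((cmod (lam i))\<^sup>2)) \<partial>cond_eigenvalue_law (n + 1)) =
     ennreal (of_int (tiling_constant n) * (\<Prod>k<n. radial_moment G (2 * k + 3)))
         / ennreal (of_int (tiling_constant n) * (\<Prod>k<n. fact (2 * k + 3)))"
    by (subst nn_integral_cond_eigenvalue_law) (simp_all only: nn[OF assms] Z, measurable)
  also have "\<dots> = ennreal (\<Prod>k<n. radial_moment G (2 * k + 3) / fact (2 * k + 3))"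
    using C G(1) radial_moment_nonneg[of G]
    by (subst divide_ennreal) (auto intro!: mult_nonneg_nonneg prod_nonneg mult_pos_pos prod_pos simp:
        prod_dividef)
  finally show ?thesis .
qed

lemma prob_space_cond_eigenvalue_law: "prob_space (cond_eigenvalue_law N)"
proof -
  have *: "prob_space (cond_eigenvalue_law (n + 1))" for n
  proof
    have "emeasure (cond_eigenvalue_law (n + 1)) (space (cond_eigenvalue_law (n + 1)))
        = (\<integral>\<^sup>+ lam. 1 \<partial>cond_eigenvalue_law (n + 1))"
      by simp
    also have "\<dots> = 1"
      using nn_integral_cond_eigenvalue_product[of "\<lambda>_. 1" n] by (simp add: radial_moment_one)
    finally show "emeasure (cond_eigenvalue_law (n + 1)) (space (cond_eigenvalue_law (n + 1))) = 1" .
  qed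
  have "cond_eigenvalue_law 0 = cond_eigenvalue_law 1"
    by (simp add: cond_eigenvalue_law_def cond_eigenvalue_weight_def)
  then show ?thesis
    using *[of "N - 1"] *[of 0] by (cases "N = 0") auto
qed

text \<open>
  The sum of two independent exponential variables is gamma distributed of parameter two. Shearing
  \<open>(s, t)\<close> to \<open>(s, s + t)\<close> turns the double integral into one over \<open>0 \<le> s \<le> x\<close>.
\<close>

lemma nn_integral_gaussian_pair_radial:
  assumes [measurable]: "f \<in> borel_measurable borel"
  shows "(\<integral>\<^sup>+ u. \<integral>\<^sup>+ v. f ((cmod u)\<^sup>2 + (cmod v)\<^sup>2) \<partial>\<nu> \<partial>\<nu>) =
    (\<integral>\<^sup>+ s. ennreal (s * exp (- s)) * indicator {0..} s * f s \<partial>lborel)"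
proof -
  let ?H = "\<lambda>(s, x). ennreal (exp (- x)) * indicator {0..} s * indicator {s..} x * f x"
  have [measurable]: "?H \<in> borel_measurable (borel \<Otimes>\<^sub>M borel)"
  proof -
    have "?H = (\<lambda>p. ennreal (exp (- snd p)) * indicator {0..} (fst p) * indicator {p. fst p \<le> snd p} p
        * f (snd p))"
      by (auto simp: fun_eq_iff split: split_indicator)
    then show ?thesis by simp
  qed
  have "(\<integral>\<^sup>+ u. \<integral>\<^sup>+ v. f ((cmod u)\<^sup>2 + (cmod v)\<^sup>2) \<partial>\<nu> \<partial>\<nu>) =
     (\<integral>\<^sup>+ u. \<integral>\<^sup>+ t. ennreal (exp (- t)) * indicator {0..} t * f ((cmod u)\<^sup>2 + t) \<partial>lborel \<partial>\<nu>)"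
    by (intro nn_integral_cong nn_integral_gaussian_radial[where f = "\<lambda>t. f ((cmod _)\<^sup>2 + t)"]) measurable
  also have "\<dots> = (\<integral>\<^sup>+ s. ennreal (exp (- s)) * indicator {0..} s
      * (\<integral>\<^sup>+ t. ennreal (exp (- t)) * indicator {0..} t * f (s + t) \<partial>lborel) \<partial>lborel)"
    by (rule nn_integral_gaussian_radial) measurable
  also have "\<dots> = (\<integral>\<^sup>+ s. \<integral>\<^sup>+ t. ?H (s, t + s) \<partial>lborel \<partial>lborel)"
  proof (intro nn_integral_cong)
    fix s
    have "ennreal (exp (- s)) * indicator {0..} s
        * (\<integral>\<^sup>+ t. ennreal (exp (- t)) * indicator {0..} t * f (s + t) \<partial>lborel)
      = (\<integral>\<^sup>+ t. ennreal (exp (- s)) * indicator {0..} s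
          * (ennreal (exp (- t)) * indicator {0..} t * f (s + t)) \<partial>lborel)"
      by (rule nn_integral_cmult[symmetric]) measurable
    also have "\<dots> = (\<integral>\<^sup>+ t. ?H (s, t + s) \<partial>lborel)"
      by (intro nn_integral_cong)
         (auto simp: mult.assoc[symmetric] ennreal_mult'[symmetric] exp_add[symmetric] add.commute
             split: split_indicator)
    finally show "ennreal (exp (- s)) * indicator {0..} s
        * (\<integral>\<^sup>+ t. ennreal (exp (- t)) * indicator {0..} t * f (s + t) \<partial>lborel)
        = (\<integral>\<^sup>+ t. ?H (s, t + s) \<partial>lborel)" .
  qed
  also have "\<dots> = (\<integral>\<^sup>+ s. \<integral>\<^sup>+ x. ?H (s, x) \<partial>lborel \<partial>lborel)"
    by (rule nn_integral_shear_snd) measurable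
  also have "\<dots> = (\<integral>\<^sup>+ x. \<integral>\<^sup>+ s. ?H (s, x) \<partial>lborel \<partial>lborel)"
    by (rule lborel_pair.Fubini'[symmetric]) measurable
  also have "\<dots> = (\<integral>\<^sup>+ x. ennreal (x * exp (- x)) * indicator {0..} x * f x \<partial>lborel)"
  proof (intro nn_integral_cong)
    fix x :: real
    have "(\<integral>\<^sup>+ s. ?H (s, x) \<partial>lborel) = (\<integral>\<^sup>+ s. (ennreal (exp (- x)) * f x) * indicator {0..x} s \<partial>lborel)"
      by (intro nn_integral_cong) (auto split: split_indicator)
    also have "\<dots> = (ennreal (exp (- x)) * f x) * emeasure lborel {0..x}"
      by (rule nn_integral_cmult_indicator) simp
    also have "\<dots> = ennreal (x * exp (- x)) * indicator {0..} x * f x"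
      by (auto simp: ennreal_mult mult_ac split: split_indicator)
    finally show "(\<integral>\<^sup>+ s. ?H (s, x) \<partial>lborel) = ennreal (x * exp (- x)) * indicator {0..} x * f x" .
  qed
  finally show ?thesis .
qed

text \<open>
  The \<open>m\<close>-th negative moment of the factor \<open>1 + X / t\<close> that an eigenvalue of squared modulus \<open>t\<close>
  contributes to the overlap, written so that it makes sense at \<open>t = 0\<close>.
\<close>

definition overlap_factor :: "nat \<Rightarrow> real \<Rightarrow> real" where
  "overlap_factor m t = enn2real (\<integral>\<^sup>+ u. \<integral>\<^sup>+ v. ennreal ((t / (t + ((cmod u)\<^sup>2 + (cmod v)\<^sup>2))) ^ m) \<partial>\<nu> \<partial>\<nu>)"

lemma measurable_overlap_factor[measurable]: "overlap_factor m \<in> borel_measurable borel"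
  unfolding overlap_factor_def by measurable

lemma ennreal_overlap_factor_le_1:
  assumes "0 \<le> t"
  shows "(\<integral>\<^sup>+ u. \<integral>\<^sup>+ v. ennreal ((t / (t + ((cmod u)\<^sup>2 + (cmod v)\<^sup>2))) ^ m) \<partial>\<nu> \<partial>\<nu>) \<le> 1"
proof -
  have "t / (t + ((cmod u)\<^sup>2 + (cmod v)\<^sup>2)) \<le> 1" "0 \<le> t / (t + ((cmod u)\<^sup>2 + (cmod v)\<^sup>2))" for u v
    using assms by (auto simp: divide_le_eq_1 add_nonneg_nonneg)
  then have "(\<integral>\<^sup>+ u. \<integral>\<^sup>+ v. ennreal ((t / (t + ((cmod u)\<^sup>2 + (cmod v)\<^sup>2))) ^ m) \<partial>\<nu> \<partial>\<nu>)
      \<le> (\<integral>\<^sup>+ u. \<integral>\<^sup>+ v. 1 \<partial>\<nu> \<partial>\<nu>)"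
    by (intro nn_integral_mono) (simp add: power_le_one)
  then show ?thesis by (simp add: gaussian.emeasure_space_1[simplified])
qed

lemma ennreal_overlap_factor:
  assumes "0 \<le> t"
  shows "ennreal (overlap_factor m t)
      = (\<integral>\<^sup>+ u. \<integral>\<^sup>+ v. ennreal ((t / (t + ((cmod u)\<^sup>2 + (cmod v)\<^sup>2))) ^ m) \<partial>\<nu> \<partial>\<nu>)"
  unfolding overlap_factor_def using ennreal_overlap_factor_le_1[OF assms, of m]
  by (intro ennreal_enn2real) (auto simp: less_top[symmetric] top_unique)

lemma overlap_factor_bounds:
  assumes "0 \<le> t"
  shows "0 \<le> overlap_factor m t" "overlap_factor m t \<le> 1"
proof -
  show "0 \<le> overlap_factor m t" by (simp add: overlap_factor_def)
  show "overlap_factor m t \<le> 1"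
    using ennreal_overlap_factor_le_1[OF assms, of m] ennreal_overlap_factor[OF assms, of m]
        by (metis ennreal_le_1)
qed

lemma nn_integral_power_affine:
  assumes "0 \<le> (r::real)"
  shows "(\<integral>\<^sup>+ t. ennreal (t ^ p * (r - t)) * indicator {0..r} t \<partial>lborel)
      = ennreal (r ^ (p + 2) / (real (p + 1) * real (p + 2)))"
proof -
  let ?F = "\<lambda>t::real. r * t ^ (p + 1) / real (p + 1) - t ^ (p + 2) / real (p + 2)"
  have "(\<integral>\<^sup>+ t. ennreal (t ^ p * (r - t)) * indicator {0..r} t \<partial>lborel) = ennreal (?F r - ?F 0)"
  proof (rule nn_integral_FTC_Icc)
    fix t assume t: "t \<in> {0..r}"
    have *: "((\<lambda>t. t ^ (k + 1) / real (k + 1)) has_real_derivative t ^ k) (at t)" for k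
      using DERIV_cdivide[OF DERIV_pow[of "k + 1" t UNIV], of "real (k + 1)"] by simp
    have "(?F has_real_derivative r * t ^ p - t ^ (p + 1)) (at t)"
      using DERIV_diff[OF DERIV_cmult[OF *[of p], of r] *[of "p + 1"]] by (simp add: add.assoc)
    then show "(?F has_real_derivative t ^ p * (r - t)) (at t)"
      by (simp add: algebra_simps)
    show "0 \<le> t ^ p * (r - t)" using t by simp
  qed (use assms in auto)
  also have "?F r - ?F 0 = r ^ (p + 2) / (real (p + 1) * real (p + 2))"
    by (simp add: field_simps)
  finally show ?thesis .
qed

text \<open>
  Up to normalization this is the \<open>m\<close>-th moment of \<open>Y / (Y + X)\<close> for independent gamma variables of
  parameters \<open>k + 1\<close> and \<open>2\<close>. In the variables \<open>t\<close> and \<open>r = t + s\<close> the integrand separates: integrating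
  over \<open>t\<close> produces the beta integral, and what remains is the gamma integral of \<open>r\<^bsup>k+2\<^esup>\<close>.
\<close>

lemma radial_moment_overlap_factor:
  "radial_moment (overlap_factor m) k = fact (k + 2) / (real (k + m + 1) * real (k + m + 2))"
proof -
  let ?q = "\<lambda>t s. (t / (t + s)) ^ m"
  let ?H = "\<lambda>(t, r). ennreal (exp (- r) / r ^ m)
      * (ennreal (t ^ (k + m) * (r - t)) * indicator {0..r} t) * indicator {0..} r"
  have [measurable]: "?H \<in> borel_measurable (borel \<Otimes>\<^sub>M borel)"
  proof -
    have "?H = (\<lambda>p. ennreal (exp (- snd p) / snd p ^ m)
        * (ennreal (fst p ^ (k + m) * (snd p - fst p)) * indicator {p. 0 \<le> fst p \<and> fst p \<le> snd p} p)
        * indicator {0..} (snd p))"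
      by (auto simp: fun_eq_iff split: split_indicator)
    then show ?thesis by simp
  qed
  have "ennreal (radial_moment (overlap_factor m) k)
      = (\<integral>\<^sup>+ t. ennreal (exp (- t)) * indicator {0..} t * ennreal (t ^ k * overlap_factor m t) \<partial>lborel)"
    using overlap_factor_bounds by (intro ennreal_radial_moment) auto
  also have "\<dots> = (\<integral>\<^sup>+ t. \<integral>\<^sup>+ s. ?H (t, s + t) \<partial>lborel \<partial>lborel)"
  proof (intro nn_integral_cong)
    fix t :: real
    show "ennreal (exp (- t)) * indicator {0..} t * ennreal (t ^ k * overlap_factor m t)
        = (\<integral>\<^sup>+ s. ?H (t, s + t) \<partial>lborel)"
    proof (cases "0 \<le> t")
      case True
      have "ennreal (overlap_factor m t)
          = (\<integral>\<^sup>+ s. ennreal (s * exp (- s)) * indicator {0..} s * ennreal (?q t s) \<partial>lborel)"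
        unfolding ennreal_overlap_factor[OF True]
        by (rule nn_integral_gaussian_pair_radial[where f = "\<lambda>s. ennreal (?q t s)"]) measurable
      then have "ennreal (exp (- t)) * indicator {0..} t * ennreal (t ^ k * overlap_factor m t) =
          ennreal (exp (- t) * t ^ k)
              * (\<integral>\<^sup>+ s. ennreal (s * exp (- s)) * indicator {0..} s * ennreal (?q t s) \<partial>lborel)"
        using True by (simp add: ennreal_mult' mult.assoc overlap_factor_bounds)
      also have "\<dots> = (\<integral>\<^sup>+ s. ennreal (exp (- t) * t ^ k)
          * (ennreal (s * exp (- s)) * indicator {0..} s * ennreal (?q t s)) \<partial>lborel)"
        by (rule nn_integral_cmult[symmetric]) measurable
      also have "\<dots> = (\<integral>\<^sup>+ s. ?H (t, s + t) \<partial>lborel)"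
      proof (intro nn_integral_cong)
        fix s :: real
        have "ennreal (exp (- t) * t ^ k) * (ennreal (s * exp (- s)) * ennreal (?q t s))
            = ennreal (exp (- (s + t)) / (s + t) ^ m) * ennreal (t ^ (k + m) * s)" if "0 \<le> s"
        proof -
          have "exp (- t) * t ^ k * (s * exp (- s) * ?q t s)
              = exp (- (s + t)) / (s + t) ^ m * (t ^ (k + m) * s)"
            by (simp add: power_add power_divide exp_diff exp_minus field_simps exp_add)
          moreover have "ennreal (exp (- t) * t ^ k) * (ennreal (s * exp (- s)) * ennreal (?q t s))
              = ennreal (exp (- t) * t ^ k * (s * exp (- s) * ?q t s))"
            using True that by (simp add: ennreal_mult)
          moreover have "ennreal (exp (- (s + t)) / (s + t) ^ m) * ennreal (t ^ (k + m) * s)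
              = ennreal (exp (- (s + t)) / (s + t) ^ m * (t ^ (k + m) * s))"
            using True that by (intro ennreal_mult[symmetric]) auto
          ultimately show ?thesis by simp
        qed
        then show "ennreal (exp (- t) * t ^ k)
            * (ennreal (s * exp (- s)) * indicator {0..} s * ennreal (?q t s)) = ?H (t, s + t)"
          using True by (auto split: split_indicator)
      qed
      finally show ?thesis .
    qed simp
  qed
  also have "\<dots> = (\<integral>\<^sup>+ t. \<integral>\<^sup>+ r. ?H (t, r) \<partial>lborel \<partial>lborel)"
    by (rule nn_integral_shear_snd) measurable
  also have "\<dots> = (\<integral>\<^sup>+ r. \<integral>\<^sup>+ t. ?H (t, r) \<partial>lborel \<partial>lborel)"
    by (rule lborel_pair.Fubini'[symmetric]) measurable
  also have "\<dots> = (\<integral>\<^sup>+ r. ennreal (1 / (real (k + m + 1) * real (k + m + 2)))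
      * (ennreal (exp (- r)) * indicator {0..} r * ennreal (r ^ (k + 2))) \<partial>lborel)"
  proof (rule nn_integral_cong_AE, use AE_lborel_singleton[of 0] in eventually_elim)
    fix r :: real assume "r \<noteq> 0"
    show "(\<integral>\<^sup>+ t. ?H (t, r) \<partial>lborel)
        = ennreal (1 / (real (k + m + 1) * real (k + m + 2)))
        * (ennreal (exp (- r)) * indicator {0..} r * ennreal (r ^ (k + 2)))"
    proof (cases "0 \<le> r")
      case True
      then have "(\<integral>\<^sup>+ t. ?H (t, r) \<partial>lborel)
          = ennreal (exp (- r) / r ^ m)
          * (\<integral>\<^sup>+ t. ennreal (t ^ (k + m) * (r - t)) * indicator {0..r} t \<partial>lborel)"
        by (simp add: nn_integral_cmult)
      also have "\<dots> = ennreal (exp (- r) / r ^ m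
          * (r ^ (k + m + 2) / (real (k + m + 1) * real (k + m + 2))))"
        using True by (subst nn_integral_power_affine) (auto simp: ennreal_mult[symmetric])
      also have "exp (- r) / r ^ m * (r ^ (k + m + 2) / (real (k + m + 1) * real (k + m + 2)))
          = 1 / (real (k + m + 1) * real (k + m + 2)) * (exp (- r) * r ^ (k + 2))"
        using \<open>r \<noteq> 0\<close> by (simp add: power_add)
      also have "ennreal \<dots> = ennreal (1 / (real (k + m + 1) * real (k + m + 2)))
          * ennreal (exp (- r) * r ^ (k + 2))"
        by (rule ennreal_mult') simp
      also have "ennreal (exp (- r) * r ^ (k + 2)) = ennreal (exp (- r)) * ennreal (r ^ (k + 2))"
        by (rule ennreal_mult') simp
      finally show ?thesis
        using True by simp
    qed simp
  qed
  also have "\<dots> = ennreal (1 / (real (k + m + 1) * real (k + m + 2))) * ennreal (fact (k + 2))"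
    by (subst nn_integral_cmult) (auto simp only: nn_integral_exp_power, measurable)
  also have "\<dots> = ennreal (fact (k + 2) / (real (k + m + 1) * real (k + m + 2)))"
    by (subst ennreal_mult[symmetric]) auto
  finally show ?thesis
    by (subst (asm) ennreal_inj) (auto intro: radial_moment_nonneg overlap_factor_bounds)
qed

section \<open>The left eigenvector by forward substitution\<close>

text \<open>
  Forward substitution for the blocks of the left null vector. Blocks are counted from \<open>0\<close> here, so
  that \<open>left_block lam u v k\<close> is the block \<open>B\<^bsub>k+1\<^esub>\<close> and involves \<open>\<lambda>\<^bsub>k+1\<^esub>\<close>.
\<close>

function left_block :: "(nat \<Rightarrow> complex) \<Rightarrow> (nat \<times> nat \<Rightarrow> complex) \<Rightarrow> (nat \<times> nat \<Rightarrow> complex) \<Rightarrow> nat \<Rightarrow> complex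
    \<times> complex" where
  "left_block lam u v k = (if k = 0 then (1, 0) else
     (- (\<Sum>i<k. fst (left_block lam u v i) * u (Suc i, Suc k) - snd (left_block lam u v i)
         * cnj (v (Suc i, Suc k))) / lam (Suc k),
      - (\<Sum>i<k. fst (left_block lam u v i) * v (Suc i, Suc k) + snd (left_block lam u v i)
          * cnj (u (Suc i, Suc k))) / cnj (lam (Suc k))))"
  by auto
termination by (relation "Wellfounded.measure (\<lambda>(_, _, _, k). k)") auto

declare left_block.simps[simp del]

definition left_sq_norm :: "nat \<Rightarrow> (nat \<Rightarrow> complex) \<Rightarrow> (nat \<times> nat \<Rightarrow> complex) \<Rightarrow> (nat \<times> nat \<Rightarrow> complex) \<Rightarrow>
    real" where
  "left_sq_norm N lam u v = (\<Sum>k<N. (cmod (fst (left_block lam u v k)))\<^sup>2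
      + (cmod (snd (left_block lam u v k)))\<^sup>2)"

lemma sum_lessThan_double:
  fixes f :: "nat \<Rightarrow> 'a::comm_monoid_add"
  shows "(\<Sum>r<2 * n. f r) = (\<Sum>i<n. f (2 * i) + f (2 * i + 1))"
  by (induction n) (simp_all add: add.assoc)

text \<open>
  Columns \<open>2k\<close> and \<open>2k + 1\<close> of the equation \<open>L S = 0\<close>, with the vanishing lower blocks dropped.
\<close>

lemma left_null_vector_iff:
  assumes L: "L \<in> carrier_vec (2 * N)"
  shows "mat_of_row L * schur_matrix N lam u v = 0\<^sub>m 1 (2 * N) \<longleftrightarrow>
    (\<forall>k<N. (\<Sum>i<k. L $ (2 * i) * u (Suc i, Suc k) - L $ (2 * i + 1) * cnj (v (Suc i, Suc k)))
        + L $ (2 * k) * lam (Suc k) = 0 \<and>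
           (\<Sum>i<k. L $ (2 * i) * v (Suc i, Suc k) + L $ (2 * i + 1) * cnj (u (Suc i, Suc k)))
               + L $ (2 * k + 1) * cnj (lam (Suc k)) = 0)"
proof -
  let ?S = "schur_matrix N lam u v"
  have ent: "(mat_of_row L * ?S) $$ (0, c)
      = (\<Sum>i<N. L $ (2 * i) * ?S $$ (2 * i, c) + L $ (2 * i + 1) * ?S $$ (2 * i + 1, c))" if "c < 2 * N"
      for c
  proof -
    have "(mat_of_row L * ?S) $$ (0, c) = (\<Sum>r<2 * N. L $ r * ?S $$ (r, c))"
      using that L by (simp add: scalar_prod_def schur_matrix_def atLeast0LessThan)
    then show ?thesis by (simp only: sum_lessThan_double)
  qed
  have S: "?S $$ (2 * i, 2 * k) = (if i = k then lam (Suc k) else if i < k then u (Suc i, Suc k) else 0)"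
    "?S $$ (2 * i + 1, 2 * k) = (if i = k then 0 else if i < k then - cnj (v (Suc i, Suc k)) else 0)"
    "?S $$ (2 * i, 2 * k + 1) = (if i = k then 0 else if i < k then v (Suc i, Suc k) else 0)"
    "?S $$ (2 * i + 1, 2 * k + 1) =
        (if i = k then cnj (lam (Suc k)) else if i < k then cnj (u (Suc i, Suc k)) else 0)"
    if "i < N" "k < N" for i k
    using that by (auto simp: schur_matrix_def schur_block_def mat_of_rows_list_def)
  have split: "(\<Sum>i<N. f i) = (\<Sum>i<k. f i) + f k" if "k < N"
      "\<And>i. k < i \<Longrightarrow> i < N \<Longrightarrow> f i = 0" for f :: "nat \<Rightarrow> complex" and k
  proof -
    have "(\<Sum>i<N. f i) = (\<Sum>i<Suc k. f i)"
      using that by (intro sum.mono_neutral_right) auto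
    then show ?thesis by simp
  qed
  have e0: "(mat_of_row L * ?S) $$ (0, 2 * k)
      = (\<Sum>i<k. L $ (2 * i) * u (Suc i, Suc k) - L $ (2 * i + 1) * cnj (v (Suc i, Suc k))) + L $ (2 * k)
      * lam (Suc k)" if k: "k < N" for k
  proof -
    have "(mat_of_row L * ?S) $$ (0, 2 * k)
        = (\<Sum>i<N. L $ (2 * i) * ?S $$ (2 * i, 2 * k) + L $ (2 * i + 1) * ?S $$ (2 * i + 1, 2 * k))"
      using k by (intro ent) simp
    also have "\<dots> = (\<Sum>i<k. L $ (2 * i) * ?S $$ (2 * i, 2 * k) + L $ (2 * i + 1)
        * ?S $$ (2 * i + 1, 2 * k))
        + (L $ (2 * k) * ?S $$ (2 * k, 2 * k) + L $ (2 * k + 1) * ?S $$ (2 * k + 1, 2 * k))"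
      using k S by (intro split) auto
    also have "\<dots> = (\<Sum>i<k. L $ (2 * i) * u (Suc i, Suc k) - L $ (2 * i + 1) * cnj (v (Suc i, Suc k)))
        + L $ (2 * k) * lam (Suc k)"
      using k S by (intro arg_cong2[where f = "(+)"] sum.cong) auto
    finally show ?thesis .
  qed
  have e1: "(mat_of_row L * ?S) $$ (0, 2 * k + 1)
      = (\<Sum>i<k. L $ (2 * i) * v (Suc i, Suc k) + L $ (2 * i + 1) * cnj (u (Suc i, Suc k)))
      + L $ (2 * k + 1) * cnj (lam (Suc k))" if k: "k < N" for k
  proof -
    have "(mat_of_row L * ?S) $$ (0, 2 * k + 1)
        = (\<Sum>i<N. L $ (2 * i) * ?S $$ (2 * i, 2 * k + 1) + L $ (2 * i + 1) * ?S $$ (2 * i + 1, 2 * k + 1))"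
      using k by (intro ent) simp
    also have "\<dots> = (\<Sum>i<k. L $ (2 * i) * ?S $$ (2 * i, 2 * k + 1) + L $ (2 * i + 1)
        * ?S $$ (2 * i + 1, 2 * k + 1))
        + (L $ (2 * k) * ?S $$ (2 * k, 2 * k + 1) + L $ (2 * k + 1) * ?S $$ (2 * k + 1, 2 * k + 1))"
      using k S by (intro split) auto
    also have "\<dots> = (\<Sum>i<k. L $ (2 * i) * v (Suc i, Suc k) + L $ (2 * i + 1) * cnj (u (Suc i, Suc k)))
        + L $ (2 * k + 1) * cnj (lam (Suc k))"
      using k S by (intro arg_cong2[where f = "(+)"] sum.cong) auto
    finally show ?thesis .
  qed
  have "mat_of_row L * ?S = 0\<^sub>m 1 (2 * N) \<longleftrightarrow> (\<forall>c<2 * N. (mat_of_row L * ?S) $$ (0, c) = 0)"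
    using L by (auto simp: mat_eq_iff schur_matrix_def simp del: index_mult_mat(1))
  also have "\<dots> \<longleftrightarrow> (\<forall>k<N. (mat_of_row L * ?S) $$ (0, 2 * k) = 0 \<and> (mat_of_row L * ?S) $$ (0, 2 * k + 1) = 0)"
  proof safe
    fix c assume *: "\<forall>k<N. (mat_of_row L * ?S) $$ (0, 2 * k) = 0 \<and> (mat_of_row L * ?S) $$ (0, 2 * k + 1)
        = 0" and c: "c < 2 * N"
    have "c div 2 < N" using c by simp
    with * show "(mat_of_row L * ?S) $$ (0, c) = 0"
      by (cases "even c") (metis dvd_mult_div_cancel, metis odd_two_times_div_two_succ)
  qed auto
  finally show ?thesis using e0 e1 by auto
qed

text \<open>
  Nonzero diagonal entries let each column block be solved for the next block of \<open>L\<close>; the first column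
  block imposes nothing since its diagonal entry is \<open>0\<close>.
\<close>

lemma reference_left_eigenvector_eq:
  assumes N: "0 < N" and nz: "\<And>i. i \<in> {2..N} \<Longrightarrow> lam i \<noteq> 0"
  shows "reference_left_eigenvector N (schur_matrix N (lam(1 := 0)) u v) =
    vec (2 * N) (\<lambda>r. if even r then fst (left_block lam u v (r div 2)) else snd
        (left_block lam u v (r div 2)))"
    (is "_ = ?v")
  unfolding reference_left_eigenvector_def
proof (rule the_equality)
  let ?B = "left_block lam u v"
  have v: "?v \<in> carrier_vec (2 * N)" "\<And>k. k < N \<Longrightarrow> ?v $ (2 * k) = fst (?B k)"
      "\<And>k. k < N \<Longrightarrow> ?v $ (2 * k + 1) = snd (?B k)"
    by auto
  have lam: "lam (Suc k) \<noteq> 0" "(lam(1 := 0)) (Suc k) = lam (Suc k)" if "k < N" "0 < k" for k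
    using nz[of "Suc k"] that by auto
  have B: "fst (?B k) * lam (Suc k)
      = - (\<Sum>i<k. fst (?B i) * u (Suc i, Suc k) - snd (?B i) * cnj (v (Suc i, Suc k)))"
    "snd (?B k) * cnj (lam (Suc k))
        = - (\<Sum>i<k. fst (?B i) * v (Suc i, Suc k) + snd (?B i) * cnj (u (Suc i, Suc k)))" if "k < N"
        "0 < k" for k
    using lam(1)[OF that] that by (simp_all add: left_block.simps[of lam u v k])
  have "mat_of_row ?v * schur_matrix N (lam(1 := 0)) u v = 0\<^sub>m 1 (2 * N)"
    unfolding left_null_vector_iff[OF v(1)]
  proof (intro allI impI)
    fix k assume k: "k < N"
    show "(\<Sum>i<k. ?v $ (2 * i) * u (Suc i, Suc k) - ?v $ (2 * i + 1) * cnj (v (Suc i, Suc k)))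
        + ?v $ (2 * k) * (lam(1 := 0)) (Suc k) = 0 \<and>
      (\<Sum>i<k. ?v $ (2 * i) * v (Suc i, Suc k) + ?v $ (2 * i + 1) * cnj (u (Suc i, Suc k)))
          + ?v $ (2 * k + 1) * cnj ((lam(1 := 0)) (Suc k)) = 0"
    proof (cases "k = 0")
      case False
      then show ?thesis using k lam[of k] B[of k] v(2,3) by simp
    qed simp
  qed
  then show "?v \<in> carrier_vec (2 * N) \<and> ?v $ 0 = 1 \<and> ?v $ 1
      = 0 \<and> mat_of_row ?v * schur_matrix N (lam(1 := 0)) u v = 0\<^sub>m 1 (2 * N)"
    using N by (auto simp: left_block.simps[of lam u v 0])
  fix L assume "L \<in> carrier_vec (2 * N) \<and> L $ 0 = 1 \<and> L $ 1
      = 0 \<and> mat_of_row L * schur_matrix N (lam(1 := 0)) u v = 0\<^sub>m 1 (2 * N)"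
  then have L: "L \<in> carrier_vec (2 * N)" "L $ 0 = 1"
      "L $ 1 = 0" and null: "mat_of_row L * schur_matrix N (lam(1 := 0)) u v = 0\<^sub>m 1 (2 * N)" by auto
  have "L $ (2 * k) = fst (?B k) \<and> L $ (2 * k + 1) = snd (?B k)" if "k < N" for k
    using that
  proof (induction k rule: less_induct)
    case (less k)
    show ?case
    proof (cases "k = 0")
      case True
      then show ?thesis using L by (simp add: left_block.simps[of lam u v 0])
    next
      case False
      have IH: "L $ (2 * i) = fst (?B i)"
          "L $ (2 * i + 1) = snd (?B i)" if "i < k" for i using less that by auto
      have "(\<Sum>i<k. fst (?B i) * u (Suc i, Suc k) - snd (?B i) * cnj (v (Suc i, Suc k))) + L $ (2 * k)
          * lam (Suc k) = 0"
        "(\<Sum>i<k. fst (?B i) * v (Suc i, Suc k) + snd (?B i) * cnj (u (Suc i, Suc k))) + L $ (2 * k + 1)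
            * cnj (lam (Suc k)) = 0"
        using null[unfolded left_null_vector_iff[OF L(1)]] less.prems lam(2)[of k] False IH by auto
      then have "L $ (2 * k) * lam (Suc k) = fst (?B k) * lam (Suc k)"
          "L $ (2 * k + 1) * cnj (lam (Suc k)) = snd (?B k) * cnj (lam (Suc k))"
        using B[OF less.prems] False by (simp_all only: add_eq_0_iff neq0_conv)
      then show ?thesis using lam(1)[of k] False less.prems by simp
    qed
  qed
  then show "L = ?v"
  proof (intro eq_vecI)
    fix r assume *: "\<And>k. k < N \<Longrightarrow> L $ (2 * k) = fst (?B k) \<and> L $ (2 * k + 1)
        = snd (?B k)" and "r < dim_vec ?v"
    then have r: "r < 2 * N" "r div 2 < N" by auto
    show "L $ r = ?v $ r"
    proof (cases "even r")
      case True
      then obtain k where "r = 2 * k" by (elim evenE)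
      then show ?thesis using *[of k] r v(2)[of k] by simp
    next
      case False
      then obtain k where "r = 2 * k + 1" by (elim oddE)
      then show ?thesis using *[of k] r v(3)[of k] by simp
    qed
  qed (use L in auto)
qed

lemma diagonal_overlap_eq:
  "diagonal_overlap N (lam, u, v) = (if \<forall>i\<in>{2..N}. lam i \<noteq> 0 then left_sq_norm N lam u v else 0)"
proof (cases "N = 0")
  case True
  then show ?thesis by (simp add: diagonal_overlap_def reference_right_eigenvector_def vec_sq_norm_def
      left_sq_norm_def)
next
  case False
  have "vec_sq_norm (reference_right_eigenvector N) = (\<Sum>k<2 * N. if k = 0 then 1 else 0)"
    unfolding vec_sq_norm_def reference_right_eigenvector_def
    by (intro sum.cong) auto
  then have R: "vec_sq_norm (reference_right_eigenvector N) = 1"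
    using False by simp
  have "vec_sq_norm (reference_left_eigenvector N (schur_matrix N (lam(1 := 0)) u v))
      = left_sq_norm N lam u v" if "\<forall>i\<in>{2..N}. lam i \<noteq> 0"
  proof (subst reference_left_eigenvector_eq)
    show "vec_sq_norm (vec (2 * N) (\<lambda>r.
        if even r then fst (left_block lam u v (r div 2)) else snd (left_block lam u v (r div 2))))
        = left_sq_norm N lam u v"
      unfolding vec_sq_norm_def left_sq_norm_def dim_vec sum_lessThan_double by (intro sum.cong) auto
  qed (use that False in auto)
  then show ?thesis using R by (simp add: diagonal_overlap_def)
qed

section \<open>Integrating out the upper triangular blocks\<close>

lemma measurable_left_block:
  assumes l: "\<And>i. i \<in> {2..N} \<Longrightarrow> (\<lambda>x. l x i) \<in> borel_measurable M"
    and U: "\<And>p. p \<in> upper_pairs N \<Longrightarrow> (\<lambda>x. U x p) \<in> borel_measurable M"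
    and V: "\<And>p. p \<in> upper_pairs N \<Longrightarrow> (\<lambda>x. V x p) \<in> borel_measurable M"
    and "k < N"
  shows "(\<lambda>x. fst (left_block (l x) (U x) (V x) k)) \<in> borel_measurable M"
    and "(\<lambda>x. snd (left_block (l x) (U x) (V x) k)) \<in> borel_measurable M"
proof -
  have "(\<lambda>x. fst (left_block (l x) (U x) (V x) k)) \<in> borel_measurable M \<and>
    (\<lambda>x. snd (left_block (l x) (U x) (V x) k)) \<in> borel_measurable M"
    using \<open>k < N\<close>
  proof (induction k rule: less_induct)
    case (less k)
    show ?case
    proof (cases "k = 0")
      case True
      then show ?thesis by (simp add: left_block.simps[of _ _ _ 0])
    next
      case False
      have [measurable]: "(\<lambda>x. l x (Suc k)) \<in> borel_measurable M"
        using less.prems False by (intro l) auto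
      have [measurable]: "(\<lambda>x. U x (Suc i, Suc k)) \<in> borel_measurable M"
          "(\<lambda>x. V x (Suc i, Suc k)) \<in> borel_measurable M"
        "(\<lambda>x. fst (left_block (l x) (U x) (V x) i)) \<in> borel_measurable M"
            "(\<lambda>x. snd (left_block (l x) (U x) (V x) i)) \<in> borel_measurable M"
        if "i < k" for i
        using less that by (auto intro!: U V simp: upper_pairs_def)
      show ?thesis
        using False by (subst (1 2) left_block.simps)
            (auto intro!: borel_measurable_divide borel_measurable_uminus borel_measurable_sum)
    qed
  qed
  then show "(\<lambda>x. fst (left_block (l x) (U x) (V x) k)) \<in> borel_measurable M"
    and "(\<lambda>x. snd (left_block (l x) (U x) (V x) k)) \<in> borel_measurable M" by auto
qed

lemma measurable_left_sq_norm:
  assumes "\<And>i. i \<in> {2..N} \<Longrightarrow> (\<lambda>x. l x i) \<in> borel_measurable M"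
    and "\<And>p. p \<in> upper_pairs N \<Longrightarrow> (\<lambda>x. U x p) \<in> borel_measurable M"
    and "\<And>p. p \<in> upper_pairs N \<Longrightarrow> (\<lambda>x. V x p) \<in> borel_measurable M"
  shows "(\<lambda>x. left_sq_norm N (l x) (U x) (V x)) \<in> borel_measurable M"
  unfolding left_sq_norm_def using measurable_left_block[OF assms]
  by (intro borel_measurable_sum borel_measurable_add borel_measurable_power borel_measurable_norm) auto

text \<open>
  The first \<open>N\<close> blocks see only the upper triangular entries with indices up to \<open>N\<close>, which is what
  makes the last column independent of them.
\<close>

lemma left_block_cong:
  assumes "\<And>p. p \<in> upper_pairs N \<Longrightarrow> u p = u' p" "\<And>p. p \<in> upper_pairs N \<Longrightarrow> v p = v' p" "k < N"
  shows "left_block lam u v k = left_block lam u' v' k"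
  using assms(3)
proof (induction k rule: less_induct)
  case (less k)
  have "u (Suc i, Suc k) = u' (Suc i, Suc k)" "v (Suc i, Suc k) = v' (Suc i, Suc k)" if "i < k" for i
    using that less.prems by (auto intro!: assms simp: upper_pairs_def)
  then show ?case
    using less by (subst (1 2) left_block.simps) (auto intro!: arg_cong2[where f = "(/)"] sum.cong)
qed

lemma left_sq_norm_ge_1: "0 < N \<Longrightarrow> 1 \<le> left_sq_norm N lam u v"
  unfolding left_sq_norm_def
  by (rule order_trans[OF _ member_le_sum[of 0]]) (auto simp: left_block.simps[of lam u v 0])

lemma finite_upper_pairs: "finite (upper_pairs N)"
  by (rule finite_subset[of _ "{1..N} \<times> {1..N}"]) (auto simp: upper_pairs_def)

text \<open>
  Splits the entries into the earlier ones (\<open>I\<close>) and those of the last column (\<open>J\<close>). The last block of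
  the eigenvector is linear in the column \<open>J\<close> with coefficients given by the earlier blocks, and the
  sum of their squared moduli is the squared norm accumulated so far.
\<close>

lemma left_sq_norm_Suc:
  fixes u v u' v' :: "nat \<times> nat \<Rightarrow> complex" and N :: nat and lam :: "nat \<Rightarrow> complex"
  defines "I \<equiv> upper_pairs N" and "J \<equiv> {1..N} \<times> {Suc N}"
  defines "a \<equiv> \<lambda>p. fst (left_block lam u v (fst p - 1))" and "b \<equiv> \<lambda>p. snd (left_block lam u v (fst p - 1))"
  assumes N: "0 < N"
  shows "left_sq_norm (Suc N) lam (merge I J (u, u')) (merge I J (v, v')) = left_sq_norm N lam u v +
     ((cmod (\<Sum>p\<in>J. a p * u' p - b p * cnj (v' p)))\<^sup>2 + (cmod (\<Sum>p\<in>J. a p * v' p + b p * cnj (u' p)))\<^sup>2)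
         / (cmod (lam (Suc N)))\<^sup>2"
    and "(\<Sum>p\<in>J. (cmod (a p))\<^sup>2 + (cmod (b p))\<^sup>2) = left_sq_norm N lam u v"
proof -
  let ?u = "merge I J (u, u')" and ?v = "merge I J (v, v')"
  have J: "(\<Sum>p\<in>J. g p) = (\<Sum>k<N. g (Suc k, Suc N))" for g :: "nat \<times> nat \<Rightarrow> 'b::comm_monoid_add"
    unfolding J_def by (rule sum.reindex_bij_witness[where i = "\<lambda>k. (Suc k, Suc N)" and j
        = "\<lambda>p. fst p - 1"]) auto
  show "(\<Sum>p\<in>J. (cmod (a p))\<^sup>2 + (cmod (b p))\<^sup>2) = left_sq_norm N lam u v"
    unfolding J left_sq_norm_def a_def b_def by simp
  have lb: "left_block lam ?u ?v k = left_block lam u v k" if "k < N" for k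
    using that by (intro left_block_cong) (auto simp: merge_def I_def)
  have JI: "?u (Suc i, Suc N) = u' (Suc i, Suc N)" "?v (Suc i, Suc N) = v' (Suc i, Suc N)" if "i < N" for i
    using that by (auto simp: merge_def I_def J_def upper_pairs_def)
  have "left_block lam ?u ?v N = (- (\<Sum>p\<in>J. a p * u' p - b p * cnj (v' p))
      / lam (Suc N), - (\<Sum>p\<in>J. a p * v' p + b p * cnj (u' p)) / cnj (lam (Suc N)))"
    unfolding J using N JI lb by (subst left_block.simps)
        (auto simp: a_def b_def intro!: arg_cong2[where f = "(/)"] sum.cong)
  then show "left_sq_norm (Suc N) lam ?u ?v = left_sq_norm N lam u v +
     ((cmod (\<Sum>p\<in>J. a p * u' p - b p * cnj (v' p)))\<^sup>2 + (cmod (\<Sum>p\<in>J. a p * v' p + b p * cnj (u' p)))\<^sup>2)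
         / (cmod (lam (Suc N)))\<^sup>2"
    using lb by (simp add: left_sq_norm_def norm_divide power_divide add_divide_distrib)
qed

text \<open>
  The columns are integrated out from the last one. Given the others, the last column multiplies the
  squared norm by \<open>1 + X / \<bar>\<lambda>\<bar>\<^sup>2\<close> with \<open>X\<close> independent of them, so the expectation of the \<open>m\<close>-th negative
  power gains the factor \<open>overlap_factor m (\<bar>\<lambda>\<bar>\<^sup>2)\<close>.
\<close>

lemma nn_integral_left_sq_norm:
  assumes "\<And>i. i \<in> {2..Suc n} \<Longrightarrow> lam i \<noteq> 0"
  shows "(\<integral>\<^sup>+ u. \<integral>\<^sup>+ v. ennreal (inverse (left_sq_norm (Suc n) lam u v) ^ m) \<partial>upper_gaussian_law (Suc n)
      \<partial>upper_gaussian_law (Suc n)) =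
    ennreal (\<Prod>i\<in>{2..Suc n}. overlap_factor m ((cmod (lam i))\<^sup>2))"
  using assms
proof (induction n)
  case 0
  have "left_sq_norm (Suc 0) lam u v = 1" for u v
    by (simp add: left_sq_norm_def left_block.simps[of lam u v 0])
  moreover have "emeasure (upper_gaussian_law (Suc 0)) (space (upper_gaussian_law (Suc 0))) = 1"
    unfolding upper_gaussian_law_def by (intro prob_space.emeasure_space_1 prob_space_gaussian_family)
  ultimately show ?case by simp
next
  case (Suc n)
  define N where "N = Suc n"
  define I where "I = upper_pairs N"
  define J where "J = {1..N} \<times> {Suc N}"
  have IJ: "upper_pairs (Suc N) = I \<union> J" "I \<inter> J = {}" "finite I" "finite J"
    using finite_upper_pairs[of N] by (auto simp: I_def J_def upper_pairs_def)
  have N: "0 < N" by (simp add: N_def)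
  let ?PI = "PiM I (\<lambda>_. \<nu>)" and ?PJ = "PiM J (\<lambda>_. \<nu>)" and ?P = "PiM (I \<union> J) (\<lambda>_. \<nu>)"
  interpret PI: prob_space ?PI by (rule prob_space_gaussian_family)
  interpret PJ: prob_space ?PJ by (rule prob_space_gaussian_family)
  interpret P: prob_space ?P by (rule prob_space_gaussian_family)
  interpret PP: pair_sigma_finite ?PJ ?PI ..
  define t where "t = (cmod (lam (Suc N)))\<^sup>2"
  have t: "0 < t" using Suc.prems[of "Suc N"] by (simp add: t_def N_def)
  let ?f = "\<lambda>u v. ennreal (inverse (left_sq_norm (Suc N) lam u v) ^ m)"
  have fm: "(\<lambda>x. ?f (U x) (V x)) \<in> borel_measurable M" if "\<And>p. p \<in> I \<union> J
      \<Longrightarrow> (\<lambda>x. U x p) \<in> borel_measurable M"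
      "\<And>p. p \<in> I \<union> J \<Longrightarrow> (\<lambda>x. V x p) \<in> borel_measurable M" for U V and M :: "'b measure"
  proof -
    have "(\<lambda>x. left_sq_norm (Suc N) lam (U x) (V x)) \<in> borel_measurable M"
      using that by (intro measurable_left_sq_norm) (auto simp: IJ)
    then show ?thesis by measurable
  qed
  have comp: "(\<lambda>x. g x p) \<in> borel_measurable M" if "p \<in> K"
      "g \<in> measurable M (PiM K (\<lambda>_. \<nu>))" for p :: "nat \<times> nat" and K g and M :: "'b measure"
    using measurable_compose[OF that(2) measurable_component_singleton[OF that(1)]]
        by (simp add: measurable_def)
  have column: "(\<integral>\<^sup>+ u'. \<integral>\<^sup>+ v'. ?f (merge I J (u, u')) (merge I J (v, v')) \<partial>?PJ \<partial>?PJ) =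
      ennreal (inverse (left_sq_norm N lam u v) ^ m) * ennreal (overlap_factor m t)" for u v
  proof -
    define S where "S = left_sq_norm N lam u v"
    have S: "0 < S" using left_sq_norm_ge_1[OF N, of lam u v] by (simp add: S_def)
    let ?a = "\<lambda>p. fst (left_block lam u v (fst p - 1))" and ?b = "\<lambda>p. snd (left_block lam u v (fst p - 1))"
    let ?F = "\<lambda>(x, y). ennreal (inverse (S + ((cmod x)\<^sup>2 + (cmod y)\<^sup>2) / t) ^ m)"
    have "(\<integral>\<^sup>+ u'. \<integral>\<^sup>+ v'. ?f (merge I J (u, u')) (merge I J (v, v')) \<partial>?PJ \<partial>?PJ) =
       (\<integral>\<^sup>+ u'. \<integral>\<^sup>+ v'. ?F (\<Sum>p\<in>J. ?a p * u' p - ?b p * cnj (v' p), \<Sum>p\<in>J. ?a p * v' p + ?b p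
           * cnj (u' p)) \<partial>?PJ \<partial>?PJ)"
      unfolding I_def J_def left_sq_norm_Suc(1)[OF N] prod.case S_def t_def ..
    also have "\<dots> = (\<integral>\<^sup>+ u. \<integral>\<^sup>+ v. ?F (sqrt S * u, sqrt S * v) \<partial>\<nu> \<partial>\<nu>)"
      by (subst nn_integral_gaussian_quaternion_sum)
          (use IJ left_sq_norm_Suc(2)[OF N, of lam u v] in \<open>simp_all add: J_def S_def\<close>)
    also have "\<dots> = (\<integral>\<^sup>+ u. \<integral>\<^sup>+ v. ennreal (inverse S ^ m)
        * ennreal ((t / (t + ((cmod u)\<^sup>2 + (cmod v)\<^sup>2))) ^ m) \<partial>\<nu> \<partial>\<nu>)"
    proof (intro nn_integral_cong)
      fix u v :: complex
      have "(cmod (sqrt S * z))\<^sup>2 = S * (cmod z)\<^sup>2" for z :: complex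
        using S by (simp add: norm_mult power_mult_distrib)
      then have "S + ((cmod (sqrt S * u))\<^sup>2 + (cmod (sqrt S * v))\<^sup>2) / t
          = S * ((t + ((cmod u)\<^sup>2 + (cmod v)\<^sup>2)) / t)"
        using t by (simp add: field_simps)
      then have "inverse (S + ((cmod (sqrt S * u))\<^sup>2 + (cmod (sqrt S * v))\<^sup>2) / t) ^ m
          = inverse S ^ m * (t / (t + ((cmod u)\<^sup>2 + (cmod v)\<^sup>2))) ^ m"
        by (simp only: inverse_mult_distrib inverse_divide power_mult_distrib)
      then show "?F (sqrt S * u, sqrt S * v)
          = ennreal (inverse S ^ m) * ennreal ((t / (t + ((cmod u)\<^sup>2 + (cmod v)\<^sup>2))) ^ m)"
        using S by (simp only: prod.case) (simp add: ennreal_mult')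
    qed
    also have "\<dots> = ennreal (inverse S ^ m) * ennreal (overlap_factor m t)"
      using t by (simp add: nn_integral_cmult ennreal_overlap_factor)
    finally show ?thesis by (simp only: S_def)
  qed
  have "(\<integral>\<^sup>+ u. \<integral>\<^sup>+ v. ?f u v \<partial>?P \<partial>?P) = (\<integral>\<^sup>+ u. \<integral>\<^sup>+ u'. \<integral>\<^sup>+ v. ?f (merge I J (u, u')) v \<partial>?P \<partial>?PJ \<partial>?PI)"
  proof (rule gaussians.product_nn_integral_fold[OF IJ(2-4)])
    have "(\<lambda>(u, v). ?f u v) \<in> borel_measurable (?P \<Otimes>\<^sub>M ?P)"
      unfolding case_prod_unfold by (intro fm comp; (assumption | measurable))
    then show "(\<lambda>u. \<integral>\<^sup>+ v. ?f u v \<partial>?P) \<in> borel_measurable ?P"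
      by (rule P.borel_measurable_nn_integral)
  qed
  also have "\<dots> = (\<integral>\<^sup>+ u. \<integral>\<^sup>+ u'. \<integral>\<^sup>+ v. \<integral>\<^sup>+ v'. ?f (merge I J (u, u')) (merge I J (v, v')) \<partial>?PJ \<partial>?PI
      \<partial>?PJ \<partial>?PI)"
  proof -
    have "(\<integral>\<^sup>+ v. ?f w v \<partial>?P) = (\<integral>\<^sup>+ v. \<integral>\<^sup>+ v'. ?f w (merge I J (v, v')) \<partial>?PJ \<partial>?PI)" for w
      by (rule gaussians.product_nn_integral_fold[OF IJ(2-4)], rule fm) (simp, measurable)
    then show ?thesis by simp
  qed
  also have "\<dots> = (\<integral>\<^sup>+ u. \<integral>\<^sup>+ v. \<integral>\<^sup>+ u'. \<integral>\<^sup>+ v'. ?f (merge I J (u, u')) (merge I J (v, v')) \<partial>?PJ \<partial>?PJ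
      \<partial>?PI \<partial>?PI)"
  proof (intro nn_integral_cong PP.Fubini'[symmetric])
    fix u assume u: "u \<in> space ?PI"
    have "(\<lambda>((u', v), v'). ?f (merge I J (u, u')) (merge I J (v, v')))
        \<in> borel_measurable ((?PJ \<Otimes>\<^sub>M ?PI) \<Otimes>\<^sub>M ?PJ)"
      unfolding case_prod_unfold using u by (intro fm comp; (assumption | measurable))
    then show "(\<lambda>(u', v). \<integral>\<^sup>+ v'. ?f (merge I J (u, u')) (merge I J (v, v')) \<partial>?PJ)
        \<in> borel_measurable (?PJ \<Otimes>\<^sub>M ?PI)"
      unfolding case_prod_unfold by
          (rule PJ.borel_measurable_nn_integral[where f
          = "\<lambda>p v'. ?f (merge I J (u, fst p)) (merge I J (snd p, v'))", unfolded case_prod_unfold])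
  qed
  also have "\<dots> = (\<integral>\<^sup>+ u. \<integral>\<^sup>+ v. ennreal (overlap_factor m t)
      * ennreal (inverse (left_sq_norm N lam u v) ^ m) \<partial>?PI \<partial>?PI)"
    unfolding column by (simp only: mult.commute)
  also have "\<dots> = ennreal (overlap_factor m t)
      * (\<integral>\<^sup>+ u. \<integral>\<^sup>+ v. ennreal (inverse (left_sq_norm N lam u v) ^ m) \<partial>?PI \<partial>?PI)"
  proof -
    have [measurable]: "(\<lambda>x. left_sq_norm N lam (U x) (V x)) \<in> borel_measurable M"
        if "U \<in> measurable M ?PI" "V \<in> measurable M ?PI" for U V and M :: "'b measure"
      using that by (intro measurable_left_sq_norm) (auto simp: I_def intro: comp)
    have "(\<integral>\<^sup>+ v. ennreal (overlap_factor m t) * ennreal (inverse (left_sq_norm N lam u v) ^ m) \<partial>?PI)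
        = ennreal (overlap_factor m t) * (\<integral>\<^sup>+ v. ennreal (inverse (left_sq_norm N lam u v) ^ m) \<partial>?PI)"
        if "u \<in> space ?PI" for u
      using that by (intro nn_integral_cmult) measurable
    then have "(\<integral>\<^sup>+ u. \<integral>\<^sup>+ v. ennreal (overlap_factor m t)
        * ennreal (inverse (left_sq_norm N lam u v) ^ m) \<partial>?PI \<partial>?PI) =
      (\<integral>\<^sup>+ u. ennreal (overlap_factor m t)
          * (\<integral>\<^sup>+ v. ennreal (inverse (left_sq_norm N lam u v) ^ m) \<partial>?PI) \<partial>?PI)"
      by (intro nn_integral_cong) auto
    also have "\<dots> = ennreal (overlap_factor m t)
        * (\<integral>\<^sup>+ u. \<integral>\<^sup>+ v. ennreal (inverse (left_sq_norm N lam u v) ^ m) \<partial>?PI \<partial>?PI)"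
      by (intro nn_integral_cmult) measurable
    finally show ?thesis .
  qed
  also have "(\<integral>\<^sup>+ u. \<integral>\<^sup>+ v. ennreal (inverse (left_sq_norm N lam u v) ^ m) \<partial>?PI \<partial>?PI)
      = ennreal (\<Prod>i\<in>{2..N}. overlap_factor m ((cmod (lam i))\<^sup>2))"
    using Suc.IH Suc.prems by (simp add: N_def I_def upper_gaussian_law_def)
  also have "ennreal (overlap_factor m t) * \<dots>
      = ennreal (\<Prod>i\<in>{2..Suc N}. overlap_factor m ((cmod (lam i))\<^sup>2))"
  proof -
    have "{2..Suc N} = insert (Suc N) {2..N}" using N by auto
    then show ?thesis
      using overlap_factor_bounds(1)[of t m] t by (simp add: t_def ennreal_mult')
  qed
  finally show ?case by (simp add: upper_gaussian_law_def IJ(1) N_def[symmetric])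
qed

section \<open>Moments on the unit interval and the beta limit\<close>

text \<open>
  The Hausdorff moment problem on \<open>[0, 1]\<close> is determinate: equal moments give equal integrals of all
  Bernstein polynomials, and these approximate continuous functions uniformly.
\<close>

lemma integral_eq_of_moments_eq:
  fixes f :: "real \<Rightarrow> real"
  assumes P: "real_distribution P" "AE x in P. x \<in> {0..1}" and Q: "real_distribution Q"
      "AE x in Q. x \<in> {0..1}"
    and moments: "\<And>m. (\<integral>x. x ^ m \<partial>P) = (\<integral>x. x ^ m \<partial>Q)"
    and f: "continuous_on {0..1} f" "f \<in> borel_measurable borel"
  shows "(\<integral>x. f x \<partial>P) = (\<integral>x. f x \<partial>Q)"
proof -
  interpret P: real_distribution P by fact
  interpret Q: real_distribution Q by fact
  note [measurable] = f(2)
  have intPQ: "integrable R h" if R: "real_distribution R"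
      "AE x in R. x \<in> {0..1}" and [measurable]: "h
      \<in> borel_measurable borel" and h: "continuous_on {0..1} h" for R and h :: "real \<Rightarrow> real"
  proof -
    interpret R: real_distribution R by fact
    have "bounded (h ` {0..1})" using h compact_continuous_image compact_imp_bounded by blast
    then obtain B where B: "\<forall>x\<in>{0..1}. \<bar>h x\<bar> \<le> B" by (auto simp: bounded_iff)
    show ?thesis
    proof (rule R.integrable_const_bound)
      show "AE x in R. norm (h x) \<le> B" using R(2) by eventually_elim (use B in auto)
    qed measurable
  qed
  (* moments of x^i (1 - x)^j by expanding one factor 1 - x at a time *)
  have mixed: "(\<integral>x. x ^ i * (1 - x) ^ j \<partial>P) = (\<integral>x. x ^ i * (1 - x) ^ j \<partial>Q)" for i j
  proof (induction j arbitrary: i)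
    case 0
    then show ?case using moments by simp
  next
    case (Suc j)
    have "(\<integral>x. x ^ i * (1 - x) ^ Suc j \<partial>R)
        = (\<integral>x. x ^ i * (1 - x) ^ j \<partial>R) - (\<integral>x. x ^ Suc i * (1 - x) ^ j \<partial>R)" if R: "real_distribution R"
        "AE x in R. x \<in> {0..1}" for R
    proof -
      have "(\<integral>x. x ^ i * (1 - x) ^ Suc j \<partial>R) = (\<integral>x. x ^ i * (1 - x) ^ j - x ^ Suc i * (1 - x) ^ j \<partial>R)"
        by (intro Bochner_Integration.integral_cong) (auto simp: algebra_simps)
      also have "\<dots> = (\<integral>x. x ^ i * (1 - x) ^ j \<partial>R) - (\<integral>x. x ^ Suc i * (1 - x) ^ j \<partial>R)"
        by (intro Bochner_Integration.integral_diff intPQ[OF R]) (auto intro!: continuous_intros)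
      finally show ?thesis .
    qed
    from this[OF P] this[OF Q] show ?case by (simp only: Suc.IH)
  qed
  have "\<bar>(\<integral>x. f x \<partial>P) - (\<integral>x. f x \<partial>Q)\<bar> \<le> 0 + e" if e: "0 < e" for e
  proof -
    obtain n where "\<forall>N x. n \<le> N \<and> x \<in> {0..1} \<longrightarrow> \<bar>f x - (\<Sum>k\<le>N. f (k / N) * Bernstein N k x)\<bar> < e / 2"
      using Bernstein_Weierstrass[OF f(1), of "e / 2"] e by auto
    then have n: "\<bar>f x - (\<Sum>k\<le>n. f (k / n) * Bernstein n k x)\<bar> < e / 2" if "x \<in> {0..1}" for x
      using that by blast
    define p where "p x = (\<Sum>k\<le>n. f (k / n) * Bernstein n k x)" for x
    have [measurable]: "p \<in> borel_measurable borel"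
      unfolding p_def Bernstein_def by measurable
    have pc: "continuous_on {0..1} p"
      unfolding p_def Bernstein_def by (intro continuous_intros)
    have near: "\<bar>(\<integral>x. f x \<partial>R) - (\<integral>x. p x \<partial>R)\<bar> \<le> e / 2" if R: "real_distribution R"
        "AE x in R. x \<in> {0..1}" for R
    proof -
      interpret R: real_distribution R by fact
      have "(\<integral>x. f x \<partial>R) - (\<integral>x. p x \<partial>R) = (\<integral>x. f x - p x \<partial>R)"
        by (intro Bochner_Integration.integral_diff[symmetric] intPQ[OF R] f pc) auto
      also have "\<bar>\<dots>\<bar> \<le> (\<integral>x. \<bar>f x - p x\<bar> \<partial>R)"
        using integral_norm_bound[of R "\<lambda>x. f x - p x"] by simp
      also have "\<dots> \<le> (\<integral>x. e / 2 \<partial>R)"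
      proof (rule integral_mono_AE)
        show "AE x in R. \<bar>f x - p x\<bar> \<le> e / 2"
          using R(2) by eventually_elim (use n in \<open>force simp: p_def\<close>)
        show "integrable R (\<lambda>x. \<bar>f x - p x\<bar>)"
          by (intro integrable_abs Bochner_Integration.integrable_diff intPQ[OF R] f pc) auto
      qed simp
      finally show ?thesis by (simp add: R.prob_space[simplified])
    qed
    have "(\<integral>x. p x \<partial>P) = (\<integral>x. p x \<partial>Q)"
    proof -
      have "(\<integral>x. p x \<partial>R) = (\<Sum>k\<le>n. f (k / n) * (real (n choose k) * (\<integral>x. x ^ k * (1 - x) ^ (n - k) \<partial>R)))"
          if R: "real_distribution R" "AE x in R. x \<in> {0..1}" for R
        unfolding p_def Bernstein_def mult.assoc
        by (subst Bochner_Integration.integral_sum) (auto intro!: intPQ[OF R] continuous_intros)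
      from this[OF P] this[OF Q] show ?thesis by (simp only: mixed)
    qed
    then show ?thesis using near[OF P] near[OF Q] by linarith
  qed
  then show ?thesis by (metis abs_le_zero_iff eq_iff_diff_eq_0 field_le_epsilon)
qed

lemma nn_integral_beta_factorial:
  assumes "0 < a" "0 < b"
  shows "(\<integral>\<^sup>+ y. ennreal (indicator {0..1} y * (y ^ a * (1 - y) ^ b)) \<partial>lborel)
      = ennreal (fact a * fact b / fact (a + b + 1))"
proof -
  have "((\<lambda>t. t powr (real (a + 1) - 1) * (1 - t) powr (real (b + 1) - 1)) has_integral Beta
      (real (a + 1)) (real (b + 1))) {0..1}"
    by (rule has_integral_Beta_real) auto
  also have "?this \<longleftrightarrow> ((\<lambda>t. t ^ a * (1 - t) ^ b) has_integral Beta (real (a + 1)) (real (b + 1))) {0..1}"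
  proof (rule has_integral_cong)
    fix t :: real assume "t \<in> {0..1}"
    then show "t powr (real (a + 1) - 1) * (1 - t) powr (real (b + 1) - 1) = t ^ a * (1 - t) ^ b"
      using assms by (cases "t = 0"; cases "t = 1") (auto simp: powr_realpow)
  qed
  finally have "integral\<^sup>N lborel (\<lambda>y. indicator {0..1} y * ennreal (y ^ a * (1 - y) ^ b))
      = ennreal (Beta (real (a + 1)) (real (b + 1)))"
    by (intro nn_integral_has_integral_lebesgue[where f
        = "\<lambda>t. t ^ a * (1 - t) ^ b", THEN trans[rotated]])
        (auto intro!: nn_integral_cong split: split_indicator)
  also have "Beta (real (a + 1)) (real (b + 1)) = fact a * fact b / fact (a + b + 1)"
    using Gamma_fact[of a, where 'a = real] Gamma_fact[of b, where 'a = real]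
        Gamma_fact[of "a + b + 1", where 'a = real]
    by (simp add: Beta_def add_ac)
  finally show ?thesis
    by (simp add: ennreal_mult' ennreal_indicator)
qed

text \<open>
  The density of the beta distribution of parameters \<open>4\<close> and \<open>2n + 2\<close>, the law of the inverse overlap
  for \<open>N = n + 2\<close>.
\<close>

definition beta_density :: "nat \<Rightarrow> real \<Rightarrow> real" where
  "beta_density n y = fact (2 * n + 5) / (6 * fact (2 * n + 1))
      * (indicator {0..1} y * (y ^ 3 * (1 - y) ^ (2 * n + 1)))"

lemma beta_density_nonneg: "0 \<le> beta_density n y"
  by (auto simp: beta_density_def split: split_indicator)

lemma measurable_beta_density[measurable]: "beta_density n \<in> borel_measurable borel"
  unfolding beta_density_def by measurable

lemma nn_integral_beta_density_power:
  "(\<integral>\<^sup>+ y. ennreal (beta_density n y) * ennreal (y ^ m) \<partial>lborel)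
      = ennreal (fact (m + 3) * fact (2 * n + 5) / (6 * fact (2 * n + 5 + m)))"
proof -
  have "(\<integral>\<^sup>+ y. ennreal (beta_density n y) * ennreal (y ^ m) \<partial>lborel) =
    (\<integral>\<^sup>+ y. ennreal (fact (2 * n + 5) / (6 * fact (2 * n + 1)))
        * ennreal (indicator {0..1} y * (y ^ (m + 3) * (1 - y) ^ (2 * n + 1))) \<partial>lborel)"
  proof (intro nn_integral_cong)
    fix y :: real
    show "ennreal (beta_density n y) * ennreal (y ^ m)
        = ennreal (fact (2 * n + 5) / (6 * fact (2 * n + 1)))
        * ennreal (indicator {0..1} y * (y ^ (m + 3) * (1 - y) ^ (2 * n + 1)))"
    proof (cases "y \<in> {0..1}")
      case True
      then have "ennreal (beta_density n y) * ennreal (y ^ m) = ennreal (beta_density n y * y ^ m)"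
        by (intro ennreal_mult'[symmetric] beta_density_nonneg)
      also have "beta_density n y * y ^ m
          = fact (2 * n + 5) / (6 * fact (2 * n + 1))
          * (indicator {0..1} y * (y ^ (m + 3) * (1 - y) ^ (2 * n + 1)))"
        by (simp add: beta_density_def power_add mult_ac)
      also have "ennreal \<dots> = ennreal (fact (2 * n + 5) / (6 * fact (2 * n + 1)))
          * ennreal (indicator {0..1} y * (y ^ (m + 3) * (1 - y) ^ (2 * n + 1)))"
        by (intro ennreal_mult') simp
      finally show ?thesis .
    qed (simp add: beta_density_def)
  qed
  also have "\<dots> = ennreal (fact (2 * n + 5) / (6 * fact (2 * n + 1)))
      * ennreal (fact (m + 3) * fact (2 * n + 1) / fact (m + 3 + (2 * n + 1) + 1))"
    by (subst nn_integral_cmult, measurable, subst nn_integral_beta_factorial) auto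
  also have "\<dots> = ennreal (fact (2 * n + 5) / (6 * fact (2 * n + 1))
      * (fact (m + 3) * fact (2 * n + 1) / fact (m + 3 + (2 * n + 1) + 1)))"
    by (intro ennreal_mult'[symmetric]) simp
  also have "fact (2 * n + 5) / (6 * fact (2 * n + 1))
      * (fact (m + 3) * fact (2 * n + 1) / fact (m + 3 + (2 * n + 1) + 1))
      = (fact (m + 3) * fact (2 * n + 5) / (6 * fact (2 * n + 5 + m)) :: real)"
    by (simp add: add_ac)
  finally show ?thesis .
qed

lemma real_distribution_beta: "real_distribution (density lborel (\<lambda>y. ennreal (beta_density n y)))"
proof -
  have "emeasure (density lborel (\<lambda>y. ennreal (beta_density n y))) UNIV = 1"
    using nn_integral_beta_density_power[of n 0] by (simp add: emeasure_density fact_numeral)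
  then have "prob_space (density lborel (\<lambda>y. ennreal (beta_density n y)))"
    by (intro prob_spaceI) simp
  then show ?thesis
    by (simp add: real_distribution_def real_distribution_axioms_def)
qed

lemma beta_density_rescaled:
  assumes "0 \<le> t" "t \<le> 2 * real n + 4"
  shows "beta_density n (t / (2 * real n + 4)) / (2 * real n + 4) =
    (2 * real n + 5) * (2 * real n + 3) * (2 * real n + 2) / (2 * real n + 4) ^ 3
        * (1 - t / (2 * real n + 4)) ^ (2 * n + 1) * (t ^ 3 / 6)"
proof -
  define c where "c = 2 * real n + 4"
  have c: "0 < c" by (simp add: c_def)
  have "fact (2 * n + 5) = (2 * real n + 5) * c * (2 * real n + 3) * (2 * real n + 2) * fact (2 * n + 1)"
    by (simp add: c_def eval_nat_numeral algebra_simps)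
  then have K: "fact (2 * n + 5) / (6 * fact (2 * n + 1))
      = (2 * real n + 5) * c * (2 * real n + 3) * (2 * real n + 2) / (6 :: real)"
    by simp
  have "t / c \<in> {0..1}" using assms c by (simp add: c_def)
  then have "beta_density n (t / c) / c
      = (2 * real n + 5) * c * (2 * real n + 3) * (2 * real n + 2) / 6
      * ((t / c) ^ 3 * (1 - t / c) ^ (2 * n + 1)) / c"
    unfolding beta_density_def K by simp
  also have "\<dots> = (2 * real n + 5) * (2 * real n + 3) * (2 * real n + 2) / c ^ 3
      * (1 - t / c) ^ (2 * n + 1) * (t ^ 3 / 6)"
  proof -
    have "A * c * b * d / 6 * ((t / c) ^ 3 * B) / c = A * b * d / c ^ 3 * B * (t ^ 3 / 6)" for A b d B
      using c by (simp add: power_divide mult_ac)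
    then show ?thesis .
  qed
  finally show ?thesis by (simp add: c_def)
qed

lemma beta_density_rescaled_tendsto:
  "(\<lambda>n. beta_density n (t / (2 * real n + 4)) / (2 * real n + 4)) \<longlonglongrightarrow> erlang_density 3 1 t"
proof (cases "0 \<le> t")
  case True
  have "(\<lambda>n. (2 * real n + 5) * (2 * real n + 3) * (2 * real n + 2) / (2 * real n + 4) ^ 3) \<longlonglongrightarrow> 1"
    by real_asymp
  moreover have "(\<lambda>n. (1 - t / (2 * real n + 4)) ^ (2 * n + 1)) \<longlonglongrightarrow> exp (- t)"
    by real_asymp
  ultimately have "(\<lambda>n. (2 * real n + 5) * (2 * real n + 3) * (2 * real n + 2) / (2 * real n + 4) ^ 3
      * (1 - t / (2 * real n + 4)) ^ (2 * n + 1) * (t ^ 3 / 6)) \<longlonglongrightarrow> 1 * exp (- t) * (t ^ 3 / 6)"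
    by (intro tendsto_intros)
  also have "1 * exp (- t) * (t ^ 3 / 6) = erlang_density 3 1 t"
    using True by (simp add: erlang_density_def fact_numeral)
  finally show ?thesis
  proof (rule Lim_transform_eventually)
    have "eventually (\<lambda>n. t \<le> 2 * real n + 4) sequentially"
      by real_asymp
    then show "\<forall>\<^sub>F n in sequentially. (2 * real n + 5) * (2 * real n + 3) * (2 * real n + 2)
        / (2 * real n + 4) ^ 3 * (1 - t / (2 * real n + 4)) ^ (2 * n + 1) * (t ^ 3 / 6)
        = beta_density n (t / (2 * real n + 4)) / (2 * real n + 4)"
      by eventually_elim (use True in \<open>simp add: beta_density_rescaled\<close>)
  qed
next
  case False
  then have "beta_density n (t / (2 * real n + 4)) = 0" for n
    by (auto simp: beta_density_def field_simps split: split_indicator)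
  then show ?thesis
    using False by (simp add: erlang_density_def)
qed

text \<open>
  An integrable bound uniform in \<open>n\<close>: the power of \<open>1 - t / c\<close> is at most an exponential whose rate
  \<open>(2n + 1) / (2n + 4)\<close> never falls below \<open>1 / 4\<close>.
\<close>

lemma beta_density_rescaled_le:
  "beta_density n (t / (2 * real n + 4)) / (2 * real n + 4) \<le> 512 * erlang_density 3 (1 / 4) t"
proof (cases "0 \<le> t \<and> t \<le> 2 * real n + 4")
  case True
  define c where "c = 2 * real n + 4"
  have c: "0 < c" by (simp add: c_def)
  have tc: "0 \<le> t" "t \<le> c" using True by (auto simp: c_def)
  have "(1 - t / c) ^ (2 * n + 1) \<le> exp (- (t / c)) ^ (2 * n + 1)"
    using exp_ge_add_one_self[of "- (t / c)"] tc c by (intro power_mono) auto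
  also have "\<dots> = exp (real (2 * n + 1) * - (t / c))"
    by (rule exp_of_nat_mult[symmetric])
  also have "\<dots> = exp (- (t * ((2 * real n + 1) / c)))"
    by (simp add: algebra_simps add_divide_distrib)
  also have "\<dots> \<le> exp (- (t / 4))"
  proof -
    have "1 / 4 \<le> (2 * real n + 1) / c" using c by (simp add: c_def field_simps)
    then have "t * (1 / 4) \<le> t * ((2 * real n + 1) / c)" using tc by (intro mult_left_mono)
    then show ?thesis by simp
  qed
  finally have e: "(1 - t / c) ^ (2 * n + 1) \<le> exp (- (t / 4))" .
  have "(2 * real n + 5) * (2 * real n + 3) = c * c - 1"
    by (simp add: c_def algebra_simps)
  then have "(2 * real n + 5) * (2 * real n + 3) \<le> c * c" by linarith
  moreover have "2 * real n + 2 \<le> c" by (simp add: c_def)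
  ultimately have "(2 * real n + 5) * (2 * real n + 3) * (2 * real n + 2) \<le> (c * c) * c"
    using c by (intro mult_mono[where b = "c * c"]) auto
  also have "\<dots> \<le> 2 * c ^ 3"
    using c by (simp add: power3_eq_cube)
  finally have k: "(2 * real n + 5) * (2 * real n + 3) * (2 * real n + 2) / c ^ 3 \<le> 2"
    using c by (subst divide_le_eq) simp
  have "beta_density n (t / c) / c = (2 * real n + 5) * (2 * real n + 3) * (2 * real n + 2) / c ^ 3
      * (1 - t / c) ^ (2 * n + 1) * (t ^ 3 / 6)"
    using True unfolding c_def by (intro beta_density_rescaled) auto
  also have "\<dots> \<le> 2 * exp (- (t / 4)) * (t ^ 3 / 6)"
    using tc c by (intro mult_mono k e) auto
  also have "\<dots> = 512 * erlang_density 3 (1 / 4) t"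
    using tc by (simp add: erlang_density_def fact_numeral power_divide)
  finally show ?thesis by (simp add: c_def)
next
  case False
  then have "beta_density n (t / (2 * real n + 4)) = 0"
    by (auto simp: beta_density_def field_simps split: split_indicator)
  then show ?thesis by simp
qed

lemma integral_rescaled_beta_tendsto:
  fixes h :: "real \<Rightarrow> real"
  assumes [measurable]: "h \<in> borel_measurable borel" and h: "\<And>x. \<bar>h x\<bar> \<le> 1"
  shows "(\<lambda>n. \<integral>y. h ((2 * real n + 4) * y) \<partial>density lborel (\<lambda>y. ennreal (beta_density n y))) \<longlonglongrightarrow>
      (\<integral>t. erlang_density 3 1 t * h t \<partial>lborel)"
proof -
  have "(\<integral>y. h ((2 * real n + 4) * y) \<partial>density lborel (\<lambda>y. ennreal (beta_density n y)))
      = (\<integral>t. beta_density n (t / (2 * real n + 4)) / (2 * real n + 4) * h t \<partial>lborel)" for n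
  proof -
    let ?c = "2 * real n + 4"
    have "(\<integral>y. h (?c * y) \<partial>density lborel (\<lambda>y. ennreal (beta_density n y)))
        = (\<integral>y. beta_density n y * h (?c * y) \<partial>lborel)"
      by (subst integral_density) (auto simp: beta_density_nonneg)
    also have "\<dots> = \<bar>1 / ?c\<bar> *\<^sub>R (\<integral>t. beta_density n (0 + 1 / ?c * t) * h (?c * (0 + 1 / ?c * t)) \<partial>lborel)"
      by (rule lborel_integral_real_affine) simp
    also have "\<dots> = (\<integral>t. 1 / ?c * (beta_density n (t / ?c) * h t) \<partial>lborel)"
      by simp
    also have "\<dots> = (\<integral>t. beta_density n (t / ?c) / ?c * h t \<partial>lborel)"
      by (intro Bochner_Integration.integral_cong) auto
    finally show ?thesis .
  qed
  moreover have "(\<lambda>n. \<integral>t. beta_density n (t / (2 * real n + 4)) / (2 * real n + 4) * h t \<partial>lborel) \<longlonglongrightarrow>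
      (\<integral>t. erlang_density 3 1 t * h t \<partial>lborel)"
  proof (rule integral_dominated_convergence[where w = "\<lambda>t. 512 * erlang_density 3 (1 / 4) t"])
    have "(\<integral>\<^sup>+ x. ennreal (erlang_density 3 (1 / 4) x) \<partial>lborel) = 1"
      using nn_integral_erlang_ith_moment[of "1 / 4" 3 0] by simp
    then have "integrable lborel (erlang_density 3 (1 / 4))"
      by (intro integrableI_nonneg) auto
    then show "integrable lborel (\<lambda>t. 512 * erlang_density 3 (1 / 4) t)" by simp
    show "AE t in lborel. (\<lambda>n. beta_density n (t / (2 * real n + 4)) / (2 * real n + 4) * h t) \<longlonglongrightarrow>
        erlang_density 3 1 t * h t"
      by (intro AE_I2 tendsto_intros beta_density_rescaled_tendsto)
    show "AE t in lborel. norm (beta_density n (t / (2 * real n + 4)) / (2 * real n + 4) * h t)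
        \<le> 512 * erlang_density 3 (1 / 4) t" for n
    proof (intro AE_I2)
      fix t
      have nn: "0 \<le> beta_density n (t / (2 * real n + 4)) / (2 * real n + 4)"
        using beta_density_nonneg by simp
      have "norm (beta_density n (t / (2 * real n + 4)) / (2 * real n + 4) * h t)
          \<le> beta_density n (t / (2 * real n + 4)) / (2 * real n + 4) * 1"
        using nn h[of t] unfolding real_norm_def abs_mult by (intro mult_mono) auto
      then show "norm (beta_density n (t / (2 * real n + 4)) / (2 * real n + 4) * h t)
          \<le> 512 * erlang_density 3 (1 / 4) t"
        using beta_density_rescaled_le[of n t] by linarith
    qed
  qed measurable
  ultimately show ?thesis by simp
qed

lemma gamma_density_4: "gamma_density 4 t = erlang_density 3 1 t"
proof (cases "0 < t")
  case True
  then have "t powr 3 = t ^ 3" using powr_realpow[of t 3] by simp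
  then show ?thesis using True by (simp add: gamma_density_def erlang_density_def Gamma_numeral
      fact_numeral)
qed (simp add: gamma_density_def erlang_density_def)

section \<open>Law of the overlap and its limit\<close>

lemma sets_cond_eigenvalue_law[measurable_cong]: "sets (cond_eigenvalue_law N)
    = sets (eigenvalue_gaussian N)"
  by (simp add: cond_eigenvalue_law_def Let_def)

lemma measurable_diagonal_overlap[measurable]: "diagonal_overlap N \<in> borel_measurable (cond_schur_law N)"
proof -
  let ?M = "cond_schur_law N"
  have "fst \<in> measurable ?M (eigenvalue_gaussian N)"
      "(\<lambda>\<omega>. fst (snd \<omega>)) \<in> measurable ?M (upper_gaussian_law N)"
    "(\<lambda>\<omega>. snd (snd \<omega>)) \<in> measurable ?M (upper_gaussian_law N)"
    unfolding cond_schur_law_def by measurable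
  moreover have "measurable ?M \<nu> = borel_measurable ?M" by (rule measurable_cong_sets) simp_all
  ultimately have *: "i \<in> {2..N} \<Longrightarrow> (\<lambda>\<omega>. fst \<omega> i) \<in> borel_measurable ?M"
    "p \<in> upper_pairs N \<Longrightarrow> (\<lambda>\<omega>. fst (snd \<omega>) p) \<in> borel_measurable ?M"
    "p \<in> upper_pairs N \<Longrightarrow> (\<lambda>\<omega>. snd (snd \<omega>) p) \<in> borel_measurable ?M" for i p
    by (auto simp: upper_gaussian_law_def dest: measurable_compose[OF _ measurable_component_singleton])
  have "(\<lambda>\<omega>. left_sq_norm N (fst \<omega>) (fst (snd \<omega>)) (snd (snd \<omega>))) \<in> borel_measurable ?M"
    using * by (intro measurable_left_sq_norm) auto
  moreover have "{\<omega> \<in> space ?M. \<forall>i\<in>{2..N}. fst \<omega> i \<noteq> 0} \<in> sets ?M"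
  proof -
    have "Measurable.pred ?M (\<lambda>\<omega>. fst \<omega> i \<noteq> 0)" if "i \<in> {2..N}" for i
      using *(1)[OF that] by measurable
    then show ?thesis by (intro sets.sets_Collect_finite_All) (auto simp: pred_def)
  qed
  ultimately have "(\<lambda>\<omega>. if \<forall>i\<in>{2..N}. fst \<omega> i \<noteq> 0 then left_sq_norm N (fst \<omega>) (fst (snd \<omega>))
      (snd (snd \<omega>)) else 0) \<in> borel_measurable ?M"
    by (intro measurable_If) auto
  moreover have "diagonal_overlap N
      = (\<lambda>\<omega>. if \<forall>i\<in>{2..N}. fst \<omega> i \<noteq> 0 then left_sq_norm N (fst \<omega>) (fst (snd \<omega>)) (snd (snd \<omega>)) else 0)"
  proof
    fix \<omega> show "diagonal_overlap N \<omega>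
        = (if \<forall>i\<in>{2..N}. fst \<omega> i \<noteq> 0 then left_sq_norm N (fst \<omega>) (fst (snd \<omega>)) (snd (snd \<omega>)) else 0)"
      by (cases \<omega>) (simp add: diagonal_overlap_eq)
  qed
  ultimately show ?thesis by simp
qed

lemma prob_space_upper_gaussian_law: "prob_space (upper_gaussian_law N)"
  unfolding upper_gaussian_law_def by (rule prob_space_gaussian_family)

lemma prob_space_cond_schur_law: "prob_space (cond_schur_law N)"
proof -
  interpret E: prob_space "cond_eigenvalue_law N" by (rule prob_space_cond_eigenvalue_law)
  interpret U: prob_space "upper_gaussian_law N" by (rule prob_space_upper_gaussian_law)
  interpret UU: pair_prob_space "upper_gaussian_law N" "upper_gaussian_law N" ..
  interpret UU': prob_space "upper_gaussian_law N \<Otimes>\<^sub>M upper_gaussian_law N" by unfold_locales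
  interpret P: pair_prob_space "cond_eigenvalue_law N" "upper_gaussian_law N \<Otimes>\<^sub>M upper_gaussian_law N" ..
  show ?thesis unfolding cond_schur_law_def by unfold_locales
qed

text \<open>
  The \<open>k\<close>-th factor is \<open>(2k + 4) (2k + 5) / ((2k + 4 + m) (2k + 5 + m))\<close>, so that the product runs
  over all consecutive integers from \<open>4\<close> to \<open>2n + 3\<close> and collapses to factorials.
\<close>

lemma prod_beta_moments:
  "(\<Prod>k<n. radial_moment (overlap_factor m) (2 * k + 3) / fact (2 * k + 3))
      = fact (m + 3) * fact (2 * n + 3) / (6 * fact (2 * n + 3 + m))"
proof (induction n)
  case 0
  then show ?case by (simp add: fact_numeral add.commute)
next
  case (Suc n)
  have "(\<Prod>k<Suc n. radial_moment (overlap_factor m) (2 * k + 3) / fact (2 * k + 3)) =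
    fact (m + 3) * fact (2 * n + 3) / (6 * fact (2 * n + 3 + m))
        * (fact (2 * n + 5) / (real (2 * n + 3 + m + 1) * real (2 * n + 3 + m + 2)) / fact (2 * n + 3))"
    unfolding prod.lessThan_Suc Suc.IH by (simp add: radial_moment_overlap_factor add_ac)
  also have "\<dots> = fact (m + 3) * fact (2 * n + 5)
      / (6 * (real (2 * n + 3 + m + 2) * real (2 * n + 3 + m + 1) * fact (2 * n + 3 + m)))"
    by simp
  also have "real (2 * n + 3 + m + 2) * real (2 * n + 3 + m + 1) * fact (2 * n + 3 + m)
      = (fact (2 * n + 5 + m) :: real)"
  proof -
    have "2 * n + 5 + m = Suc (Suc (2 * n + 3 + m))" by simp
    then show ?thesis by (simp only: fact_Suc) (simp add: add_ac)
  qed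
  finally show ?case by (simp add: add_ac)
qed

text \<open>
  Combines the conditional expectation given the eigenvalues with Kostlan's theorem. Vectors with some
  \<open>\<lambda>\<^sub>i = 0\<close>, where the overlap is set to \<open>0\<close>, carry no weight.
\<close>

lemma nn_integral_inverse_overlap_power:
  "(\<integral>\<^sup>+ \<omega>. ennreal (inverse (diagonal_overlap (n + 1) \<omega>) ^ m) \<partial>cond_schur_law (n + 1)) =
    ennreal (fact (m + 3) * fact (2 * n + 3) / (6 * fact (2 * n + 3 + m)))"
proof -
  let ?N = "n + 1"
  let ?U = "upper_gaussian_law ?N" and ?E = "cond_eigenvalue_law ?N"
  let ?G = "\<lambda>lam. ennreal (\<Prod>i\<in>{2..?N}. overlap_factor m ((cmod (lam i))\<^sup>2))"
  interpret E: prob_space ?E by (rule prob_space_cond_eigenvalue_law)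
  interpret U: prob_space ?U by (rule prob_space_upper_gaussian_law)
  interpret UU: pair_prob_space ?U ?U ..
  have om: "(\<lambda>\<omega>. ennreal (inverse (diagonal_overlap ?N \<omega>) ^ m)) \<in> borel_measurable (?E \<Otimes>\<^sub>M (?U \<Otimes>\<^sub>M ?U))"
    using measurable_diagonal_overlap[of ?N] unfolding cond_schur_law_def by measurable
  have Gm: "?G \<in> borel_measurable (eigenvalue_gaussian ?N)" by measurable
  have inner: "(\<integral>\<^sup>+ p. ennreal (inverse (diagonal_overlap ?N (lam, p)) ^ m) \<partial>(?U \<Otimes>\<^sub>M ?U)) = ?G lam"
    if "lam \<in> space ?E" and nz: "\<forall>i\<in>{2..?N}. lam i \<noteq> 0" for lam
  proof -
    have m: "(\<lambda>p. ennreal (inverse (diagonal_overlap ?N (lam, p)) ^ m)) \<in> borel_measurable (?U \<Otimes>\<^sub>M ?U)"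
      using measurable_Pair2[OF om that(1)] .
    have "(\<integral>\<^sup>+ p. ennreal (inverse (diagonal_overlap ?N (lam, p)) ^ m) \<partial>(?U \<Otimes>\<^sub>M ?U)) =
      (\<integral>\<^sup>+ u. \<integral>\<^sup>+ v. ennreal (inverse (diagonal_overlap ?N (lam, u, v)) ^ m) \<partial>?U \<partial>?U)"
      by (rule U.nn_integral_fst[OF m, symmetric])
    also have "\<dots> = (\<integral>\<^sup>+ u. \<integral>\<^sup>+ v. ennreal (inverse (left_sq_norm (Suc n) lam u v) ^ m) \<partial>?U \<partial>?U)"
      using nz by (simp add: diagonal_overlap_eq)
    also have "\<dots> = ?G lam"
      using nn_integral_left_sq_norm[of n lam m] nz by simp
    finally show ?thesis .
  qed
  have zero: "cond_eigenvalue_weight ?N lam = 0" if "\<not> (\<forall>i\<in>{2..?N}. lam i \<noteq> 0)" for lam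
  proof -
    from that have "(\<Prod>i\<in>{2..?N}. cmod (lam i) ^ 4) = 0" by (intro prod_zero) auto
    then show ?thesis by (simp only: cond_eigenvalue_weight_def mult_zero_left)
  qed
  have "(\<integral>\<^sup>+ \<omega>. ennreal (inverse (diagonal_overlap ?N \<omega>) ^ m) \<partial>cond_schur_law ?N) =
    (\<integral>\<^sup>+ lam. \<integral>\<^sup>+ p. ennreal (inverse (diagonal_overlap ?N (lam, p)) ^ m) \<partial>(?U \<Otimes>\<^sub>M ?U) \<partial>?E)"
    unfolding cond_schur_law_def by (rule UU.P.nn_integral_fst[OF om, symmetric])
  also have "\<dots> = (\<integral>\<^sup>+ lam. ?G lam \<partial>?E)"
  proof -
    have "(\<lambda>lam. \<integral>\<^sup>+ p. ennreal (inverse (diagonal_overlap ?N (lam, p)) ^ m) \<partial>(?U \<Otimes>\<^sub>M ?U))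
        \<in> borel_measurable ?E"
      by (rule UU.P.borel_measurable_nn_integral_fst[OF om])
    then have "(\<lambda>lam. \<integral>\<^sup>+ p. ennreal (inverse (diagonal_overlap ?N (lam, p)) ^ m) \<partial>(?U \<Otimes>\<^sub>M ?U))
        \<in> borel_measurable (eigenvalue_gaussian ?N)"
      by (simp cong: measurable_cong_sets add: sets_cond_eigenvalue_law)
    moreover have "ennreal (cond_eigenvalue_weight ?N lam)
        * (\<integral>\<^sup>+ p. ennreal (inverse (diagonal_overlap ?N (lam, p)) ^ m) \<partial>(?U \<Otimes>\<^sub>M ?U)) =
       ennreal (cond_eigenvalue_weight ?N lam) * ?G lam" if "lam \<in> space (eigenvalue_gaussian ?N)" for lam
      using inner[of lam] zero[of lam] that sets_eq_imp_space_eq[OF sets_cond_eigenvalue_law[of ?N]]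
      by (cases "\<forall>i\<in>{2..?N}. lam i \<noteq> 0") auto
    ultimately show ?thesis
      using Gm by (simp only: nn_integral_cond_eigenvalue_law cong: nn_integral_cong)
  qed
  also have "\<dots> = ennreal (\<Prod>k<n. radial_moment (overlap_factor m) (2 * k + 3) / fact (2 * k + 3))"
    by (intro nn_integral_cond_eigenvalue_product overlap_factor_bounds) auto
  finally show ?thesis unfolding prod_beta_moments .
qed

lemma diagonal_overlap_range: "diagonal_overlap N \<omega> = 0 \<or> 1 \<le> diagonal_overlap N \<omega>"
proof (cases "N = 0")
  case True
  then show ?thesis by (cases \<omega>) (auto simp: diagonal_overlap_eq left_sq_norm_def)
next
  case False
  then show ?thesis using left_sq_norm_ge_1[of N] by (cases \<omega>) (auto simp: diagonal_overlap_eq)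
qed

lemma integral_inverse_overlap_eq_beta:
  fixes f :: "real \<Rightarrow> real"
  assumes [measurable]: "f \<in> borel_measurable borel" and f: "continuous_on UNIV f"
  shows "(\<integral>\<omega>. f (inverse (diagonal_overlap (n + 2) \<omega>)) \<partial>cond_schur_law (n + 2))
      = (\<integral>y. f y \<partial>density lborel (\<lambda>y. ennreal (beta_density n y)))"
proof -
  let ?Y = "\<lambda>\<omega>. inverse (diagonal_overlap (n + 2) \<omega>)"
  let ?P = "distr (cond_schur_law (n + 2)) borel ?Y" and ?Q
      = "density lborel (\<lambda>y. ennreal (beta_density n y))"
  interpret S: prob_space "cond_schur_law (n + 2)" by (rule prob_space_cond_schur_law)
  interpret Q: real_distribution ?Q by (rule real_distribution_beta)
  have range: "0 \<le> ?Y \<omega>" "?Y \<omega> \<le> 1" for \<omega>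
    using diagonal_overlap_range[of "n + 2" \<omega>] by (auto simp: inverse_le_1_iff)
  have "(\<integral>\<omega>. f (?Y \<omega>) \<partial>cond_schur_law (n + 2)) = (\<integral>x. f x \<partial>?P)"
    by (rule integral_distr[symmetric]) measurable
  also have "\<dots> = (\<integral>x. f x \<partial>?Q)"
  proof (rule integral_eq_of_moments_eq)
    show "real_distribution ?P" by (intro S.real_distribution_distr) measurable
    show "real_distribution ?Q" by (rule real_distribution_beta)
    show P01: "AE x in ?P. x \<in> {0..1}" using range by (subst AE_distr_iff) auto
    show Q01: "AE x in ?Q. x \<in> {0..1}"
      by (subst AE_density) (auto simp: beta_density_def split: split_indicator)
    show "continuous_on {0..1} f" using f continuous_on_subset by blast
    fix m :: nat
    let ?c = "fact (m + 3) * fact (2 * n + 5) / (6 * fact (2 * n + 5 + m)) :: real"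
    have "(\<integral>x. x ^ m \<partial>?P) = (\<integral>\<omega>. ?Y \<omega> ^ m \<partial>cond_schur_law (n + 2))"
      by (rule integral_distr) measurable
    also have "\<dots> = ?c"
      using nn_integral_inverse_overlap_power[of "n + 1" m] range
      by (intro integral_eq_nn_integral[THEN trans]) (auto simp: numeral_Bit1 simp del: fact_Suc)
    finally have 1: "(\<integral>x. x ^ m \<partial>?P) = ?c" .
    have "(\<integral>x. x ^ m \<partial>?Q) = enn2real (\<integral>\<^sup>+ x. ennreal (x ^ m) \<partial>?Q)"
      using Q01 by (intro integral_eq_nn_integral) auto
    also have "(\<integral>\<^sup>+ x. ennreal (x ^ m) \<partial>?Q) = ennreal ?c"
      by (subst nn_integral_density) (auto simp only: nn_integral_beta_density_power, measurable)
    finally have "(\<integral>x. x ^ m \<partial>?Q) = ?c" by (simp del: fact_Suc)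
    with 1 show "(\<integral>x. x ^ m \<partial>?P) = (\<integral>x. x ^ m \<partial>?Q)" by simp
  qed measurable
  finally show ?thesis .
qed

lemma continuous_cts_step: "a < b \<Longrightarrow> continuous_on UNIV (cts_step a b)"
  by (intro uniformly_continuous_imp_continuous cts_step_uniformly_continuous)

text \<open>
  For \<open>N = n + 2\<close> the inverse overlap has density \<open>beta_density n\<close>. For \<open>N \<le> 1\<close> it is constant, but these
  two terms do not affect the limit.
\<close>

lemma weak_conv_inverse_overlap:
  fixes \<Gamma> :: "real measure"
  defines "\<Gamma> \<equiv> density lborel (\<lambda>t. ennreal (erlang_density 3 1 t))"
  shows "weak_conv_m (\<lambda>N. distr (cond_schur_law N) borel
      (\<lambda>\<omega>. 2 * real N * inverse (diagonal_overlap N \<omega>))) \<Gamma>"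
proof (rule integral_cts_step_conv_imp_weak_conv)
  fix N
  interpret S: prob_space "cond_schur_law N" by (rule prob_space_cond_schur_law)
  show "real_distribution (distr (cond_schur_law N) borel
      (\<lambda>\<omega>. 2 * real N * inverse (diagonal_overlap N \<omega>)))"
    by (intro S.real_distribution_distr) measurable
next
  have "prob_space \<Gamma>" unfolding \<Gamma>_def by (rule prob_space_erlang_density) simp
  then show "real_distribution \<Gamma>" by (simp add: real_distribution_def real_distribution_axioms_def \<Gamma>_def)
next
  fix a b :: real assume ab: "a < b"
  let ?h = "cts_step a b"
  have [measurable]: "?h \<in> borel_measurable borel"
    using continuous_cts_step[OF ab] by (rule borel_measurable_continuous_onI)
  have h: "\<bar>?h x\<bar> \<le> 1" for x using ab by (auto simp: cts_step_def)
  have eq: "(\<integral>x. ?h x \<partial>distr (cond_schur_law (n + 2)) borel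
      (\<lambda>\<omega>. 2 * real (n + 2) * inverse (diagonal_overlap (n + 2) \<omega>))) =
    (\<integral>y. ?h ((2 * real n + 4) * y) \<partial>density lborel (\<lambda>y. ennreal (beta_density n y)))" for n
  proof -
    have "(\<integral>x. ?h x \<partial>distr (cond_schur_law (n + 2)) borel
        (\<lambda>\<omega>. 2 * real (n + 2) * inverse (diagonal_overlap (n + 2) \<omega>))) =
       (\<integral>\<omega>. ?h (2 * real (n + 2) * inverse (diagonal_overlap (n + 2) \<omega>)) \<partial>cond_schur_law (n + 2))"
      by (rule integral_distr) measurable
    also have "\<dots> = (\<integral>y. ?h (2 * real (n + 2) * y) \<partial>density lborel (\<lambda>y. ennreal (beta_density n y)))"
      by (rule integral_inverse_overlap_eq_beta[where f = "\<lambda>y. ?h (2 * real (n + 2) * y)"])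
         (measurable, intro continuous_on_compose2[OF continuous_cts_step[OF ab]] continuous_intros, auto)
    also have "\<dots> = (\<integral>y. ?h ((2 * real n + 4) * y) \<partial>density lborel (\<lambda>y. ennreal (beta_density n y)))"
      by (simp add: add.commute)
    finally show ?thesis .
  qed
  have "(\<integral>x. ?h x \<partial>\<Gamma>) = (\<integral>t. erlang_density 3 1 t * ?h t \<partial>lborel)"
    unfolding \<Gamma>_def by (subst integral_density) auto
  then have "(\<lambda>n. \<integral>x. ?h x \<partial>distr (cond_schur_law (n + 2)) borel
      (\<lambda>\<omega>. 2 * real (n + 2) * inverse (diagonal_overlap (n + 2) \<omega>))) \<longlonglongrightarrow> (\<integral>x. ?h x \<partial>\<Gamma>)"
    unfolding eq using integral_rescaled_beta_tendsto[of ?h] h by simp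
  then show "(\<lambda>N. \<integral>x. ?h x \<partial>distr (cond_schur_law N) borel
      (\<lambda>\<omega>. 2 * real N * inverse (diagonal_overlap N \<omega>))) \<longlonglongrightarrow> (\<integral>x. ?h x \<partial>\<Gamma>)"
    by (rule LIMSEQ_offset)
qed

text \<open>
  Continuous mapping for \<open>inverse\<close>, whose only discontinuity is at \<open>0\<close>.
\<close>

lemma weak_conv_m_inverse:
  fixes \<mu> :: "nat \<Rightarrow> real measure" and \<Gamma> :: "real measure"
  assumes \<mu>: "\<And>n. real_distribution (\<mu> n)" and \<Gamma>: "real_distribution \<Gamma>" and conv: "weak_conv_m \<mu> \<Gamma>" and
      zero: "emeasure \<Gamma> {0} = 0"
  shows "weak_conv_m (\<lambda>n. distr (\<mu> n) borel inverse) (distr \<Gamma> borel inverse)"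
proof (rule integral_cts_step_conv_imp_weak_conv)
  interpret \<Gamma>: real_distribution \<Gamma> by fact
  show "real_distribution (distr \<Gamma> borel inverse)" by simp
  show "real_distribution (distr (\<mu> n) borel inverse)" for n
  proof -
    interpret M: real_distribution "\<mu> n" by fact
    show ?thesis by simp
  qed
  have sets: "sets (\<mu> n) = sets borel" for n
    using \<mu>[of n] by (simp add: real_distribution.events_eq_borel)
  fix a b :: real assume ab: "a < b"
  let ?h = "cts_step a b"
  have [measurable]: "?h \<in> borel_measurable borel"
    using continuous_cts_step[OF ab] by (rule borel_measurable_continuous_onI)
  have "isCont (\<lambda>x. ?h (inverse x)) x" if "x \<noteq> 0" for x
  proof (rule isCont_o2[where f = inverse and g = ?h])
    show "isCont inverse x" using that by (intro continuous_intros)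
    show "isCont ?h (inverse x)"
      using continuous_cts_step[OF ab] by (simp add: continuous_on_eq_continuous_at)
  qed
  then have "{x. \<not> isCont (\<lambda>x. ?h (inverse x)) x} \<subseteq> {0}" by auto
  then have "emeasure \<Gamma> {x. \<not> isCont (\<lambda>x. ?h (inverse x)) x} = 0"
    using emeasure_mono[of _ "{0}" \<Gamma>] zero
        by (metis (no_types, lifting) \<Gamma>.events_eq_borel borel_singleton le_zero_eq sets.empty_sets)
  then have "(\<lambda>n. \<integral>x. ?h (inverse x) \<partial>\<mu> n) \<longlonglongrightarrow> (\<integral>x. ?h (inverse x) \<partial>\<Gamma>)"
    by (intro weak_conv_imp_bdd_ae_continuous_conv[OF \<mu> \<Gamma> conv, where B = 1]) (auto simp: cts_step_def)
  then show "(\<lambda>n. \<integral>x. ?h x \<partial>distr (\<mu> n) borel inverse) \<longlonglongrightarrow> (\<integral>x. ?h x \<partial>distr \<Gamma> borel inverse)"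
    by (simp add: integral_distr sets cong: measurable_cong_sets)
qed

theorem theorem3p5:
  fixes M :: "'a measure" and \<gamma>\<^sub>4 :: "'a \<Rightarrow> real"
  assumes "prob_space M"
    and "distributed M lborel \<gamma>\<^sub>4 (\<lambda>t. ennreal (gamma_density 4 t))"
  shows "weak_conv_m
           (\<lambda>N. distr (cond_schur_law N) borel (\<lambda>\<omega>. diagonal_overlap N \<omega> / (2 * real N)))
           (distr M borel (\<lambda>x. inverse (\<gamma>\<^sub>4 x)))"
proof -
  interpret M: prob_space M by fact
  define \<Gamma> where "\<Gamma> = density lborel (\<lambda>t. ennreal (erlang_density 3 1 t))"
  let ?\<mu> = "\<lambda>N. distr (cond_schur_law N) borel (\<lambda>\<omega>. 2 * real N * inverse (diagonal_overlap N \<omega>))"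
  have [measurable]: "\<gamma>\<^sub>4 \<in> borel_measurable M"
    using distributed_measurable[OF assms(2)] by simp
  have "distr M borel \<gamma>\<^sub>4 = distr M lborel \<gamma>\<^sub>4" by (rule distr_cong) auto
  also have "\<dots> = density lborel (\<lambda>t. ennreal (gamma_density 4 t))"
    by (rule distributed_distr_eq_density[OF assms(2)])
  also have "\<dots> = \<Gamma>"
    by (simp only: \<Gamma>_def gamma_density_4)
  finally have \<Gamma>: "distr M borel \<gamma>\<^sub>4 = \<Gamma>" .
  have "emeasure \<Gamma> {0} = 0"
    unfolding \<Gamma>_def by (subst emeasure_density)
        (auto simp: nn_integral_0_iff_AE intro!: AE_I[where N = "{0}"])
  moreover have "real_distribution (?\<mu> N)" for N
  proof -
    interpret S: prob_space "cond_schur_law N" by (rule prob_space_cond_schur_law)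
    show ?thesis by (intro S.real_distribution_distr) measurable
  qed
  moreover have "real_distribution \<Gamma>"
    unfolding \<Gamma>[symmetric] by (intro M.real_distribution_distr) measurable
  ultimately have "weak_conv_m (\<lambda>N. distr (?\<mu> N) borel inverse) (distr \<Gamma> borel inverse)"
    using weak_conv_inverse_overlap unfolding \<Gamma>_def[symmetric] by (intro weak_conv_m_inverse)
  (* also for a vanishing overlap, since inverse 0 = 0 *)
  moreover have "distr (?\<mu> N) borel inverse
      = distr (cond_schur_law N) borel (\<lambda>\<omega>. diagonal_overlap N \<omega> / (2 * real N))" for N
    by (subst distr_distr) (auto simp: comp_def field_simps intro!: distr_cong)
  moreover have "distr \<Gamma> borel inverse = distr M borel (\<lambda>x. inverse (\<gamma>\<^sub>4 x))"
    unfolding \<Gamma>[symmetric] by (subst distr_distr) (auto simp: comp_def)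
  ultimately show ?thesis by simp
qed

end
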